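(* Let $\Lambda$ be a domestic string algebra. If $u$ is a semi-bridge (respectively, a torsion reverse semi-bridge) then $u$ is an arch bridge (respectively, a torsion reverse arch bridge).
   Context: STRINGS. $\mathcal K$ is an algebraically closed field. A string algebra is $\Lambda=\mathcal K\mathcal Q/\langle\rho\rangle$ with $\mathcal Q=(Q_0,Q_1,s,t)$ a finite quiver and $\rho$ a set of paths of length $\ge2$, none a subpath of another, such that: every vertex is the source of at most two and the target of at most two arrows; for every arrow $b$ there is at most one arrow $a$ with $s(a)=t(b)$, $ab\notin\rho$, and at most one arrow $c$ with $t(c)=s(b)$, $bc\notin\rho$; all sufficiently long paths have a subpath in $\rho$. Words are composed from right to left. Fix $\sigma,\varepsilon:Q_1\to\{1,-1\}$ with $\sigma(a)=-\sigma(b)$ for distinct arrows with the same source, $\varepsilon(a)=-\varepsilon(b)$ for distinct arrows with the same target, and $\sigma(a)=-\varepsilon(b)$ whenever $s(a)=t(b)$ and $ab\notin\rho$. Syllables are arrows (direct) and their formal inverses (inverse), with $s(a^{-1})=t(a)$, $t(a^{-1})=s(a)$, $\sigma(a^{-1})=\varepsilon(a)$, $\varepsilon(a^{-1})=\sigma(a)$. A string of length $n>0$ is a word $\alpha_n\cdots\alpha_1$ of syllables with $s(\alpha_{i+1})=t(\alpha_i)$, $\alpha_{i+1}\ne\alpha_i^{-1}$, and no subword in $\rho\cup\rho^{-1}$; its first syllable is $\alpha_1$ (determining $s,\sigma$) and its last is $\alpha_n$ (determining $t,\varepsilon$). For each vertex $v$ and $i\in\{1,-1\}$ there is a length-$0$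 string $1_{(v,i)}$ with $s=t=v$, $\sigma=-i$, $\varepsilon=i$; $x1_{(v,i)}=x$ is defined iff $s(x)=v,\sigma(x)=-i$, and $1_{(v,i)}x=x$ is defined iff $t(x)=v,\varepsilon(x)=i$. If $z=yx$ is a string then $x$ is called a left substring of $z$. A band is a string $b$ with $s(b)=t(b)$ whose first syllable is inverse and last syllable is direct, such that $b^n$ is a string for all $n\ge1$ and $b$ is not a proper power of a string. $\Lambda$ is domestic if it has only finitely many bands. A string is band-free if no substring of it is a cyclic permutation of a band. Distinct strings $x_1,x_2$ with the same $s$ and $\sigma$ fork if their maximal common left substring is a proper left substring of both. REDUCTIONS. For a band $b$ and a string $y$, $N(b,y)$ is the largest $n$ with $y=y_2(b')^ny_1$ for some strings $y_1,y_2$ and some cyclic permutation $b'$ of $b$; $\mathfrak B(y)$ is the set of bands $b$ (up to cyclic permutation) with $N(b,y)>0$. A 1-step $b$-reduction of $y$ is a string $y_2y_1$ where $y=y_2b'y_1$ with $b'$ a cyclic permutation of $b$; when it exists it is denoted $\mathrm R_b(y)$. The skeleton $\{y\}$ is obtained by applying, for every $b\in\mathfrak B(y)$, the operation $\mathrm R_b$ exactly $N(b,y)-1$ times. Strings $y_1,y_2$ are H-equivalent, $y_1\equiv_H y_2$, if $t(y_1)=t(y_2)$ and for each string $x$ with $s(x)=t(y_1)$, $xy_1$ is a string iff $xy_2$ is a string. A 1-step H-reduction of $y$ is a string $y_2y_1$, where $y=y_2b'y_1$ with $b'$ a cyclic permutation of a band and $b'y_1\equiv_H y_1$. Set $\mathfrak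 h_b(y)=\mathrm R_b(y)$ if $b\in\mathfrak B(y)$, $\mathrm R_b(y)$ exists and is a 1-step H-reduction of $y$; otherwise $\mathfrak h_b(y)=y$. ARROWS. Fix a set $Q_0^{\mathrm{Ba}}$ of representatives of bands up to cyclic permutation. For $b_1,b_2\in Q_0^{\mathrm{Ba}}$, a weak bridge $u:b_1\to b_2$ is a band-free string $u$ such that $b_2ub_1$ is a string, excluding the trivial ones $1_{(t(b),\varepsilon(b))}:b\to b$. A weak reverse half bridge $u:b\to1_{(v,j)}$ ($b\in Q_0^{\mathrm{Ba}}$) is a band-free string $u$ such that $1_{(v,j)}ub$ is a string. Write $\mathfrak s(u),\mathfrak t(u)$ for source and target. A weak reverse half bridge $u$ from $b$ is torsion if $ub$ and $b^2$ fork and, for every weak bridge $u':b\to b'$, the strings $ub$ and $b'u'b$ fork; it is maximal if it is not a proper left substring of another weak reverse half bridge from $b$. The exit $\beta(u)$ of a weak bridge (resp. torsion weak reverse half bridge) $u$ from $b_1$: write $\mathfrak t(u)ub_1=\beta_n\cdots\beta_1b_1$ and let $\beta(u)=\beta_k$ with $k$ minimal such that $\beta_k\cdots\beta_1b_1$ is not a substring of a power of $b_1$. Composition: for a weak bridge $u_1$ and a weak bridge (or weak reverse half bridge) $u_2$ with $\mathfrak t(u_1)=\mathfrak s(u_2)=b$, $u_2\circ u_1:=u_2u_1$ if this is a weak bridge (weak reverse half bridge) $\mathfrak s(u_1)\to\mathfrak t(u_2)$; if $N(b,u_2u_1)=1$ and $\mathrm R_b(u_2u_1)$ exists and is a weak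 bridge (weak reverse half bridge) $\mathfrak s(u_1)\to\mathfrak t(u_2)$, then $u_2\circ u_1:=\mathrm R_b(u_2u_1)$; otherwise it is undefined. SEMI-BRIDGES. A weak bridge (resp. torsion weak reverse half bridge) $u$ is a semi-bridge (resp. torsion reverse semi-bridge) if for every non-trivial factorization $u=u_2\circ u_1$ with $u_1$ a weak bridge one has $\beta(u)\ne\beta(u_1)$. ARCH BRIDGES. For a path $P=(u_1,\dots,u_n)$, $n\ge1$, with $\mathfrak t(u_j)=\mathfrak s(u_{j+1})$, $u_1,\dots,u_{n-1}$ weak bridges and $u_n$ a weak bridge or a maximal torsion weak reverse half bridge, put $\mathfrak s(P)=\mathfrak s(u_1)$, $\mathfrak t(P)=\mathfrak t(u_n)$ and define the string $\mathfrak h(P)$ by $$\mathfrak t(P)\,\mathfrak h(P)\,\mathfrak s(P)=\mathfrak h_{\mathfrak t(u_1)}\cdots\mathfrak h_{\mathfrak t(u_{n-1})}\big(\{\mathfrak t(u_n)u_n\cdots\mathfrak t(u_1)u_1\mathfrak s(u_1)\}\big).$$ A weak bridge (resp. torsion weak reverse half bridge) $u$ is an arch bridge (resp. torsion reverse arch bridge) if $u\ne\mathfrak h(P)$ for every such path $P$ of length at least $2$ with $\mathfrak s(P)=\mathfrak s(u)$, $\mathfrak t(P)=\mathfrak t(u)$. *)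

theory Defs
  imports
    "Graph_Theory.Digraph"
    "HOL-Library.Sublist"
    "HOL-Algebra.Algebraic_Closure"
begin

section \<open>String algebras\<close>

text \<open>
  Words are composed from right to left and are stored in the written order: the word
  \<open>x\<^sub>n \<dots> x\<^sub>1\<close> is the list \<open>[x\<^sub>n, \<dots>, x\<^sub>1]\<close>.  Hence concatenation of words is \<open>@\<close>, the
  first syllable \<open>x\<^sub>1\<close> is the \<open>last\<close> element of the list, and the last syllable \<open>x\<^sub>n\<close>
  is its \<open>hd\<close>.
\<close>

record ('v, 'a) bound_quiver =
  quiver :: "('v, 'a) pre_digraph"
  rels :: "'a list set"
  sgn_src :: "'a \<Rightarrow> int"
  sgn_tgt :: "'a \<Rightarrow> int"

text \<open>
  \<open>s = tail\<close> and \<open>t = head\<close>; \<open>sgn_src\<close> and \<open>sgn_tgt\<close> are the functions \<open>\<sigma>\<close> and \<open>\<epsilon>\<close>.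
\<close>

abbreviation asrc :: "('v, 'a) bound_quiver \<Rightarrow> 'a \<Rightarrow> 'v" where
  "asrc \<Lambda> \<equiv> tail (quiver \<Lambda>)"

abbreviation atgt :: "('v, 'a) bound_quiver \<Rightarrow> 'a \<Rightarrow> 'v" where
  "atgt \<Lambda> \<equiv> head (quiver \<Lambda>)"

abbreviation arrows :: "('v, 'a) bound_quiver \<Rightarrow> 'a set" where
  "arrows \<Lambda> \<equiv> arcs (quiver \<Lambda>)"

text \<open>Paths of positive length.\<close>

definition is_path :: "('v, 'a) bound_quiver \<Rightarrow> 'a list \<Rightarrow> bool" where
  "is_path \<Lambda> p \<longleftrightarrow> p \<noteq> [] \<and> set p \<subseteq> arrows \<Lambda> \<and> successively (\<lambda>a b. asrc \<Lambda> a = atgt \<Lambda> b) p"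

definition sign_functions :: "('v, 'a) bound_quiver \<Rightarrow> bool" where
  "sign_functions \<Lambda> \<longleftrightarrow>
     (\<forall>a \<in> arrows \<Lambda>. sgn_src \<Lambda> a \<in> {1, -1} \<and> sgn_tgt \<Lambda> a \<in> {1, -1}) \<and>
     (\<forall>a \<in> arrows \<Lambda>. \<forall>b \<in> arrows \<Lambda>.
        (a \<noteq> b \<and> asrc \<Lambda> a = asrc \<Lambda> b \<longrightarrow> sgn_src \<Lambda> a = - sgn_src \<Lambda> b) \<and>
        (a \<noteq> b \<and> atgt \<Lambda> a = atgt \<Lambda> b \<longrightarrow> sgn_tgt \<Lambda> a = - sgn_tgt \<Lambda> b) \<and>
        (asrc \<Lambda> a = atgt \<Lambda> b \<and> [a, b] \<notin> rels \<Lambda> \<longrightarrow> sgn_src \<Lambda> a = - sgn_tgt \<Lambda> b))"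

text \<open>
  The algebra is given by its presentation: the ground field \<open>K\<close>, the quiver and the
  monomial relations, together with the chosen sign functions.  Strings, bands and everything
  built from them depend only on \<open>\<Lambda>\<close>, not on \<open>K\<close>.
\<close>

definition string_algebra :: "'k ring \<Rightarrow> ('v, 'a) bound_quiver \<Rightarrow> bool" where
  "string_algebra K \<Lambda> \<longleftrightarrow>
     algebraically_closed K \<and>
     fin_digraph (quiver \<Lambda>) \<and>
     (\<forall>r \<in> rels \<Lambda>. is_path \<Lambda> r \<and> length r \<ge> 2) \<and>
     (\<forall>r \<in> rels \<Lambda>. \<forall>r' \<in> rels \<Lambda>. r \<noteq> r' \<longrightarrow> \<not> sublist r r') \<and>
     (\<forall>v \<in> verts (quiver \<Lambda>).
        card {a \<in> arrows \<Lambda>. asrc \<Lambda> a = v} \<le> 2 \<and> card {a \<in> arrows \<Lambda>. atgt \<Lambda> a = v} \<le> 2) \<and>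
     (\<forall>b \<in> arrows \<Lambda>.
        card {a \<in> arrows \<Lambda>. asrc \<Lambda> a = atgt \<Lambda> b \<and> [a, b] \<notin> rels \<Lambda>} \<le> 1 \<and>
        card {c \<in> arrows \<Lambda>. atgt \<Lambda> c = asrc \<Lambda> b \<and> [b, c] \<notin> rels \<Lambda>} \<le> 1) \<and>
     (\<exists>n. \<forall>p. is_path \<Lambda> p \<and> length p \<ge> n \<longrightarrow> (\<exists>r \<in> rels \<Lambda>. sublist r p)) \<and>
     sign_functions \<Lambda>"


section \<open>Strings\<close>

datatype 'a syllable = is_direct: Dir (arrow_of: 'a) | Inv (arrow_of: 'a)

fun syl_inv :: "'a syllable \<Rightarrow> 'a syllable" where
  "syl_inv (Dir a) = Inv a"
| "syl_inv (Inv a) = Dir a"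

fun syl_src :: "('v, 'a) bound_quiver \<Rightarrow> 'a syllable \<Rightarrow> 'v" where
  "syl_src \<Lambda> (Dir a) = asrc \<Lambda> a"
| "syl_src \<Lambda> (Inv a) = atgt \<Lambda> a"

fun syl_tgt :: "('v, 'a) bound_quiver \<Rightarrow> 'a syllable \<Rightarrow> 'v" where
  "syl_tgt \<Lambda> (Dir a) = atgt \<Lambda> a"
| "syl_tgt \<Lambda> (Inv a) = asrc \<Lambda> a"

fun syl_sig :: "('v, 'a) bound_quiver \<Rightarrow> 'a syllable \<Rightarrow> int" where
  "syl_sig \<Lambda> (Dir a) = sgn_src \<Lambda> a"
| "syl_sig \<Lambda> (Inv a) = sgn_tgt \<Lambda> a"

fun syl_eps :: "('v, 'a) bound_quiver \<Rightarrow> 'a syllable \<Rightarrow> int" where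
  "syl_eps \<Lambda> (Dir a) = sgn_tgt \<Lambda> a"
| "syl_eps \<Lambda> (Inv a) = sgn_src \<Lambda> a"

text \<open>\<open>Triv v i\<close> is the string \<open>1\<^bsub>(v,i)\<^esub>\<close>; \<open>Syl []\<close> is junk and is never a string.\<close>

datatype ('v, 'a) qword = Triv 'v int | Syl "'a syllable list"

fun syls :: "('v, 'a) qword \<Rightarrow> 'a syllable list" where
  "syls (Triv v i) = []"
| "syls (Syl w) = w"

fun src :: "('v, 'a) bound_quiver \<Rightarrow> ('v, 'a) qword \<Rightarrow> 'v" where
  "src \<Lambda> (Triv v i) = v"
| "src \<Lambda> (Syl w) = syl_src \<Lambda> (last w)"

fun tgt :: "('v, 'a) bound_quiver \<Rightarrow> ('v, 'a) qword \<Rightarrow> 'v" where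
  "tgt \<Lambda> (Triv v i) = v"
| "tgt \<Lambda> (Syl w) = syl_tgt \<Lambda> (hd w)"

fun sig :: "('v, 'a) bound_quiver \<Rightarrow> ('v, 'a) qword \<Rightarrow> int" where
  "sig \<Lambda> (Triv v i) = - i"
| "sig \<Lambda> (Syl w) = syl_sig \<Lambda> (last w)"

fun eps :: "('v, 'a) bound_quiver \<Rightarrow> ('v, 'a) qword \<Rightarrow> int" where
  "eps \<Lambda> (Triv v i) = i"
| "eps \<Lambda> (Syl w) = syl_eps \<Lambda> (hd w)"

fun is_string :: "('v, 'a) bound_quiver \<Rightarrow> ('v, 'a) qword \<Rightarrow> bool" where
  "is_string \<Lambda> (Triv v i) \<longleftrightarrow> v \<in> verts (quiver \<Lambda>) \<and> i \<in> {1, -1}"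
| "is_string \<Lambda> (Syl w) \<longleftrightarrow>
     w \<noteq> [] \<and> arrow_of ` set w \<subseteq> arrows \<Lambda> \<and>
     successively (\<lambda>\<beta> \<alpha>. syl_src \<Lambda> \<beta> = syl_tgt \<Lambda> \<alpha> \<and> \<beta> \<noteq> syl_inv \<alpha>) w \<and>
     (\<forall>r \<in> rels \<Lambda>. \<not> sublist (map Dir r) w \<and> \<not> sublist (rev (map Inv r)) w)"

text \<open>The partial product of strings; \<open>composable \<Lambda> y x\<close> says that \<open>y x\<close> is defined and a string.\<close>

fun composable :: "('v, 'a) bound_quiver \<Rightarrow> ('v, 'a) qword \<Rightarrow> ('v, 'a) qword \<Rightarrow> bool" where
  "composable \<Lambda> (Triv v i) x \<longleftrightarrow> tgt \<Lambda> x = v \<and> eps \<Lambda> x = i"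
| "composable \<Lambda> (Syl y) (Triv v i) \<longleftrightarrow> src \<Lambda> (Syl y) = v \<and> sig \<Lambda> (Syl y) = - i"
| "composable \<Lambda> (Syl y) (Syl x) \<longleftrightarrow> is_string \<Lambda> (Syl (y @ x))"

fun cat :: "('v, 'a) qword \<Rightarrow> ('v, 'a) qword \<Rightarrow> ('v, 'a) qword" where
  "cat (Triv v i) x = x"
| "cat (Syl y) (Triv v i) = Syl y"
| "cat (Syl y) (Syl x) = Syl (y @ x)"

text \<open>
  \<open>prd \<Lambda> [x\<^sub>n, \<dots>, x\<^sub>1] = Some z\<close> means: the \<open>x\<^sub>i\<close> are strings, their product
  \<open>x\<^sub>n \<dots> x\<^sub>1\<close> is defined and it is the string \<open>z\<close>.
\<close>

fun prd :: "('v, 'a) bound_quiver \<Rightarrow> ('v, 'a) qword list \<Rightarrow> ('v, 'a) qword option" where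
  "prd \<Lambda> [] = None"
| "prd \<Lambda> [x] = (if is_string \<Lambda> x then Some x else None)"
| "prd \<Lambda> (x # y # zs) =
     (case prd \<Lambda> (y # zs) of
        None \<Rightarrow> None
      | Some z \<Rightarrow> if is_string \<Lambda> x \<and> composable \<Lambda> x z then Some (cat x z) else None)"

definition substring :: "('v, 'a) bound_quiver \<Rightarrow> ('v, 'a) qword \<Rightarrow> ('v, 'a) qword \<Rightarrow> bool" where
  "substring \<Lambda> x z \<longleftrightarrow> (\<exists>y2 y1. prd \<Lambda> [y2, x, y1] = Some z)"

definition left_substring :: "('v, 'a) bound_quiver \<Rightarrow> ('v, 'a) qword \<Rightarrow> ('v, 'a) qword \<Rightarrow> bool" where
  "left_substring \<Lambda> x z \<longleftrightarrow> (\<exists>y. prd \<Lambda> [y, x] = Some z)"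

definition proper_left_substring ::
    "('v, 'a) bound_quiver \<Rightarrow> ('v, 'a) qword \<Rightarrow> ('v, 'a) qword \<Rightarrow> bool" where
  "proper_left_substring \<Lambda> x z \<longleftrightarrow> left_substring \<Lambda> x z \<and> x \<noteq> z"

definition fork :: "('v, 'a) bound_quiver \<Rightarrow> ('v, 'a) qword \<Rightarrow> ('v, 'a) qword \<Rightarrow> bool" where
  "fork \<Lambda> x1 x2 \<longleftrightarrow>
     is_string \<Lambda> x1 \<and> is_string \<Lambda> x2 \<and> x1 \<noteq> x2 \<and> src \<Lambda> x1 = src \<Lambda> x2 \<and> sig \<Lambda> x1 = sig \<Lambda> x2 \<and>
     (\<exists>w. left_substring \<Lambda> w x1 \<and> left_substring \<Lambda> w x2 \<and>
          (\<forall>w'. left_substring \<Lambda> w' x1 \<and> left_substring \<Lambda> w' x2 \<longrightarrow> left_substring \<Lambda> w' w) \<and>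
          proper_left_substring \<Lambda> w x1 \<and> proper_left_substring \<Lambda> w x2)"


section \<open>Bands\<close>

definition band :: "('v, 'a) bound_quiver \<Rightarrow> ('v, 'a) qword \<Rightarrow> bool" where
  "band \<Lambda> b \<longleftrightarrow>
     is_string \<Lambda> b \<and> syls b \<noteq> [] \<and> src \<Lambda> b = tgt \<Lambda> b \<and>
     \<not> is_direct (last (syls b)) \<and> is_direct (hd (syls b)) \<and>
     (\<forall>n \<ge> 1. prd \<Lambda> (replicate n b) \<noteq> None) \<and>
     \<not> (\<exists>x. \<exists>n \<ge> 2. prd \<Lambda> (replicate n x) = Some b)"

definition cyclic_perm :: "('v, 'a) qword \<Rightarrow> ('v, 'a) qword \<Rightarrow> bool" where
  "cyclic_perm b b' \<longleftrightarrow> (\<exists>w k. b = Syl w \<and> b' = Syl (rotate k w))"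

definition domestic :: "('v, 'a) bound_quiver \<Rightarrow> bool" where
  "domestic \<Lambda> \<longleftrightarrow> finite {b. band \<Lambda> b}"

definition band_free :: "('v, 'a) bound_quiver \<Rightarrow> ('v, 'a) qword \<Rightarrow> bool" where
  "band_free \<Lambda> y \<longleftrightarrow> \<not> (\<exists>b b'. band \<Lambda> b \<and> cyclic_perm b b' \<and> substring \<Lambda> b' y)"

definition band_representatives :: "('v, 'a) bound_quiver \<Rightarrow> ('v, 'a) qword set \<Rightarrow> bool" where
  "band_representatives \<Lambda> B \<longleftrightarrow>
     B \<subseteq> {b. band \<Lambda> b} \<and> (\<forall>b. band \<Lambda> b \<longrightarrow> (\<exists>!b0. b0 \<in> B \<and> cyclic_perm b b0))"


section \<open>Reductions\<close>

definition band_mult :: "('v, 'a) bound_quiver \<Rightarrow> ('v, 'a) qword \<Rightarrow> ('v, 'a) qword \<Rightarrow> nat" where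
  "band_mult \<Lambda> b y =
     (GREATEST n. \<exists>y2 b' y1. cyclic_perm b b' \<and> prd \<Lambda> (y2 # replicate n b' @ [y1]) = Some y)"

text \<open>Here and below \<open>B\<close> is a set of representatives of the bands up to cyclic permutation.\<close>

definition bands_in ::
    "('v, 'a) bound_quiver \<Rightarrow> ('v, 'a) qword set \<Rightarrow> ('v, 'a) qword \<Rightarrow> ('v, 'a) qword set" where
  "bands_in \<Lambda> B y = {b \<in> B. band_mult \<Lambda> b y > 0}"

definition band_reduction ::
    "('v, 'a) bound_quiver \<Rightarrow> ('v, 'a) qword \<Rightarrow> ('v, 'a) qword \<Rightarrow> ('v, 'a) qword \<Rightarrow> bool" where
  "band_reduction \<Lambda> b y z \<longleftrightarrow>
     (\<exists>y2 b' y1. cyclic_perm b b' \<and> prd \<Lambda> [y2, b', y1] = Some y \<and> prd \<Lambda> [y2, y1] = Some z)"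

text \<open>
  \<open>R\<^sub>b(y)\<close>; meaningful only if a one-step \<open>b\<close>-reduction of \<open>y\<close> exists, i.e. if
  \<open>\<exists>z. band_reduction \<Lambda> b y z\<close>.
\<close>

definition red :: "('v, 'a) bound_quiver \<Rightarrow> ('v, 'a) qword \<Rightarrow> ('v, 'a) qword \<Rightarrow> ('v, 'a) qword" where
  "red \<Lambda> b y = (SOME z. band_reduction \<Lambda> b y z)"

text \<open>
  The skeleton: the multiplicities are those of the original string \<open>y\<close>, and the bands of
  \<open>y\<close> are processed in some order.
\<close>

definition skeleton ::
    "('v, 'a) bound_quiver \<Rightarrow> ('v, 'a) qword set \<Rightarrow> ('v, 'a) qword \<Rightarrow> ('v, 'a) qword" where
  "skeleton \<Lambda> B y =
     (SOME z. \<exists>bs. distinct bs \<and> set bs = bands_in \<Lambda> B y \<and>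
                   z = fold (\<lambda>b. red \<Lambda> b ^^ (band_mult \<Lambda> b y - 1)) bs y)"

definition H_equiv :: "('v, 'a) bound_quiver \<Rightarrow> ('v, 'a) qword \<Rightarrow> ('v, 'a) qword \<Rightarrow> bool" where
  "H_equiv \<Lambda> y1 y2 \<longleftrightarrow>
     is_string \<Lambda> y1 \<and> is_string \<Lambda> y2 \<and> tgt \<Lambda> y1 = tgt \<Lambda> y2 \<and>
     (\<forall>x. is_string \<Lambda> x \<and> src \<Lambda> x = tgt \<Lambda> y1 \<longrightarrow>
          (prd \<Lambda> [x, y1] \<noteq> None \<longleftrightarrow> prd \<Lambda> [x, y2] \<noteq> None))"

definition H_reduction :: "('v, 'a) bound_quiver \<Rightarrow> ('v, 'a) qword \<Rightarrow> ('v, 'a) qword \<Rightarrow> bool" where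
  "H_reduction \<Lambda> y z \<longleftrightarrow>
     (\<exists>b y2 b' y1 w. band \<Lambda> b \<and> cyclic_perm b b' \<and> prd \<Lambda> [y2, b', y1] = Some y \<and>
        prd \<Lambda> [b', y1] = Some w \<and> H_equiv \<Lambda> w y1 \<and> prd \<Lambda> [y2, y1] = Some z)"

definition H_red ::
    "('v, 'a) bound_quiver \<Rightarrow> ('v, 'a) qword set \<Rightarrow> ('v, 'a) qword \<Rightarrow> ('v, 'a) qword \<Rightarrow> ('v, 'a) qword"
where
  "H_red \<Lambda> B b y =
     (if b \<in> bands_in \<Lambda> B y \<and> (\<exists>z. band_reduction \<Lambda> b y z) \<and> H_reduction \<Lambda> y (red \<Lambda> b y)
      then red \<Lambda> b y else y)"


section \<open>Weak bridges and weak reverse half bridges\<close>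

text \<open>
  An arrow \<open>u : \<ss>(u) \<rightarrow> \<tt>(u)\<close> consists of a string and its end points; \<open>source\<close> is a band and
  \<open>target\<close> is a band or a string \<open>Triv v j\<close>.
\<close>

datatype ('v, 'a) arrow =
  Arrow (source: "('v, 'a) qword") (str: "('v, 'a) qword") (target: "('v, 'a) qword")

text \<open>\<open>1\<^bsub>(t(b),\<epsilon>(b))\<^esub>\<close>\<close>

definition triv_at :: "('v, 'a) bound_quiver \<Rightarrow> ('v, 'a) qword \<Rightarrow> ('v, 'a) qword" where
  "triv_at \<Lambda> b = Triv (tgt \<Lambda> b) (eps \<Lambda> b)"

definition weak_bridge :: "('v, 'a) bound_quiver \<Rightarrow> ('v, 'a) qword set \<Rightarrow> ('v, 'a) arrow \<Rightarrow> bool" where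
  "weak_bridge \<Lambda> B u \<longleftrightarrow>
     source u \<in> B \<and> target u \<in> B \<and> is_string \<Lambda> (str u) \<and> band_free \<Lambda> (str u) \<and>
     prd \<Lambda> [target u, str u, source u] \<noteq> None \<and>
     \<not> (source u = target u \<and> str u = triv_at \<Lambda> (source u))"

definition weak_rhb :: "('v, 'a) bound_quiver \<Rightarrow> ('v, 'a) qword set \<Rightarrow> ('v, 'a) arrow \<Rightarrow> bool" where
  "weak_rhb \<Lambda> B u \<longleftrightarrow>
     source u \<in> B \<and> (\<exists>v j. target u = Triv v j) \<and> is_string \<Lambda> (str u) \<and> band_free \<Lambda> (str u) \<and>
     prd \<Lambda> [target u, str u, source u] \<noteq> None"

definition torsion :: "('v, 'a) bound_quiver \<Rightarrow> ('v, 'a) qword set \<Rightarrow> ('v, 'a) arrow \<Rightarrow> bool" where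
  "torsion \<Lambda> B u \<longleftrightarrow>
     weak_rhb \<Lambda> B u \<and>
     (let b = source u; ub = the (prd \<Lambda> [str u, b]) in
        fork \<Lambda> ub (the (prd \<Lambda> [b, b])) \<and>
        (\<forall>u'. weak_bridge \<Lambda> B u' \<and> source u' = b \<longrightarrow>
              fork \<Lambda> ub (the (prd \<Lambda> [target u', str u', b]))))"

definition maximal_rhb :: "('v, 'a) bound_quiver \<Rightarrow> ('v, 'a) qword set \<Rightarrow> ('v, 'a) arrow \<Rightarrow> bool" where
  "maximal_rhb \<Lambda> B u \<longleftrightarrow>
     weak_rhb \<Lambda> B u \<and>
     \<not> (\<exists>u'. weak_rhb \<Lambda> B u' \<and> source u' = source u \<and> proper_left_substring \<Lambda> (str u) (str u'))"

text \<open>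
  The exit: in \<open>\<tt>(u) u \<ss>(u) = \<beta>\<^sub>n \<dots> \<beta>\<^sub>1 \<ss>(u)\<close>, stored as the list \<open>L\<close>, the string
  \<open>\<beta>\<^sub>k \<dots> \<beta>\<^sub>1 \<ss>(u)\<close> is \<open>Syl (drop (n - k) L)\<close> and \<open>\<beta>\<^sub>k = L ! (n - k)\<close>.
\<close>

definition exit_syl :: "('v, 'a) bound_quiver \<Rightarrow> ('v, 'a) arrow \<Rightarrow> 'a syllable" where
  "exit_syl \<Lambda> u =
     (let L = syls (the (prd \<Lambda> [target u, str u, source u]));
          n = length L - length (syls (source u));
          k = (LEAST k. 1 \<le> k \<and> k \<le> n \<and>
                 \<not> (\<exists>m z. prd \<Lambda> (replicate m (source u)) = Some z \<and>
                          substring \<Lambda> (Syl (drop (n - k) L)) z))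
      in L ! (n - k))"

definition compose_arrow ::
    "('v, 'a) bound_quiver \<Rightarrow> ('v, 'a) qword set \<Rightarrow> ('v, 'a) arrow \<Rightarrow> ('v, 'a) arrow \<Rightarrow>
     ('v, 'a) arrow option" where
  "compose_arrow \<Lambda> B u2 u1 =
     (if weak_bridge \<Lambda> B u1 \<and> (weak_bridge \<Lambda> B u2 \<or> weak_rhb \<Lambda> B u2) \<and> target u1 = source u2 then
        (case prd \<Lambda> [str u2, str u1] of
           None \<Rightarrow> None
         | Some y \<Rightarrow>
             (let b = target u1;
                  ok = (\<lambda>u. if weak_bridge \<Lambda> B u2 then weak_bridge \<Lambda> B u else weak_rhb \<Lambda> B u);
                  u = Arrow (source u1) y (target u2);
                  u' = Arrow (source u1) (red \<Lambda> b y) (target u2)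
              in if ok u then Some u
                 else if band_mult \<Lambda> b y = 1 \<and> (\<exists>z. band_reduction \<Lambda> b y z) \<and> ok u' then Some u'
                 else None))
      else None)"


section \<open>Semi-bridges and arch bridges\<close>

text \<open>
  A factorization \<open>u = u2 \<circ> u1\<close> is trivial if one of the factors is an identity
  \<open>1\<^bsub>(t(b),\<epsilon>(b))\<^esub>\<close>; for weak bridges this is already excluded by the definition of \<open>weak_bridge\<close>.
\<close>

definition nontrivial_factorization ::
    "('v, 'a) bound_quiver \<Rightarrow> ('v, 'a) qword set \<Rightarrow> ('v, 'a) arrow \<Rightarrow> ('v, 'a) arrow \<Rightarrow>
     ('v, 'a) arrow \<Rightarrow> bool" where
  "nontrivial_factorization \<Lambda> B u u2 u1 \<longleftrightarrow>
     weak_bridge \<Lambda> B u1 \<and> compose_arrow \<Lambda> B u2 u1 = Some u \<and>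
     \<not> (weak_rhb \<Lambda> B u2 \<and> str u2 = triv_at \<Lambda> (source u2))"

definition semi_bridge :: "('v, 'a) bound_quiver \<Rightarrow> ('v, 'a) qword set \<Rightarrow> ('v, 'a) arrow \<Rightarrow> bool" where
  "semi_bridge \<Lambda> B u \<longleftrightarrow>
     weak_bridge \<Lambda> B u \<and>
     (\<forall>u1 u2. nontrivial_factorization \<Lambda> B u u2 u1 \<longrightarrow> exit_syl \<Lambda> u \<noteq> exit_syl \<Lambda> u1)"

definition torsion_reverse_semi_bridge ::
    "('v, 'a) bound_quiver \<Rightarrow> ('v, 'a) qword set \<Rightarrow> ('v, 'a) arrow \<Rightarrow> bool" where
  "torsion_reverse_semi_bridge \<Lambda> B u \<longleftrightarrow>
     torsion \<Lambda> B u \<and>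
     (\<forall>u1 u2. nontrivial_factorization \<Lambda> B u u2 u1 \<longrightarrow> exit_syl \<Lambda> u \<noteq> exit_syl \<Lambda> u1)"

text \<open>Paths \<open>P = (u\<^sub>1, \<dots>, u\<^sub>n)\<close> are the lists \<open>[u\<^sub>1, \<dots>, u\<^sub>n]\<close>.\<close>

definition arrow_path ::
    "('v, 'a) bound_quiver \<Rightarrow> ('v, 'a) qword set \<Rightarrow> ('v, 'a) arrow list \<Rightarrow> bool" where
  "arrow_path \<Lambda> B P \<longleftrightarrow>
     P \<noteq> [] \<and> successively (\<lambda>u u'. target u = source u') P \<and>
     (\<forall>u \<in> set (butlast P). weak_bridge \<Lambda> B u) \<and>
     (weak_bridge \<Lambda> B (last P) \<or> (torsion \<Lambda> B (last P) \<and> maximal_rhb \<Lambda> B (last P)))"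

text \<open>The string \<open>\<tt>(u\<^sub>n) u\<^sub>n \<dots> \<tt>(u\<^sub>1) u\<^sub>1 \<ss>(u\<^sub>1)\<close>.\<close>

definition path_string ::
    "('v, 'a) bound_quiver \<Rightarrow> ('v, 'a) arrow list \<Rightarrow> ('v, 'a) qword" where
  "path_string \<Lambda> P =
     the (prd \<Lambda> (concat (map (\<lambda>u. [target u, str u]) (rev P)) @ [source (hd P)]))"

text \<open>
  \<open>H_string \<Lambda> B P h\<close> says that \<open>h\<close> is the string \<open>\<hh>(P)\<close>, which is characterised by
  \<open>\<tt>(P) \<hh>(P) \<ss>(P) \<close> being the H-reduced skeleton of \<open>path_string\<close>; such an \<open>h\<close> is unique.
\<close>

definition H_string ::
    "('v, 'a) bound_quiver \<Rightarrow> ('v, 'a) qword set \<Rightarrow> ('v, 'a) arrow list \<Rightarrow> ('v, 'a) qword \<Rightarrow> bool" where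
  "H_string \<Lambda> B P h \<longleftrightarrow>
     prd \<Lambda> [target (last P), h, source (hd P)] =
       Some (foldr (\<lambda>u. H_red \<Lambda> B (target u)) (butlast P) (skeleton \<Lambda> B (path_string \<Lambda> P)))"

definition is_H_reduced_path ::
    "('v, 'a) bound_quiver \<Rightarrow> ('v, 'a) qword set \<Rightarrow> ('v, 'a) arrow \<Rightarrow> bool" where
  "is_H_reduced_path \<Lambda> B u \<longleftrightarrow>
     (\<exists>P. arrow_path \<Lambda> B P \<and> length P \<ge> 2 \<and>
          source (hd P) = source u \<and> target (last P) = target u \<and> H_string \<Lambda> B P (str u))"

definition arch_bridge :: "('v, 'a) bound_quiver \<Rightarrow> ('v, 'a) qword set \<Rightarrow> ('v, 'a) arrow \<Rightarrow> bool" where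
  "arch_bridge \<Lambda> B u \<longleftrightarrow> weak_bridge \<Lambda> B u \<and> \<not> is_H_reduced_path \<Lambda> B u"

definition torsion_reverse_arch_bridge ::
    "('v, 'a) bound_quiver \<Rightarrow> ('v, 'a) qword set \<Rightarrow> ('v, 'a) arrow \<Rightarrow> bool" where
  "torsion_reverse_arch_bridge \<Lambda> B u \<longleftrightarrow> torsion \<Lambda> B u \<and> \<not> is_H_reduced_path \<Lambda> B u"

end

theory Submission
  imports Defs
begin

text \<open>
  Reading words from right to left, strings are recognized by a deterministic automaton whose states
  are the classes of words with the same extensions. Relations are paths, so a word with both direct
  and inverse syllables determines the state, whatever was read before it. Hence every band is the
  label of a cycle, and domesticity means that distinct cycles are disjoint and that one cannot get
  from one cycle to another and back.

  Suppose \<open>u = \<hh>(u\<^sub>1, \<dots>, u\<^sub>n)\<close> with \<open>n \<ge> 2\<close>, and let \<open>b = \<ss>(u\<^sub>n)\<close>. Each deletion of a band performed by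
  the skeleton or by an H-reduction removes a closed walk along a cycle, so the string
  \<open>\<tt>(u) u \<ss>(u)\<close> still passes through the cycle of \<open>b\<close>, at a point from which, after enough turns,
  one reads \<open>\<tt>(u) u\<^sub>n b\<close>. The shortest \<open>v\<close> for which \<open>b v \<ss>(u)\<close> is obtained by following the string
  to this point and then the cycle is a weak bridge, and \<open>u = u\<^sub>n \<circ> v\<close>. Both \<open>u\<close> and \<open>v\<close>
  leave the cycle of \<open>\<ss>(u)\<close> before they meet the one of \<open>b\<close>, so they have the same exit, and \<open>u\<close> is
  not a semi-bridge.
\<close>

section \<open>Conjugate words\<close>

text \<open>The operations do not say where they cut: \<open>red\<close> and \<open>skeleton\<close>
  are choices, the band witnessing an H-reduction is not tied to the one that \<open>red\<close>
  deletes, and the copy of b read before the last arrow may itself be cut. Since loops at one state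
  commute, all deletions of one band from one string agree. The damage to b is absorbed by the
  invariant \<open>linked\<close>, which remembers only a place on the cycle of b where copies can
  be pumped back in; it survives the deletion of loops on cycles that reach b. So no cycle met after
  b may lose a loop, although the last arrow and the target band are read after b. Here the normal
  form of bands enters: an overlap that does not fix the state has syllables of one kind only,
  direct at b and inverse at the target band. A suffix condition in the invariant keeps the copy of
  \<ss>(u) that is read first. Minimality of v makes v band-free, and at most one pumped copy of b
  then remains to be deleted, which is the single reduction that the composition of arrows
  permits.\<close>

abbreviation wpow :: "nat \<Rightarrow> 'c list \<Rightarrow> 'c list" where
  "wpow n w \<equiv> concat (replicate n w)"

lemma wpow_add: "wpow (m + n) w = wpow m w @ wpow n w"
  by (simp add: replicate_add)

lemma wpow_commute: "wpow n w @ w = w @ wpow n w"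
  by (induction n) auto

lemma wpow_commute_append: "wpow n w @ w @ z = w @ wpow n w @ z"
  using wpow_commute[of n w] by (metis append.assoc)

lemma length_wpow: "length (wpow n w) = n * length w"
  by (induction n) auto

lemma wpow_mult: "wpow m (wpow n w) = wpow (m * n) w"
  by (induction m) (auto simp: replicate_add)

lemma wpow_conj:
  assumes "x @ b = c @ x"
  shows "x @ wpow n b = wpow n c @ x"
proof (induction n)
  case (Suc n)
  have "x @ wpow (Suc n) b = c @ x @ wpow n b"
    using assms by (metis append.assoc concat.simps(2) replicate_Suc)
  with Suc show ?case by simp
qed simp

lemma wpow_rotate: "wpow n (s @ t) @ s = s @ wpow n (t @ s)"
  using wpow_conj[of s "t @ s" "s @ t" n] by simp

definition rot :: "'c list \<Rightarrow> 'c list \<Rightarrow> bool" where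
  "rot b c \<longleftrightarrow> (\<exists>s t. b = s @ t \<and> c = t @ s)"

lemma rot_refl [simp]: "rot b b"
  unfolding rot_def by (metis append_Nil append_Nil2)

lemma rot_sym: "rot b c \<Longrightarrow> rot c b"
  unfolding rot_def by blast

lemma rot_iff_rotate: "rot b c \<longleftrightarrow> (\<exists>k. c = rotate k b)"
  unfolding rot_def by (metis append_take_drop_id rotate_append rotate_drop_take)

lemma rot_trans: "rot a b \<Longrightarrow> rot b c \<Longrightarrow> rot a c"
  unfolding rot_iff_rotate by (metis rotate_rotate)

lemma rot_length: "rot b c \<Longrightarrow> length c = length b"
  unfolding rot_def by auto

lemma rot_set: "rot b c \<Longrightarrow> set c = set b"
  unfolding rot_def by auto

text \<open>As long as \<open>x\<close> is at least as long as \<open>c\<close>, a copy of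
  \<open>c\<close> can be cancelled from its front; once \<open>x\<close> is shorter,
  \<open>c\<close> begins with \<open>x\<close> and the equation displays both words as rotations of
  each other.\<close>

lemma conj_rot: "x @ b = c @ x \<Longrightarrow> rot b c"
proof (induction "length x" arbitrary: x rule: less_induct)
  case less
  show ?case
  proof (cases "length x < length c")
    case True
    obtain y where "c = x @ y"
      using less.prems True by (metis append_eq_append_conv_if append_take_drop_id less_imp_le)
    with less.prems have "b = y @ x" by simp
    then show ?thesis using \<open>c = x @ y\<close> unfolding rot_def by blast
  next
    case False
    then obtain y where y: "x = c @ y"
      using less.prems by (metis append_eq_append_conv_if append_take_drop_id not_less)
    with less.prems have eq: "y @ b = c @ y" by simp
    show ?thesis
    proof (cases "c = []")
      case True
      with eq show ?thesis by simp
    next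
      case False
      with y have "length y < length x" by simp
      from less.hyps[OF this eq] show ?thesis .
    qed
  qed
qed

lemma rot_Nil [simp]: "rot [] c \<longleftrightarrow> c = []"
  unfolding rot_def by auto

text \<open>The shift \<open>d\<close> between the two places of deletion satisfies
  \<open>w @ d = d @ w'\<close>. This will identify the band cut out by an H-reduction with the one
  cut out by \<open>red\<close>, when only the results are known to agree.\<close>

lemma rot_if_same_deletion:
  assumes "p @ w @ q = p' @ w' @ q'" and "p @ q = p' @ q'" and "length w = length w'"
  shows "rot w w'"
proof -
  have *: "rot w w'" if "p @ w @ q = p' @ w' @ q'" "p @ q = p' @ q'"
    "length w = length w'" "length p \<le> length p'" for p p' q q' w w' :: "'a list"
  proof -
    from that(2,4) obtain d where d: "p' = p @ d" "q = d @ q'"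
      by (auto simp: append_eq_append_conv2)
    with that have "w @ d = d @ w'" by simp
    then have "rot w' w" by (metis conj_rot)
    then show ?thesis by (rule rot_sym)
  qed
  show ?thesis
  proof (cases "length p \<le> length p'")
    case True
    with *[OF assms] show ?thesis by blast
  next
    case False
    then have "rot w' w" using *[of p' w' q' p w q] assms by simp
    then show ?thesis by (rule rot_sym)
  qed
qed

text \<open>If \<open>r @ x\<close> is a walk along the cycle \<open>b\<close> back to its starting
  point, then \<open>c\<close> is the cycle as seen from the intermediate point where
  \<open>x\<close> ends.\<close>

lemma factor_of_conj:
  assumes "r @ x @ b = b @ r @ x"
  shows "\<exists>c. x @ b = c @ x \<and> r @ c = b @ r"
proof -
  define c where "c = drop (length r) (b @ r)"
  have "x @ b = drop (length r) ((b @ r) @ x)"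
    using assms by (metis append.assoc append_eq_conv_conj)
  then have 1: "x @ b = c @ x"
    by (simp add: c_def)
  have "take (length r) (b @ r) = take (length r) (b @ r @ x)" by simp
  also have "\<dots> = r" using assms by (metis append_eq_conv_conj)
  finally have "r @ c = b @ r" unfolding c_def by (metis append_take_drop_id)
  with 1 show ?thesis by blast
qed

lemma commute_wpow_imp_commute:
  assumes "wpow n p @ q = q @ wpow n p" and "n \<ge> 1"
  shows "p @ q = q @ p"
proof (cases "p = []")
  case False
  \<comment> \<open>A multiple of \<open>n\<close>, so that \<open>?P\<close> is a power of
    \<open>wpow n p\<close> and commutes with \<open>q\<close>, and large enough to compare the two
    sides of \<open>p @ ?P = ?P @ p\<close> on their first \<open>length (p @ q)\<close> letters:
    these are \<open>p @ q\<close> and \<open>q @ p\<close>.\<close>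
  define N where "N = n * (length p + length q)"
  let ?P = "wpow N p"
  have "?P = wpow (length p + length q) (wpow n p)"
    by (simp only: wpow_mult) (simp add: N_def mult.commute)
  moreover have "q @ wpow k (wpow n p) = wpow k (wpow n p) @ q" for k
    by (rule wpow_conj) (simp add: assms(1))
  ultimately have comm: "?P @ q = q @ ?P" by metis
  have "N * length p \<ge> N * 1" using False by (intro mult_le_mono2) (cases p, auto)
  moreover have "N \<ge> length p + length q" unfolding N_def using assms(2) by (cases n) auto
  ultimately have len: "length ?P \<ge> length (p @ q)" 
    unfolding length_wpow length_append by linarith
  have "take (length (p @ q)) (p @ ?P) = p @ q"
  proof -
    have "take (length q) ?P = take (length q) (?P @ q)" using len by simp
    also have "\<dots> = q" by (simp add: comm)
    finally show ?thesis by simp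
  qed
  moreover have "take (length (p @ q)) (?P @ p) = q @ p"
  proof -
    have "take (length (p @ q)) (?P @ p) = take (length (p @ q)) (?P @ q)" using len by simp
    also have "\<dots> = q @ take (length p) ?P" by (simp add: comm)
    also have "take (length p) ?P = take (length p) (?P @ p)" using len by simp
    also have "\<dots> = p" by (simp add: wpow_commute)
    finally show ?thesis .
  qed
  ultimately show ?thesis by (simp add: wpow_commute)
qed simp

section \<open>Primitive words and roots\<close>

definition primitive :: "'c list \<Rightarrow> bool" where
  "primitive b \<longleftrightarrow> b \<noteq> [] \<and> (\<forall>n x. b = wpow n x \<longrightarrow> n = 1)"

lemma primitive_rot:
  assumes "primitive b" and "rot b c"
  shows "primitive c"
  unfolding primitive_def
proof (intro conjI allI impI)
  show "c \<noteq> []" using assms rot_sym[OF assms(2)] by (auto simp: primitive_def)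
  fix n x assume c: "c = wpow n x"
  have r1: "\<exists>x'. rotate1 (wpow n x) = wpow n x'" for x :: "'a list"
  proof (cases x)
    case (Cons a x')
    have "rotate1 (wpow n x) = wpow n (x' @ [a])"
    proof (cases n)
      case (Suc m)
      then show ?thesis using wpow_rotate[of m x' "[a]"] wpow_commute[of m "x' @ [a]"]
          wpow_rotate[of m "[a]" x']
        by (auto simp: Cons)
    qed simp
    then show ?thesis by blast
  qed (auto intro: exI[of _ "[]"])
  have rk: "\<exists>x'. rotate k (wpow n x) = wpow n x'" for k
  proof (induction k)
    case (Suc k)
    then show ?case using r1 by (metis rotate_Suc)
  qed auto
  obtain k where "b = rotate k c" using rot_sym[OF assms(2)] unfolding rot_iff_rotate by blast
  with c rk obtain x' where "b = wpow n x'" by metis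
  with assms(1) show "n = 1" unfolding primitive_def by blast
qed

lemma commute_primitive:
  assumes "primitive b" and "x @ b = b @ x"
  shows "\<exists>n. x = wpow n b"
proof -
  from comm_append_are_replicate[OF assms(2)]
  obtain m n z where "wpow m z = x" "wpow n z = b" by blast
  moreover from this have "n = 1" using assms(1) unfolding primitive_def by metis
  ultimately show ?thesis by auto
qed

lemma primitive_root:
  assumes "w \<noteq> []"
  shows "\<exists>r n. w = wpow n r \<and> primitive r \<and> n \<ge> 1"
  using assms
proof (induction "length w" arbitrary: w rule: less_induct)
  case less
  show ?case
  proof (cases "primitive w")
    case True
    then show ?thesis by (intro exI[of _ w] exI[of _ 1]) auto
  next
    case False
    then obtain n x where x: "w = wpow n x" "n \<noteq> 1" using less.prems unfolding primitive_def by blast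
    with less.prems have "n > 1" "x \<noteq> []" by (cases n; auto)+
    then have "length x < length w" unfolding x(1) length_wpow by (intro n_less_m_mult_n) auto
    from less.hyps[OF this \<open>x \<noteq> []\<close>] obtain r m where "x = wpow m r" "primitive r" "m \<ge> 1" by blast
    then have "w = wpow (n * m) r" "n * m \<ge> 1" using x(1) \<open>n > 1\<close> wpow_mult by auto
    with \<open>primitive r\<close> show ?thesis by blast
  qed
qed

section \<open>Gluing strings\<close>

definition mixed :: "'a syllable list \<Rightarrow> bool" where
  "mixed w \<longleftrightarrow> (\<exists>\<alpha> \<in> set w. is_direct \<alpha>) \<and> (\<exists>\<alpha> \<in> set w. \<not> is_direct \<alpha>)"

lemma mixed_sublist: "mixed v \<Longrightarrow> sublist v w \<Longrightarrow> mixed w"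
  unfolding mixed_def by (meson set_mono_sublist subsetD)

lemma mixed_append: "mixed v \<Longrightarrow> mixed (x @ v @ y)"
  unfolding mixed_def by auto

lemma mixed_nonempty: "mixed v \<Longrightarrow> v \<noteq> []"
  unfolding mixed_def by auto

lemma mixed_rot: "rot b c \<Longrightarrow> mixed b \<Longrightarrow> mixed c"
  unfolding mixed_def by (simp add: rot_set)

lemma not_mixed_relation: "\<not> mixed (map Dir r)" "\<not> mixed (rev (map Inv r))"
  unfolding mixed_def by auto

lemma sublist_append3:
  assumes "sublist r (x @ v @ y)"
  shows "sublist r (x @ v) \<or> sublist r (v @ y) \<or> sublist v r"
proof -
  from assms obtain p q where eq: "x @ (v @ y) = p @ (r @ q)" unfolding sublist_def by auto
  from iffD1[OF append_eq_append_conv2 eq] obtain z where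
    "x = p @ z \<and> z @ v @ y = r @ q \<or> x @ z = p \<and> v @ y = z @ r @ q" by auto
  then show ?thesis
  proof
    assume *: "x = p @ z \<and> z @ v @ y = r @ q"
    then have eq': "(z @ v) @ y = r @ q" by simp
    from iffD1[OF append_eq_append_conv2 eq'] obtain t where
      "z @ v = r @ t \<or> z @ v @ t = r" by auto
    then show ?thesis
    proof
      assume "z @ v = r @ t"
      then have "x @ v = p @ r @ t" using * by simp
      then show ?thesis unfolding sublist_def by blast
    next
      assume "z @ v @ t = r"
      then show ?thesis unfolding sublist_def by blast
    qed
  next
    assume "x @ z = p \<and> v @ y = z @ r @ q"
    then show ?thesis unfolding sublist_def by blast
  qed
qed

lemma successively_append3:
  "v \<noteq> [] \<Longrightarrow> successively P (x @ v @ y) \<longleftrightarrow> successively P (x @ v) \<and> successively P (v @ y)"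
  by (auto simp: successively_append_iff)

text \<open>The sign is \<open>- sig\<close>, so that \<open>Triv v i\<close> starts and ends at
  \<open>(v, i)\<close> and the condition for two strings to meet is an equality of end point and
  start point.\<close>

fun start_pt :: "('v, 'a) bound_quiver \<Rightarrow> ('v, 'a) qword \<Rightarrow> 'v \<times> int" where
  "start_pt \<Lambda> x = (src \<Lambda> x, - sig \<Lambda> x)"

fun end_pt :: "('v, 'a) bound_quiver \<Rightarrow> ('v, 'a) qword \<Rightarrow> 'v \<times> int" where
  "end_pt \<Lambda> x = (tgt \<Lambda> x, eps \<Lambda> x)"

text \<open>A bare list forgets the base point of a trivial string; \<open>p\<close> restores
  it.\<close>

definition qword_of :: "'v \<times> int \<Rightarrow> 'a syllable list \<Rightarrow> ('v, 'a) qword" where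
  "qword_of p w = (if w = [] then Triv (fst p) (snd p) else Syl w)"

lemma syls_qword_of [simp]: "syls (qword_of p w) = w"
  by (simp add: qword_of_def)

lemma syls_cat: "syls (cat y x) = syls y @ syls x"
  by (cases "(y, x)" rule: cat.cases) auto

lemma Syl_eqI: "syls x = w \<Longrightarrow> w \<noteq> [] \<Longrightarrow> x = Syl w"
  by (cases x) auto

locale string_alg =
  fixes K :: "'k ring" and \<Lambda> :: "('v, 'a) bound_quiver"
  assumes string_algebra: "string_algebra K \<Lambda>"
begin

definition str_ok :: "'a syllable list \<Rightarrow> bool" where
  "str_ok w \<longleftrightarrow> w = [] \<or> is_string \<Lambda> (Syl w)"

lemma relation_length: "r \<in> rels \<Lambda> \<Longrightarrow> length r \<ge> 2"
  using string_algebra unfolding string_algebra_def by blast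

lemma str_ok_Nil [simp]: "str_ok []"
  by (simp add: str_ok_def)

lemma str_ok_iff:
  "str_ok w \<longleftrightarrow> arrow_of ` set w \<subseteq> arrows \<Lambda> \<and>
     successively (\<lambda>\<beta> \<alpha>. syl_src \<Lambda> \<beta> = syl_tgt \<Lambda> \<alpha> \<and> \<beta> \<noteq> syl_inv \<alpha>) w \<and>
     (\<forall>r \<in> rels \<Lambda>. \<not> sublist (map Dir r) w \<and> \<not> sublist (rev (map Inv r)) w)"
  unfolding str_ok_def using relation_length by fastforce

lemma str_ok_sublist:
  assumes "str_ok w" and "sublist v w"
  shows "str_ok v"
proof -
  obtain x y where w: "w = x @ v @ y" using assms(2) unfolding sublist_def by blast
  have "sublist r w" if "sublist r v" for r
    using that assms(2) by (rule sublist_order.order_trans)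
  then show ?thesis using assms(1) unfolding str_ok_iff
    by (auto simp: w successively_append_iff)
qed

lemma str_ok_appendD: "str_ok (x @ y) \<Longrightarrow> str_ok x" "str_ok (x @ y) \<Longrightarrow> str_ok y"
  by (auto elim: str_ok_sublist)

lemma str_ok_no_rel:
  assumes "str_ok w" and "r \<in> rels \<Lambda>"
  shows "\<not> sublist (map Dir r) w" and "\<not> sublist (rev (map Inv r)) w"
  using assms unfolding str_ok_iff by blast+

text \<open>A relation occurring in \<open>x @ v @ y\<close> but in neither of the two overlapping
  parts would contain \<open>v\<close>. Relations are paths, so neither they nor their inverses are
  mixed.\<close>

lemma glue:
  assumes "mixed v" and "str_ok (x @ v)" and "str_ok (v @ y)"
  shows "str_ok (x @ v @ y)"
  unfolding str_ok_iff
proof (intro conjI ballI)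
  show "arrow_of ` set (x @ v @ y) \<subseteq> arrows \<Lambda>" using assms unfolding str_ok_iff by auto
  show "successively (\<lambda>\<beta> \<alpha>. syl_src \<Lambda> \<beta> = syl_tgt \<Lambda> \<alpha> \<and> \<beta> \<noteq> syl_inv \<alpha>) (x @ v @ y)"
    using assms unfolding str_ok_iff successively_append3[OF mixed_nonempty[OF assms(1)]] by blast
  fix r assume r: "r \<in> rels \<Lambda>"
  have *: "\<not> sublist s (x @ v @ y)"
    if "\<not> mixed s" "\<not> sublist s (x @ v)" "\<not> sublist s (v @ y)" for s
    using sublist_append3[of s x v y] that mixed_sublist[OF assms(1)] by blast
  show "\<not> sublist (map Dir r) (x @ v @ y)"
    by (rule *[OF not_mixed_relation(1)]) (use str_ok_no_rel[OF _ r] assms in blast)+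
  show "\<not> sublist (rev (map Inv r)) (x @ v @ y)"
    by (rule *[OF not_mixed_relation(2)]) (use str_ok_no_rel[OF _ r] assms in blast)+
qed

text \<open>A variant of \<open>glue\<close> where the two parts overlap in the single syllable
  \<open>g\<close>: relations have length at least 2, so a new occurrence would contain the turn
  \<open>[d, g]\<close>, which is mixed.\<close>

lemma glue_turn:
  assumes "is_direct d \<noteq> is_direct g" and "str_ok [d, g]" and "str_ok (g # y)"
  shows "str_ok (d # g # y)"
  unfolding str_ok_iff
proof (intro conjI ballI)
  show "arrow_of ` set (d # g # y) \<subseteq> arrows \<Lambda>" using assms unfolding str_ok_iff by auto
  show "successively (\<lambda>\<beta> \<alpha>. syl_src \<Lambda> \<beta> = syl_tgt \<Lambda> \<alpha> \<and> \<beta> \<noteq> syl_inv \<alpha>) (d # g # y)"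
    using assms unfolding str_ok_iff by auto
  fix r assume r: "r \<in> rels \<Lambda>"
  have m: "mixed [d, g]" using assms(1) unfolding mixed_def by auto
  have *: "\<not> sublist s (d # g # y)"
    if "\<not> mixed s" "\<not> sublist s [d, g]" "\<not> sublist s (g # y)" "length s \<ge> 2" for s
  proof
    assume "sublist s (d # g # y)"
    then have "prefix s (d # g # y)" using that(3) by (simp add: sublist_Cons_right)
    then have "sublist [d, g] s" using that(4) by (cases s rule: remdups_adj.cases) auto
    with m that(1) mixed_sublist show False by blast
  qed
  have "length (map Dir r) \<ge> 2" "length (rev (map Inv r)) \<ge> 2" using relation_length[OF r] by auto
  with *[OF not_mixed_relation(1)[of r]] *[OF not_mixed_relation(2)[of r]]
    str_ok_no_rel[OF assms(2) r] str_ok_no_rel[OF assms(3) r]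
  show "\<not> sublist (map Dir r) (d # g # y)" "\<not> sublist (rev (map Inv r)) (d # g # y)"
    by blast+
qed

text \<open>
  \<open>same_ext\<close> is the state of the automaton that reads strings from right to left: the class
  of a word under the right congruence of having the same extensions.
\<close>

definition same_ext :: "'a syllable list \<Rightarrow> 'a syllable list \<Rightarrow> bool" where
  "same_ext a c \<longleftrightarrow> (\<forall>x. str_ok (x @ a) \<longleftrightarrow> str_ok (x @ c))"

lemma same_ext_refl [simp]: "same_ext a a"
  by (simp add: same_ext_def)

lemma same_ext_sym: "same_ext a c \<Longrightarrow> same_ext c a"
  by (simp add: same_ext_def)

lemma same_ext_trans: "same_ext a b \<Longrightarrow> same_ext b c \<Longrightarrow> same_ext a c"
  by (simp add: same_ext_def)

lemma same_ext_append: "same_ext a c \<Longrightarrow> same_ext (x @ a) (x @ c)"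
  unfolding same_ext_def by (metis append.assoc)

lemma same_ext_str_ok: "same_ext a c \<Longrightarrow> str_ok (x @ a) \<longleftrightarrow> str_ok (x @ c)"
  by (simp add: same_ext_def)

lemma same_ext_str_ok0: "same_ext a c \<Longrightarrow> str_ok a \<longleftrightarrow> str_ok c"
  using same_ext_str_ok[of a c "[]"] by simp

lemma reset: "mixed v \<Longrightarrow> str_ok (v @ y) \<Longrightarrow> same_ext (v @ y) v"
  unfolding same_ext_def using glue str_ok_appendD by (metis append.assoc)

text \<open>Syllables of the same direction are governed by the sign condition for nonzero
  compositions, turns by those for distinct arrows with a common source or target. So for nonempty
  words the conditions on end points and signs follow once the concatenation is a string.\<close>

lemma sgn_adjacent:
  assumes "str_ok (\<beta> # \<alpha> # w)"
  shows "syl_src \<Lambda> \<beta> = syl_tgt \<Lambda> \<alpha> \<and> syl_sig \<Lambda> \<beta> = - syl_eps \<Lambda> \<alpha>"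
proof -
  have ok: "str_ok [\<beta>, \<alpha>]" using assms by (rule str_ok_sublist) (auto simp: sublist_Cons_right)
  have s: "sign_functions \<Lambda>" using string_algebra unfolding string_algebra_def by blast
  from ok have arr: "arrow_of \<beta> \<in> arrows \<Lambda>" "arrow_of \<alpha> \<in> arrows \<Lambda>"
    and adj: "syl_src \<Lambda> \<beta> = syl_tgt \<Lambda> \<alpha>" "\<beta> \<noteq> syl_inv \<alpha>"
    and rel: "\<And>r. r \<in> rels \<Lambda> \<Longrightarrow> map Dir r \<noteq> [\<beta>, \<alpha>] \<and> rev (map Inv r) \<noteq> [\<beta>, \<alpha>]"
    unfolding str_ok_iff by auto
  have sgn: "asrc \<Lambda> a = asrc \<Lambda> b \<Longrightarrow> a \<noteq> b \<Longrightarrow> sgn_src \<Lambda> a = - sgn_src \<Lambda> b"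
    "atgt \<Lambda> a = atgt \<Lambda> b \<Longrightarrow> a \<noteq> b \<Longrightarrow> sgn_tgt \<Lambda> a = - sgn_tgt \<Lambda> b"
    "asrc \<Lambda> a = atgt \<Lambda> b \<Longrightarrow> [a, b] \<notin> rels \<Lambda> \<Longrightarrow> sgn_src \<Lambda> a = - sgn_tgt \<Lambda> b"
    if "a \<in> arrows \<Lambda>" "b \<in> arrows \<Lambda>" for a b
    using s that unfolding sign_functions_def by blast+
  have "syl_sig \<Lambda> \<beta> = - syl_eps \<Lambda> \<alpha>"
  proof (cases \<beta>; cases \<alpha>)
    fix a b assume *: "\<beta> = Dir a" "\<alpha> = Dir b"
    with rel[of "[a, b]"] have "[a, b] \<notin> rels \<Lambda>" by auto
    with * arr adj have "sgn_src \<Lambda> a = - sgn_tgt \<Lambda> b" by (intro sgn(3)) auto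
    with * show ?thesis by simp
  next
    fix a b assume *: "\<beta> = Inv a" "\<alpha> = Inv b"
    with rel[of "[b, a]"] have "[b, a] \<notin> rels \<Lambda>" by auto
    with * arr adj have "sgn_src \<Lambda> b = - sgn_tgt \<Lambda> a" by (intro sgn(3)) auto
    with * show ?thesis by simp
  next
    fix a b assume *: "\<beta> = Dir a" "\<alpha> = Inv b"
    with arr adj have "sgn_src \<Lambda> a = - sgn_src \<Lambda> b" by (intro sgn(1)) auto
    with * show ?thesis by simp
  next
    fix a b assume *: "\<beta> = Inv a" "\<alpha> = Dir b"
    with arr adj have "sgn_tgt \<Lambda> a = - sgn_tgt \<Lambda> b" by (intro sgn(2)) auto
    with * show ?thesis by simp
  qed
  with adj(1) show ?thesis by blast
qed

text \<open>This is the uniqueness of the arrow \<open>c\<close> with \<open>t(c) = s(b)\<close> and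
  \<open>bc\<close> not a relation, read for inverse syllables: two different continuations of an
  inverse syllable cannot both be inverse.\<close>

lemma inverse_unique:
  assumes "str_ok (Inv p # Inv r # w)" and "str_ok (Inv q # Inv r # w')"
  shows "p = q"
proof -
  have *: "p \<in> {c \<in> arrows \<Lambda>. atgt \<Lambda> c = asrc \<Lambda> r \<and> [r, c] \<notin> rels \<Lambda>}" "r \<in> arrows \<Lambda>"
    if "str_ok (Inv p # Inv r # w)" for p w
  proof -
    have "str_ok [Inv p, Inv r]" using that by (rule str_ok_sublist) (auto simp: sublist_Cons_right)
    moreover have "[r, p] \<in> rels \<Lambda> \<Longrightarrow> sublist (rev (map Inv [r, p])) [Inv p, Inv r]" by simp
    ultimately show "p \<in> {c \<in> arrows \<Lambda>. atgt \<Lambda> c = asrc \<Lambda> r \<and> [r, c] \<notin> rels \<Lambda>}" "r \<in> arrows \<Lambda>"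
      unfolding str_ok_iff by auto
  qed
  have "card {c \<in> arrows \<Lambda>. atgt \<Lambda> c = asrc \<Lambda> r \<and> [r, c] \<notin> rels \<Lambda>} \<le> 1"
    using *(2)[OF assms(1)] string_algebra unfolding string_algebra_def by blast
  moreover have "fin_digraph (quiver \<Lambda>)"
    using string_algebra unfolding string_algebra_def by blast
  then have "finite {c \<in> arrows \<Lambda>. atgt \<Lambda> c = asrc \<Lambda> r \<and> [r, c] \<notin> rels \<Lambda>}"
    by (simp add: fin_digraph.finite_arcs)
  ultimately show ?thesis
    using *(1)[OF assms(1)] *(1)[OF assms(2)] by (metis (lifting) card_le_Suc0_iff_eq One_nat_def)
qed

section \<open>Partial products of strings\<close>

lemma is_string_Syl: "is_string \<Lambda> (Syl w) \<longleftrightarrow> w \<noteq> [] \<and> str_ok w"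
  unfolding str_ok_def by auto

lemma is_string_str_ok: "is_string \<Lambda> x \<Longrightarrow> str_ok (syls x)"
  by (cases x) (auto simp: str_ok_def)

lemma end_start_pt:
  assumes "str_ok (y @ x)" and "x \<noteq> []" and "y \<noteq> []"
  shows "end_pt \<Lambda> (Syl x) = start_pt \<Lambda> (Syl y)"
proof -
  have "str_ok (last y # hd x # [])"
  proof (rule str_ok_sublist[OF assms(1)])
    have "y @ x = butlast y @ [last y, hd x] @ tl x" using assms by simp
    then show "sublist [last y, hd x] (y @ x)" by (metis sublist_appendI)
  qed
  from sgn_adjacent[OF this] show ?thesis by simp
qed

lemma composable_iff:
  assumes "is_string \<Lambda> x" and "is_string \<Lambda> y"
  shows "composable \<Lambda> y x \<longleftrightarrow> end_pt \<Lambda> x = start_pt \<Lambda> y \<and> str_ok (syls y @ syls x)"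
proof (cases y)
  case (Triv v i)
  then show ?thesis using is_string_str_ok[OF assms(1)] by auto
next
  case y: (Syl b)
  show ?thesis
  proof (cases x)
    case (Triv v i)
    then show ?thesis using is_string_str_ok[OF assms(2)] y by auto
  next
    case (Syl a)
    then show ?thesis using assms y end_start_pt[of b a]
      by (auto simp: is_string_Syl simp del: is_string.simps)
  qed
qed

lemma cat_string:
  assumes "is_string \<Lambda> x" and "is_string \<Lambda> y" and "composable \<Lambda> y x"
  shows "is_string \<Lambda> (cat y x) \<and> start_pt \<Lambda> (cat y x) = start_pt \<Lambda> x \<and>
    end_pt \<Lambda> (cat y x) = end_pt \<Lambda> y"
  using assms by (cases "(y, x)" rule: cat.cases) (auto simp: last_append hd_append)

lemma prd2_iff:
  "prd \<Lambda> [y, x] = Some z \<longleftrightarrow>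
     is_string \<Lambda> x \<and> is_string \<Lambda> y \<and> end_pt \<Lambda> x = start_pt \<Lambda> y \<and> str_ok (syls y @ syls x) \<and>
     z = cat y x"
  using composable_iff[of x y] by auto

lemma prd_ConsD:
  assumes "prd \<Lambda> (x # y # zs) = Some z"
  shows "\<exists>w. prd \<Lambda> (y # zs) = Some w \<and> prd \<Lambda> [x, w] = Some z"
proof -
  obtain w where w: "prd \<Lambda> (y # zs) = Some w" using assms by (auto split: option.splits)
  have "is_string \<Lambda> w" using w
  proof (induction zs arbitrary: y w)
    case Nil
    then show ?case by (auto split: if_splits)
  next
    case (Cons z zs)
    then obtain w' where "prd \<Lambda> (z # zs) = Some w'" "is_string \<Lambda> y" "composable \<Lambda> y w'" "w = cat y w'"
      by (auto split: option.splits if_splits)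
    with Cons.IH cat_string show ?case by blast
  qed
  with w assms show ?thesis by auto
qed

lemma prd_ConsI:
  assumes "prd \<Lambda> (y # zs) = Some w" and "prd \<Lambda> [x, w] = Some z"
  shows "prd \<Lambda> (x # y # zs) = Some z"
  using assms by (auto split: if_splits)

lemma prd_props:
  "prd \<Lambda> xs = Some z \<Longrightarrow> is_string \<Lambda> z \<and> syls z = concat (map syls xs) \<and>
     start_pt \<Lambda> z = start_pt \<Lambda> (last xs) \<and> end_pt \<Lambda> z = end_pt \<Lambda> (hd xs)"
proof (induction xs arbitrary: z)
  case (Cons x xs)
  show ?case
  proof (cases xs)
    case Nil
    with Cons.prems show ?thesis by (auto split: if_splits)
  next
    case (Cons y zs)
    with Cons.prems obtain w where w: "prd \<Lambda> xs = Some w" "prd \<Lambda> [x, w] = Some z"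
      using prd_ConsD by blast
    have "is_string \<Lambda> w" "is_string \<Lambda> x" "composable \<Lambda> x w" "z = cat x w"
      using w(2) by (auto split: if_splits)
    with Cons.IH[OF w(1)] cat_string[of w x] Cons show ?thesis
      by (simp add: syls_cat del: start_pt.simps end_pt.simps)
  qed
qed simp

end

section \<open>Bands as cycles\<close>

context string_alg
begin

abbreviation bandw :: "'a syllable list \<Rightarrow> bool" where
  "bandw b \<equiv> band \<Lambda> (Syl b)"

lemma prd_replicate:
  assumes "x \<noteq> []" and "str_ok (wpow (Suc n) x)"
  shows "prd \<Lambda> (replicate (Suc n) (Syl x)) = Some (Syl (wpow (Suc n) x))"
  using assms(2)
proof (induction n)
  case 0
  then show ?case using assms(1) by (simp add: is_string_Syl del: is_string.simps)
next
  case (Suc n)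
  have "str_ok (wpow (Suc n) x)" "str_ok x"
    using Suc.prems str_ok_appendD[of x "wpow (Suc n) x"] by simp_all
  with Suc have "prd \<Lambda> (replicate (Suc n) (Syl x)) = Some (Syl (wpow (Suc n) x))" by blast
  moreover have "prd \<Lambda> [Syl x, Syl (wpow (Suc n) x)] = Some (Syl (wpow (Suc (Suc n)) x))"
    using \<open>str_ok (wpow (Suc n) x)\<close> \<open>str_ok x\<close> Suc.prems assms(1)
    by (simp add: is_string_Syl del: is_string.simps)
  ultimately show ?case using prd_ConsI[of "Syl x" "replicate n (Syl x)"]
    by (metis replicate_Suc)
qed

lemma band_nonempty: "bandw b \<Longrightarrow> b \<noteq> []"
  unfolding band_def by simp

lemma band_hd: "bandw b \<Longrightarrow> is_direct (hd b)"
  unfolding band_def by simp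

lemma band_last: "bandw b \<Longrightarrow> \<not> is_direct (last b)"
  unfolding band_def by simp

lemma band_mixed: "bandw b \<Longrightarrow> mixed b"
  unfolding mixed_def using band_nonempty band_hd band_last by (meson hd_in_set last_in_set)

lemma band_wpow: "bandw b \<Longrightarrow> str_ok (wpow n b)"
proof (cases n)
  case (Suc m)
  assume "bandw b"
  moreover have "n \<ge> 1" using Suc by simp
  ultimately have "prd \<Lambda> (replicate n (Syl b)) \<noteq> None" unfolding band_def by blast
  then obtain z where "prd \<Lambda> (replicate n (Syl b)) = Some z" by blast
  from prd_props[OF this] have "is_string \<Lambda> z" "syls z = wpow n b"
    by (simp_all add: map_replicate)
  then show ?thesis using is_string_str_ok by metis
qed simp

lemma band_primitive:
  assumes "bandw b"
  shows "primitive b"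
  unfolding primitive_def
proof (intro conjI allI impI)
  show "b \<noteq> []" using band_nonempty assms by blast
  fix n x assume b: "b = wpow n x"
  show "n = 1"
  proof (rule ccontr)
    assume "n \<noteq> 1"
    with b \<open>b \<noteq> []\<close> have "n \<ge> 2" "x \<noteq> []" by (cases n; auto)+
    then obtain m where m: "n = Suc m" by (cases n) auto
    have "str_ok b" using band_wpow[OF assms, of 1] by simp
    with prd_replicate[OF \<open>x \<noteq> []\<close>, of m] b m have "prd \<Lambda> (replicate n (Syl x)) = Some (Syl b)" by simp
    with \<open>n \<ge> 2\<close> show False using assms unfolding band_def by blast
  qed
qed

lemma wpow_rot:
  assumes "\<And>n. str_ok (wpow n b)" and "rot b c"
  shows "str_ok (wpow n c)"
proof -
  obtain s t where st: "b = s @ t" "c = t @ s" using assms(2) unfolding rot_def by blast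
  have "wpow (n + 1) b = s @ wpow n c @ t"
    unfolding wpow_add using wpow_rotate[of n s t] by (simp add: st)
  then show ?thesis using assms(1)[of "n + 1"] str_ok_sublist by (metis sublist_appendI)
qed

lemma rot_band:
  assumes "bandw b" and "rot b c"
  shows "mixed c" and "primitive c" and "c \<noteq> []" and "str_ok (wpow n c)" and "str_ok c"
proof -
  show "mixed c" using mixed_rot[OF assms(2) band_mixed[OF assms(1)]] .
  then show "c \<noteq> []" by (rule mixed_nonempty)
  show "primitive c" using primitive_rot[OF band_primitive[OF assms(1)] assms(2)] .
  show pow: "str_ok (wpow n c)" for n using wpow_rot[OF band_wpow[OF assms(1)] assms(2)] .
  show "str_ok c" using pow[of 1] by simp
qed

text \<open>A word with syllables of one kind is a path or the inverse of a path, and sufficiently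
  long paths contain a relation.\<close>

lemma unmixed_bounded: "\<exists>N. \<forall>w. str_ok w \<and> \<not> mixed w \<longrightarrow> length w < N"
proof -
  obtain N where N: "\<And>p. is_path \<Lambda> p \<Longrightarrow> length p \<ge> N \<Longrightarrow> \<exists>r \<in> rels \<Lambda>. sublist r p"
    using string_algebra unfolding string_algebra_def by blast
  have "length w < Suc N" if w: "str_ok w" "\<not> mixed w" for w
  proof (rule ccontr)
    assume l: "\<not> length w < Suc N"
    consider "\<forall>\<alpha> \<in> set w. is_direct \<alpha>" | "\<forall>\<alpha> \<in> set w. \<not> is_direct \<alpha>"
      using w(2) unfolding mixed_def by blast
    then show False
    proof cases
      case 1
      define p where "p = map arrow_of w"
      have wp: "w = map Dir p" unfolding p_def using 1 by (induction w) auto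
      have "successively (\<lambda>a b. asrc \<Lambda> a = atgt \<Lambda> b) p"
        using w(1) unfolding wp str_ok_iff successively_map by (auto elim: successively_mono)
      moreover have "set p \<subseteq> arrows \<Lambda>" using w(1) unfolding str_ok_iff p_def by simp
      moreover have "p \<noteq> []" using l by (auto simp: p_def)
      ultimately have "is_path \<Lambda> p" unfolding is_path_def by blast
      moreover have "length p \<ge> N" using l by (simp add: p_def)
      ultimately obtain r x y where "r \<in> rels \<Lambda>" "p = x @ r @ y" using N unfolding sublist_def by blast
      then show False using str_ok_no_rel(1)[OF w(1)] unfolding wp by (metis map_append sublist_appendI)
    next
      case 2
      define p where "p = rev (map arrow_of w)"
      have "map (Inv \<circ> arrow_of) w = w" using 2
        by (intro map_idI) (metis comp_apply syllable.disc(1) syllable.exhaust_sel)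
      then have wp: "w = rev (map Inv p)" unfolding p_def by (simp add: rev_map)
      have "successively (\<lambda>a b. asrc \<Lambda> a = atgt \<Lambda> b) p"
        using w(1) unfolding wp str_ok_iff successively_rev successively_map
        by (auto elim: successively_mono)
      moreover have "set p \<subseteq> arrows \<Lambda>" using w(1) unfolding str_ok_iff p_def by simp
      moreover have "p \<noteq> []" using l by (auto simp: p_def)
      ultimately have "is_path \<Lambda> p" unfolding is_path_def by blast
      moreover have "length p \<ge> N" using l by (simp add: p_def)
      ultimately obtain r x y where "r \<in> rels \<Lambda>" "p = x @ r @ y" using N unfolding sublist_def by blast
      then show False using str_ok_no_rel(2)[OF w(1)] unfolding wp
        by (metis append.assoc map_append rev_append sublist_appendI)
    qed
  qed
  then show ?thesis by blast
qed

text \<open>The primitive root is mixed, because its powers are arbitrarily long strings; it remains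
  to rotate it so that an inverse syllable is read first and a direct one last.\<close>

lemma cyclic_word_band:
  assumes "w \<noteq> []" and "\<And>n. str_ok (wpow n w)"
  shows "\<exists>r n c. w = wpow n r \<and> rot r c \<and> bandw c"
proof -
  obtain r n where r: "w = wpow n r" "primitive r" "n \<ge> 1" using primitive_root[OF assms(1)] by blast
  have ok: "str_ok (wpow k r)" for k
  proof -
    have "wpow k w = wpow (k + (k * n - k)) r"
      using r by (simp add: wpow_mult)
    then have "wpow k w = wpow k r @ wpow (k * n - k) r" unfolding wpow_add .
    then show ?thesis using assms(2)[of k] str_ok_appendD(1) by metis
  qed
  have "r \<noteq> []" using r(2) by (simp add: primitive_def)
  obtain N where N: "\<And>v. str_ok v \<Longrightarrow> \<not> mixed v \<Longrightarrow> length v < N" using unmixed_bounded by blast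
  have "N \<le> length (wpow N r)" using \<open>r \<noteq> []\<close> by (cases r) (auto simp: length_wpow)
  then have "mixed (wpow N r)" using N ok by (meson not_less)
  moreover have "set (wpow N r) \<subseteq> set r" by auto
  ultimately have "mixed r" unfolding mixed_def by blast
  then obtain \<alpha> \<beta> where \<alpha>: "\<alpha> \<in> set r" "\<not> is_direct \<alpha>" and \<beta>: "\<beta> \<in> set r" "is_direct \<beta>"
    unfolding mixed_def by blast
  obtain x y where "r = x @ \<alpha> # y" using \<alpha>(1) by (meson split_list)
  define r' where "r' = \<alpha> # y @ x"
  have rr': "rot r r'" unfolding rot_def r'_def
    using \<open>r = x @ \<alpha> # y\<close> by (metis append_Cons)
  \<comment> \<open>In written order \<open>r'\<close> begins with a block of inverse syllables.
    Moving this block to the end puts a direct syllable at the head and an inverse one at the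
    end.\<close>
  let ?I = "takeWhile (\<lambda>\<gamma>. \<not> is_direct \<gamma>) r'" and ?D = "dropWhile (\<lambda>\<gamma>. \<not> is_direct \<gamma>) r'"
  have "\<beta> \<in> set r'" using rot_set[OF rr'] \<beta> by simp
  with \<beta>(2) have D: "?D \<noteq> []" by (auto simp: dropWhile_eq_Nil_conv)
  have I: "?I \<noteq> []" using \<alpha>(2) by (simp add: r'_def)
  define c where "c = ?D @ ?I"
  have "rot r' c" unfolding rot_def c_def by (metis takeWhile_dropWhile_id)
  with rr' have rc: "rot r c" by (rule rot_trans)
  have "is_direct (hd c)" using D hd_dropWhile[OF D] by (simp add: c_def)
  moreover have "\<not> is_direct (last c)"
    using I last_in_set[OF I] set_takeWhileD by (fastforce simp: c_def)
  moreover have cok: "str_ok (wpow k c)" for k using wpow_rot ok rc by blast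
  moreover have "c \<noteq> []" using D by (simp add: c_def)
  moreover have "str_ok c" using cok[of 1] by simp
  moreover have "src \<Lambda> (Syl c) = tgt \<Lambda> (Syl c)"
    using end_start_pt[of c c] cok[of 2] \<open>c \<noteq> []\<close> by (simp add: numeral_2_eq_2)
  moreover have "prd \<Lambda> (replicate k (Syl c)) \<noteq> None" if "k \<ge> 1" for k
    using prd_replicate[OF \<open>c \<noteq> []\<close>, of "k - 1"] cok[of k] that by simp
  moreover have "\<not> (\<exists>x. \<exists>k \<ge> 2. prd \<Lambda> (replicate k x) = Some (Syl c))"
  proof
    assume "\<exists>x. \<exists>k \<ge> 2. prd \<Lambda> (replicate k x) = Some (Syl c)"
    then obtain x k where k: "k \<ge> 2" "prd \<Lambda> (replicate k x) = Some (Syl c)" by blast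
    from prd_props[OF k(2)] have "c = wpow k (syls x)" by (simp add: map_replicate)
    with k(1) primitive_rot[OF r(2) rc] show False unfolding primitive_def by fastforce
  qed
  ultimately have "bandw c" unfolding band_def by (simp add: is_string_Syl del: is_string.simps src.simps tgt.simps)
  with r(1) rc show ?thesis by blast
qed

section \<open>Reachability between cycles of the automaton\<close>

definition reach :: "'a syllable list \<Rightarrow> 'a syllable list \<Rightarrow> bool" where
  "reach b c \<longleftrightarrow> (\<exists>x. str_ok (c @ x @ b))"

text \<open>The state of \<open>a\<close> lies on the cycle of the automaton given by the band \<open>b\<close>.\<close>

definition on_cycle :: "'a syllable list \<Rightarrow> 'a syllable list \<Rightarrow> bool" where
  "on_cycle b a \<longleftrightarrow> str_ok a \<and> (\<exists>b'. rot b b' \<and> same_ext a b')"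

lemma on_cycle_str_ok: "on_cycle b a \<Longrightarrow> str_ok a"
  by (simp add: on_cycle_def)

lemma on_cycle_same_ext: "on_cycle b a \<Longrightarrow> same_ext c a \<Longrightarrow> on_cycle b c"
  unfolding on_cycle_def using same_ext_trans same_ext_str_ok0 by blast

lemma on_cycle_rot: "bandw b \<Longrightarrow> rot b c \<Longrightarrow> str_ok (c @ y) \<Longrightarrow> on_cycle b (c @ y)"
  unfolding on_cycle_def using reset rot_band by blast

lemma reach_refl: "bandw b \<Longrightarrow> reach b b"
  unfolding reach_def using band_wpow[of b 2] by (auto simp: numeral_2_eq_2 intro: exI[of _ "[]"])

lemma reach_trans: "bandw b \<Longrightarrow> reach a b \<Longrightarrow> reach b c \<Longrightarrow> reach a c"
proof -
  assume b: "bandw b" and "reach a b" "reach b c"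
  then obtain x y where "str_ok (b @ x @ a)" "str_ok (c @ y @ b)" unfolding reach_def by blast
  then have "str_ok ((c @ y) @ b @ (x @ a))" using glue[OF band_mixed[OF b], of "c @ y" "x @ a"] by simp
  then show "reach a c" unfolding reach_def by (metis append.assoc)
qed

lemma cycle_loop:
  assumes "bandw b" and "rot b b'" and "same_ext a b'"
  shows "same_ext (b' @ a) a"
proof -
  have "same_ext (b' @ a) (b' @ b')" using assms(3) by (rule same_ext_append)
  moreover have "same_ext (b' @ b') b'"
    using reset[OF rot_band(1)[OF assms(1,2)], of b'] rot_band(4)[OF assms(1,2), of 2]
    by (simp add: numeral_2_eq_2)
  ultimately show ?thesis using assms(3) same_ext_trans same_ext_sym by blast
qed

text \<open>The state is the one after some rotation \<open>t @ s\<close> of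
  \<open>b = s @ t\<close>; completing the turn by \<open>s\<close> leads to the point from which
  \<open>b\<close> is read.\<close>

lemma on_cycle_extend:
  assumes "bandw b" and "on_cycle b a"
  shows "\<exists>x. str_ok (b @ x @ a)"
proof -
  obtain b' where b': "rot b b'" "same_ext a b'" using assms(2) unfolding on_cycle_def by blast
  obtain s t where st: "b = s @ t" "b' = t @ s" using b'(1) unfolding rot_def by blast
  have "wpow 3 b = b @ s @ b' @ t" by (simp add: numeral_3_eq_3 st)
  then have "str_ok (b @ s @ b')" using band_wpow[OF assms(1), of 3]
    by (metis append.assoc str_ok_appendD(1))
  then have "str_ok (b @ s @ a)" using same_ext_str_ok[OF b'(2), of "b @ s"] by simp
  then show ?thesis by blast
qed

lemma reachI:
  assumes "bandw b" and "bandw c" and "on_cycle b a" and "on_cycle c (x @ a)"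
  shows "reach b c"
proof -
  obtain r where r: "str_ok (c @ r @ x @ a)" using on_cycle_extend[OF assms(2,4)] by blast
  obtain b' where b': "rot b b'" "same_ext a b'" using assms(3) unfolding on_cycle_def by blast
  with r have 1: "str_ok ((c @ r @ x) @ b')" using same_ext_str_ok[OF b'(2), of "c @ r @ x"] by simp
  obtain s t where st: "b = s @ t" "b' = t @ s" using b'(1) unfolding rot_def by blast
  have "wpow 3 b = s @ (b' @ t @ b)" by (simp add: numeral_3_eq_3 st)
  then have "str_ok (b' @ t @ b)" using band_wpow[OF assms(1), of 3] by (metis str_ok_appendD(2))
  with 1 have "str_ok ((c @ r @ x) @ b' @ t @ b)"
    using glue[OF rot_band(1)[OF assms(1) b'(1)], of "c @ r @ x" "t @ b"] by blast
  then show ?thesis unfolding reach_def by (metis append.assoc)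
qed

end

section \<open>Consequences of domesticity\<close>

locale domestic_alg = string_alg K \<Lambda>
  for K :: "'k ring" and \<Lambda> :: "('v, 'a) bound_quiver" +
  assumes domestic: "domestic \<Lambda>"
begin

text \<open>
  Two non-commuting loops at a state would generate a free monoid all of whose elements are
  strings, hence infinitely many bands.
\<close>

lemma loops_commute:
  assumes "str_ok a" and "same_ext (p @ a) a" and "same_ext (q @ a) a"
  shows "p @ q = q @ p"
proof (cases "q = []")
  case False
  have fin: "finite (length ` syls ` {b. band \<Lambda> b})" using domestic unfolding domestic_def by simp
  define M where "M = Max (length ` syls ` {b. band \<Lambda> b})"
  have M: "length c \<le> M" if "bandw c" for c
    unfolding M_def using that by (intro Max_ge fin) (force intro: image_eqI[of _ _ "Syl c"])
  \<comment> \<open>Rotations of bands have length at most \<open>M\<close>, so the length of the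
    root \<open>r\<close> of \<open>w\<close> divides \<open>fact M\<close>. Hence
    \<open>wpow n p\<close>, an initial part of a power of \<open>r\<close> whose length is a
    multiple of \<open>length r\<close>, is itself a power of \<open>r\<close>, and so is the
    remainder \<open>q\<close>.\<close>
  define n :: nat where "n = fact M"
  have "n \<ge> 1" unfolding n_def by simp
  define w where "w = wpow n p @ q"
  have loop: "same_ext (wpow k v @ a) a" if "same_ext (v @ a) a" for k v
  proof (induction k)
    case (Suc k)
    have "same_ext (v @ wpow k v @ a) (v @ a)" using Suc by (rule same_ext_append)
    with that show ?case using same_ext_trans by auto
  qed simp
  have "same_ext (w @ a) (wpow n p @ a)"
    unfolding w_def using same_ext_append[OF assms(3), of "wpow n p"] by simp
  then have "same_ext (w @ a) a" using loop[OF assms(2)] same_ext_trans by blast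
  then have "same_ext (wpow k w @ a) a" for k by (rule loop)
  then have "str_ok (wpow k w)" for k
    using assms(1) same_ext_str_ok0 str_ok_appendD(1) by blast
  moreover have "w \<noteq> []" using False by (simp add: w_def)
  ultimately obtain r j c where r: "w = wpow j r" "rot r c" "bandw c"
    using cyclic_word_band by blast
  have "r \<noteq> []" using r(2) band_nonempty[OF r(3)] by auto
  have "length r \<le> M" using M[OF r(3)] rot_length[OF r(2)] by simp
  then have "length r dvd n" unfolding n_def using \<open>r \<noteq> []\<close> by (intro dvd_fact) (cases r, auto)
  then obtain t where t: "n = length r * t" by blast
  define i where "i = t * length p"
  have li: "length (wpow n p) = length (wpow i r)" by (simp add: length_wpow t i_def)
  have "length (wpow i r) \<le> length w" unfolding w_def li[symmetric] by simp
  then have "i \<le> j" unfolding r(1) length_wpow using \<open>r \<noteq> []\<close> by simp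
  then have "w = wpow i r @ wpow (j - i) r" unfolding r(1) wpow_add[symmetric] by simp
  then have eq: "wpow n p = wpow i r" "q = wpow (j - i) r" using li unfolding w_def by auto
  have "wpow n p @ q = q @ wpow n p" unfolding eq wpow_add[symmetric] by (simp add: add.commute)
  then show ?thesis using commute_wpow_imp_commute \<open>n \<ge> 1\<close> by blast
qed simp

text \<open>Otherwise the arc \<open>t\<close> between the two points is a loop and commutes with
  the full turn \<open>b1 = s @ t\<close>, which forces \<open>s @ t = t @ s\<close>.\<close>

lemma cycle_state_unique:
  assumes "bandw b" and "rot b b1" and "rot b b2" and "same_ext b1 b2"
  shows "b1 = b2"
proof -
  obtain s t where st: "b1 = s @ t" "b2 = t @ s"
    using rot_trans[OF rot_sym[OF assms(2)] assms(3)] unfolding rot_def by blast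
  have "str_ok (b2 @ b2)" using rot_band(4)[OF assms(1,3), of 2] by (simp add: numeral_2_eq_2)
  then have "str_ok ((b2 @ t) @ s)" using st by simp
  then have "str_ok (b2 @ t)" by (rule str_ok_appendD(1))
  then have "same_ext (t @ b1) b2" using reset[OF rot_band(1)[OF assms(1,3)]] st by simp
  then have "same_ext (t @ b1) b1" using assms(4) same_ext_sym same_ext_trans by blast
  moreover have "same_ext (b1 @ b1) b1" using cycle_loop[OF assms(1,2)] by simp
  ultimately have "t @ b1 = b1 @ t"
    using loops_commute rot_band(5)[OF assms(1,2)] by blast
  then show ?thesis using st by simp
qed

text \<open>A walk cannot leave a cycle and come back: closing \<open>x\<close> by an arc
  \<open>t\<close> of the cycle gives a loop, which commutes with \<open>b'\<close>. The equation
  \<open>x @ b' = c @ x\<close> expresses that \<open>x\<close> runs along the cycle from the phase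
  \<open>b'\<close> to the phase \<open>c\<close>.\<close>

lemma follow_cycle:
  assumes "bandw b" and "rot b b'" and "same_ext a b'" and "on_cycle b (x @ a)"
  shows "\<exists>c. x @ b' = c @ x \<and> rot b c \<and> same_ext (x @ a) c"
proof -
  obtain c0 where c0: "rot b c0" "same_ext (x @ a) c0" using assms(4) unfolding on_cycle_def by blast
  obtain s t where st: "c0 = s @ t" "b' = t @ s"
    using rot_trans[OF rot_sym[OF c0(1)] assms(2)] unfolding rot_def by blast
  have "str_ok (b' @ b')" using rot_band(4)[OF assms(1,2), of 2] by (simp add: numeral_2_eq_2)
  then have "str_ok ((b' @ t) @ s)" using st by simp
  then have ok: "str_ok (b' @ t)" by (rule str_ok_appendD(1))
  have "same_ext (t @ x @ a) (t @ c0)" using c0(2) by (rule same_ext_append)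
  also have "t @ c0 = b' @ t" using st by simp
  finally have "same_ext (t @ x @ a) b'"
    using reset[OF rot_band(1)[OF assms(1,2)] ok] same_ext_trans by blast
  from same_ext_trans[OF this same_ext_sym[OF assms(3)]] have "same_ext ((t @ x) @ a) a" by simp
  moreover have "same_ext (b' @ a) a" using cycle_loop[OF assms(1-3)] .
  moreover have oka: "str_ok a" using assms(4) unfolding on_cycle_def by (meson str_ok_appendD(2))
  ultimately have "t @ x @ b' = b' @ t @ x" using loops_commute[of a "t @ x" b'] by simp
  from factor_of_conj[OF this] obtain c where c: "x @ b' = c @ x" by blast
  have "rot b c" using conj_rot[OF c] assms(2) rot_trans by blast
  moreover have "same_ext (x @ a) c"
  proof -
    have s: "same_ext (x @ a) (c @ x)" using same_ext_append[OF assms(3), of x] c by simp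
    then have "str_ok (c @ x)" using on_cycle_str_ok[OF assms(4)] same_ext_str_ok0 by blast
    then show ?thesis using s reset rot_band(1)[OF assms(1) \<open>rot b c\<close>] same_ext_trans by blast
  qed
  ultimately show ?thesis using c by blast
qed

lemma follow_cycle_to:
  assumes "bandw b" and "rot b b'" and "same_ext a b'" and "rot b c" and "same_ext (x @ a) c"
    and "str_ok (x @ a)"
  shows "x @ b' = c @ x"
proof -
  have "on_cycle b (x @ a)" using assms unfolding on_cycle_def by blast
  from follow_cycle[OF assms(1-3) this] obtain c' where
    "x @ b' = c' @ x" "rot b c'" "same_ext (x @ a) c'" by blast
  moreover have "c' = c" using cycle_state_unique[OF assms(1) \<open>rot b c'\<close> assms(4)]
      \<open>same_ext (x @ a) c'\<close> assms(5) same_ext_sym same_ext_trans by blast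
  ultimately show ?thesis by simp
qed

text \<open>Going from \<open>b\<close> to \<open>c\<close> and back, with any number of turns of
  \<open>c\<close> in between, is a loop at \<open>b\<close>, hence a power of \<open>b\<close>. One
  additional turn shows that \<open>length b\<close> divides \<open>length c\<close>. By symmetry
  the lengths agree, and then a factor \<open>c\<close> of a power of \<open>b\<close> is a rotation
  of \<open>b\<close>.\<close>

lemma reach_antisym:
  assumes b: "bandw b" and c: "bandw c" and "reach b c" and "reach c b"
  shows "rot b c"
proof -
  have *: "length b dvd length c \<and> (\<exists>x y. b @ (b @ y @ c @ x) = (b @ y @ c @ x) @ b)"
    if b: "bandw b" and c: "bandw c" and "reach b c" and "reach c b" for b c
  proof -
    obtain x y where x: "str_ok (c @ x @ b)" and y: "str_ok (b @ y @ c)"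
      using \<open>reach b c\<close> \<open>reach c b\<close> unfolding reach_def by blast
    define p where "p k = b @ y @ wpow (Suc k) c @ x" for k
    have comm: "b @ p k = p k @ b" for k
    proof -
      have 1: "str_ok (wpow k c @ c @ (x @ b))"
        using glue[OF band_mixed[OF c], of "wpow k c" "x @ b"] band_wpow[OF c, of "Suc k"] x
        by (simp add: wpow_commute)
      have "wpow k c @ c @ (x @ b) = c @ (wpow k c @ (x @ b))"
        using wpow_commute[of k c] by (metis append.assoc)
      with 1 have "str_ok ((b @ y) @ c @ (wpow k c @ x @ b))"
        using y glue[OF band_mixed[OF c], of "b @ y" "wpow k c @ x @ b"] by simp
      then have "str_ok (b @ (y @ wpow (Suc k) c @ x @ b))" by simp
      then have "same_ext (p k @ b) b" using reset[OF band_mixed[OF b]] by (simp add: p_def)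
      moreover have "same_ext (b @ b) b" using cycle_loop[OF b rot_refl] by simp
      moreover have "str_ok b" using band_wpow[OF b, of 1] by simp
      ultimately show ?thesis using loops_commute by blast
    qed
    have "length b dvd length (p k)" for k
    proof -
      obtain n where "p k = wpow n b" using commute_primitive[OF band_primitive[OF b]] comm by metis
      then show ?thesis by (simp add: length_wpow)
    qed
    then have "length b dvd length (p 1) - length (p 0)" by (intro dvd_diff_nat)
    moreover have "length (p 1) - length (p 0) = length c" by (simp add: p_def)
    moreover have "\<exists>x y. b @ (b @ y @ c @ x) = (b @ y @ c @ x) @ b"
      using comm[of 0] unfolding p_def by auto
    ultimately show ?thesis by simp
  qed
  have len: "length b = length c" using *[OF assms] *[OF c b assms(4,3)] by (simp add: dvd_antisym)
  obtain x y where "b @ (b @ y @ c @ x) = (b @ y @ c @ x) @ b" using *[OF assms] by blast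
  then have "(b @ y @ c) @ x @ b = b @ (b @ y @ c) @ x" by simp
  from factor_of_conj[OF this] obtain d where d: "x @ b = d @ x" "(b @ y @ c) @ d = b @ (b @ y @ c)"
    by blast
  have "length d = length b" using d(1) by (metis add.commute add_right_cancel length_append)
  then have "d = c" using d(2) len by (metis append.assoc append_eq_append_conv)
  then show ?thesis using conj_rot d(1) by blast
qed

lemma on_cycle_disjoint:
  assumes "bandw b" and "bandw c" and "on_cycle b a" and "on_cycle c a"
  shows "rot b c"
  using assms reachI[of b c a "[]"] reachI[of c b a "[]"] reach_antisym by simp

end

section \<open>Deleting bands\<close>

lemma cyclic_perm_Syl: "cyclic_perm (Syl b) c \<longleftrightarrow> (\<exists>c'. c = Syl c' \<and> rot b c')"
  unfolding cyclic_perm_def rot_iff_rotate by auto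

lemma prefix_wpow:
  assumes "x @ b = c @ x" and "c \<noteq> []"
  shows "\<exists>k. prefix x (wpow k c)"
proof -
  have "x @ wpow (length x) b = wpow (length x) c @ x" using assms(1) by (rule wpow_conj)
  then have "prefix x (wpow (length x) c @ x)" by (metis prefixI)
  moreover have "prefix (wpow (length x) c) (wpow (length x) c @ x)" by simp
  moreover have "length x \<le> length (wpow (length x) c)"
    using assms(2) by (cases c) (auto simp: length_wpow)
  ultimately show ?thesis using prefix_length_prefix by blast
qed

declare is_string.simps(2) [simp del]

section \<open>Factorizations and reductions of strings as operations on lists\<close>

context string_alg
begin

declare is_string_Syl [simp]

lemma point_strings:
  assumes "is_string \<Lambda> x"
  shows "is_string \<Lambda> (Triv (tgt \<Lambda> x) (eps \<Lambda> x))" and "is_string \<Lambda> (Triv (src \<Lambda> x) (- sig \<Lambda> x))"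
proof -
  have s: "sign_functions \<Lambda>" and w: "wf_digraph (quiver \<Lambda>)"
    using string_algebra unfolding string_algebra_def fin_digraph_def by blast+
  have l: "syl_src \<Lambda> \<alpha> \<in> verts (quiver \<Lambda>)" "syl_tgt \<Lambda> \<alpha> \<in> verts (quiver \<Lambda>)"
    "syl_sig \<Lambda> \<alpha> \<in> {1, -1}" "syl_eps \<Lambda> \<alpha> \<in> {1, -1}" if "arrow_of \<alpha> \<in> arrows \<Lambda>" for \<alpha>
    using that s wf_digraph.tail_in_verts[OF w] wf_digraph.head_in_verts[OF w]
    unfolding sign_functions_def by (cases \<alpha>; auto)+
  have "is_string \<Lambda> (Triv (tgt \<Lambda> x) (eps \<Lambda> x)) \<and> is_string \<Lambda> (Triv (src \<Lambda> x) (- sig \<Lambda> x))"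
  proof (cases x)
    case (Triv v i)
    then show ?thesis using assms by auto
  next
    case (Syl w)
    then have "w \<noteq> []" "arrow_of ` set w \<subseteq> arrows \<Lambda>"
      using assms unfolding Syl is_string_Syl str_ok_iff by auto
    then have "arrow_of (hd w) \<in> arrows \<Lambda>" "arrow_of (last w) \<in> arrows \<Lambda>" by auto
    with l[of "hd w"] l[of "last w"] show ?thesis by (auto simp: Syl)
  qed
  then show "is_string \<Lambda> (Triv (tgt \<Lambda> x) (eps \<Lambda> x))" "is_string \<Lambda> (Triv (src \<Lambda> x) (- sig \<Lambda> x))"
    by blast+
qed

lemma string_eqI:
  assumes "is_string \<Lambda> x" and "is_string \<Lambda> y" and "syls x = syls y" and "start_pt \<Lambda> x = start_pt \<Lambda> y"
  shows "x = y"
  using assms by (cases x; cases y) auto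

lemma prd2I:
  assumes "is_string \<Lambda> x" and "is_string \<Lambda> y" and "end_pt \<Lambda> x = start_pt \<Lambda> y"
    and "is_string \<Lambda> z" and "syls z = syls y @ syls x" and "start_pt \<Lambda> z = start_pt \<Lambda> x"
  shows "prd \<Lambda> [y, x] = Some z"
proof -
  have ok: "str_ok (syls y @ syls x)" using is_string_str_ok[OF assms(4)] assms(5) by simp
  then have "composable \<Lambda> y x" using composable_iff[OF assms(1,2)] assms(3) by blast
  from cat_string[OF assms(1,2) this] have "cat y x = z"
    using string_eqI[of "cat y x" z] assms by (simp add: syls_cat del: start_pt.simps end_pt.simps)
  with ok assms show ?thesis unfolding prd2_iff by blast
qed

lemma qword_of_points:
  assumes "is_string \<Lambda> (Triv (fst p) (snd p))" and "str_ok w"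
  shows "is_string \<Lambda> (qword_of p w)"
    and "w = [] \<Longrightarrow> start_pt \<Lambda> (qword_of p w) = p" and "w = [] \<Longrightarrow> end_pt \<Lambda> (qword_of p w) = p"
    and "w \<noteq> [] \<Longrightarrow> qword_of p w = Syl w"
  using assms by (auto simp: qword_of_def is_string_Syl simp del: is_string.simps)

text \<open>The nonempty middle factor provides base points for the outer factors, which may be
  trivial strings. Thus factorizations of the list lift to products of strings.\<close>

lemma factor_prd:
  assumes z: "is_string \<Lambda> z" and w: "syls z = y2 @ b @ y1" and b: "b \<noteq> []"
  defines "q1 \<equiv> qword_of (start_pt \<Lambda> (Syl b)) y1" and "q2 \<equiv> qword_of (end_pt \<Lambda> (Syl b)) y2"
  shows "prd \<Lambda> [q2, Syl b, q1] = Some z" and "is_string \<Lambda> q1" and "is_string \<Lambda> q2"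
    and "end_pt \<Lambda> q1 = start_pt \<Lambda> (Syl b)" and "start_pt \<Lambda> q2 = end_pt \<Lambda> (Syl b)"
    and "start_pt \<Lambda> q1 = start_pt \<Lambda> z" and "end_pt \<Lambda> q2 = end_pt \<Lambda> z"
proof -
  have ok: "str_ok (y2 @ b @ y1)" using is_string_str_ok[OF z] w by simp
  then have oks: "str_ok y2" "str_ok (b @ y1)" "str_ok b" "str_ok y1" "str_ok (y2 @ b)"
    using str_ok_appendD[of y2 "b @ y1"] str_ok_appendD[of b y1] str_ok_appendD[of "y2 @ b" y1] by simp_all
  have zS: "z = Syl (y2 @ b @ y1)" using w b by (intro Syl_eqI) auto
  have bS: "is_string \<Lambda> (Syl b)" using b oks is_string_Syl by blast
  have p: "is_string \<Lambda> (Triv (fst (start_pt \<Lambda> (Syl b))) (snd (start_pt \<Lambda> (Syl b))))"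
    "is_string \<Lambda> (Triv (fst (end_pt \<Lambda> (Syl b))) (snd (end_pt \<Lambda> (Syl b))))"
    using point_strings[OF bS] by simp_all
  show q1: "is_string \<Lambda> q1" unfolding q1_def using qword_of_points(1)[OF p(1) oks(4)] .
  show q2: "is_string \<Lambda> q2" unfolding q2_def using qword_of_points(1)[OF p(2) oks(1)] .
  show e1: "end_pt \<Lambda> q1 = start_pt \<Lambda> (Syl b)"
    using end_start_pt[OF oks(2) _ b] qword_of_points[OF p(1) oks(4)] unfolding q1_def by metis
  show s2: "start_pt \<Lambda> q2 = end_pt \<Lambda> (Syl b)"
    using end_start_pt[OF oks(5) b] qword_of_points[OF p(2) oks(1)] unfolding q2_def by metis
  show s1: "start_pt \<Lambda> q1 = start_pt \<Lambda> z"
    by (cases "y1 = []") (simp_all add: q1_def qword_of_def zS b)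
  show e2: "end_pt \<Lambda> q2 = end_pt \<Lambda> z"
    by (cases "y2 = []") (simp_all add: q2_def qword_of_def zS b)
  have "is_string \<Lambda> (Syl (b @ y1))" using b oks is_string_Syl by simp
  then have 1: "prd \<Lambda> [Syl b, q1] = Some (Syl (b @ y1))"
    using q1 bS e1 s1 b by (intro prd2I) (simp_all add: q1_def zS)
  have "prd \<Lambda> [q2, Syl (b @ y1)] = Some z"
    using \<open>is_string \<Lambda> (Syl (b @ y1))\<close> q2 s2 z w b by (intro prd2I) (simp_all add: q2_def zS)
  with 1 show "prd \<Lambda> [q2, Syl b, q1] = Some z" by (rule prd_ConsI)
qed

lemma prd3_syls:
  "prd \<Lambda> [y2, b, y1] = Some z \<Longrightarrow> is_string \<Lambda> z \<and> syls z = syls y2 @ syls b @ syls y1 \<and>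
     start_pt \<Lambda> z = start_pt \<Lambda> y1 \<and> end_pt \<Lambda> z = end_pt \<Lambda> y2"
  using prd_props[of "[y2, b, y1]" z] by (simp del: prd.simps start_pt.simps end_pt.simps)

lemma prd2_syls:
  "prd \<Lambda> [y2, y1] = Some z \<Longrightarrow> is_string \<Lambda> z \<and> syls z = syls y2 @ syls y1 \<and>
     start_pt \<Lambda> z = start_pt \<Lambda> y1 \<and> end_pt \<Lambda> z = end_pt \<Lambda> y2"
  using prd_props[of "[y2, y1]" z] by (simp del: prd.simps start_pt.simps end_pt.simps)

lemma band_reductionD:
  assumes "band_reduction \<Lambda> (Syl b) y z"
  shows "\<exists>y2 b' y1. rot b b' \<and> syls y = y2 @ b' @ y1 \<and> syls z = y2 @ y1 \<and> is_string \<Lambda> z \<and>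
    start_pt \<Lambda> z = start_pt \<Lambda> y \<and> is_string \<Lambda> y"
proof -
  obtain y2 b' y1 where b: "cyclic_perm (Syl b) b'" "prd \<Lambda> [y2, b', y1] = Some y"
    "prd \<Lambda> [y2, y1] = Some z" using assms unfolding band_reduction_def by blast
  obtain c where "b' = Syl c" "rot b c" using b(1) unfolding cyclic_perm_Syl by blast
  with prd3_syls[OF b(2)] prd2_syls[OF b(3)] show ?thesis
    by (intro exI[of _ "syls y2"] exI[of _ c] exI[of _ "syls y1"]) (simp del: start_pt.simps)
qed

text \<open>The conditions on end points only matter if \<open>y1\<close> or \<open>y2\<close> is empty.\<close>

lemma band_reductionI:
  assumes "rot b b'" and "b' \<noteq> []" and "is_string \<Lambda> y" and "syls y = y2 @ b' @ y1"
    and "is_string \<Lambda> z" and "syls z = y2 @ y1"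
    and "start_pt \<Lambda> z = start_pt \<Lambda> y" and "end_pt \<Lambda> z = end_pt \<Lambda> y"
    and "start_pt \<Lambda> (Syl b') = end_pt \<Lambda> (Syl b')"
  shows "band_reduction \<Lambda> (Syl b) y z"
proof -
  define q1 where "q1 = qword_of (start_pt \<Lambda> (Syl b')) y1"
  define q2 where "q2 = qword_of (end_pt \<Lambda> (Syl b')) y2"
  note f = factor_prd[OF assms(3,4,2), folded q1_def q2_def]
  have "prd \<Lambda> [q2, q1] = Some z"
    using f assms by (intro prd2I) (simp_all add: q1_def q2_def del: start_pt.simps end_pt.simps)
  with f(1) assms(1) show ?thesis unfolding band_reduction_def cyclic_perm_Syl by blast
qed

text \<open>For nonempty words the end point conditions are automatic by
  \<open>end_start_pt\<close>, so H-equivalence gives equal states: an H-reduction at a nonempty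
  string removes a closed walk of the automaton.\<close>

lemma H_equiv_same_ext:
  assumes "H_equiv \<Lambda> (Syl a) (Syl c)"
  shows "same_ext a c"
  unfolding same_ext_def
proof
  fix x
  have a: "is_string \<Lambda> (Syl a)" "is_string \<Lambda> (Syl c)" and t: "tgt \<Lambda> (Syl a) = tgt \<Lambda> (Syl c)"
    and ext: "\<And>x. is_string \<Lambda> x \<Longrightarrow> src \<Lambda> x = tgt \<Lambda> (Syl a) \<Longrightarrow>
      prd \<Lambda> [x, Syl a] \<noteq> None \<longleftrightarrow> prd \<Lambda> [x, Syl c] \<noteq> None"
    using assms unfolding H_equiv_def by blast+
  then have ne: "a \<noteq> []" "c \<noteq> []" "str_ok a" "str_ok c" unfolding is_string_Syl by blast+
  show "str_ok (x @ a) \<longleftrightarrow> str_ok (x @ c)"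
  proof (cases "x = []")
    case False
    have *: "str_ok (x @ d) \<longleftrightarrow> is_string \<Lambda> (Syl x) \<and> src \<Lambda> (Syl x) = tgt \<Lambda> (Syl d) \<and> prd \<Lambda> [Syl x, Syl d] \<noteq> None"
      if "d \<noteq> []" "str_ok d" for d
      using that end_start_pt[of x d] False str_ok_appendD(1)[of x d]
      by (auto simp: is_string_Syl simp del: is_string.simps)
    show ?thesis using * ne ext[of "Syl x"] t by metis
  qed (use ne in simp)
qed

text \<open>A lower bound for the multiplicity. This bound, rather than the maximum itself, is
  carried through the deletions of other bands.\<close>

definition contains_pow :: "nat \<Rightarrow> 'a syllable list \<Rightarrow> 'a syllable list \<Rightarrow> bool" where
  "contains_pow k b w \<longleftrightarrow> (\<exists>b'. rot b b' \<and> sublist (wpow k b') w)"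

text \<open>The \<open>GREATEST\<close> in \<open>band_mult\<close> is attained: the exponent 0 is
  possible, and as \<open>b\<close> is nonempty every possible exponent is at most
  \<open>length w\<close>.\<close>

lemma band_mult_contains:
  assumes "is_string \<Lambda> (Syl w)" and "b \<noteq> []"
  shows "contains_pow (band_mult \<Lambda> (Syl b) (Syl w)) b w"
proof -
  let ?P = "\<lambda>n. \<exists>y2 b' y1. cyclic_perm (Syl b) b' \<and> prd \<Lambda> (y2 # replicate n b' @ [y1]) = Some (Syl w)"
  have D: "\<exists>b' x y. rot b b' \<and> w = x @ wpow n b' @ y" if n: "?P n" for n
  proof -
    obtain y2 b' y1 where "rot b b'" and b': "prd \<Lambda> (y2 # replicate n (Syl b') @ [y1]) = Some (Syl w)"
      using n unfolding cyclic_perm_Syl by blast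
    from prd_props[OF b'] have "w = syls y2 @ wpow n b' @ syls y1"
      by (simp add: map_replicate del: prd.simps start_pt.simps end_pt.simps)
    with \<open>rot b b'\<close> show ?thesis by blast
  qed
  have 0: "?P 0"
  proof -
    have "prd \<Lambda> [Syl w, Triv (src \<Lambda> (Syl w)) (- sig \<Lambda> (Syl w))] = Some (Syl w)"
      using assms point_strings[OF assms(1)] by (intro prd2I) auto
    then have "cyclic_perm (Syl b) (Syl b) \<and> prd \<Lambda> (Syl w # replicate 0 (Syl b) @
        [Triv (src \<Lambda> (Syl w)) (- sig \<Lambda> (Syl w))]) = Some (Syl w)"
      by (simp add: cyclic_perm_Syl del: prd.simps)
    then show ?thesis by blast
  qed
  have bound: "n \<le> length w" if n: "?P n" for n
  proof -
    obtain b' x y where b': "rot b b'" "w = x @ wpow n b' @ y" using D[OF n] by blast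
    from b'(1) have "length b' \<noteq> 0" using rot_length assms(2) by fastforce
    then have "n \<le> n * length b'" by (cases "length b'") auto
    moreover have "length w = length x + (n * length b' + length y)"
      unfolding b'(2) by (simp only: length_append length_wpow)
    ultimately show ?thesis by linarith
  qed
  from GreatestI_nat[of ?P 0 "length w"] 0 bound
  have "?P (band_mult \<Lambda> (Syl b) (Syl w))" unfolding band_mult_def by blast
  from D[OF this] show ?thesis unfolding contains_pow_def sublist_def by blast
qed

end

section \<open>Uniqueness and effect of a deletion\<close>

context domestic_alg
begin

text \<open>Going around \<open>b\<close> repeatedly passes through the cycle of \<open>c\<close>
  and returns, so each of the two cycles reaches the other.\<close>

lemma band_factor_rot:
  assumes b: "bandw b" and c: "bandw c" and "rot b b'" and "rot c c'" and "sublist c' b'"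
  shows "rot b c"
proof -
  obtain x y where b': "b' = x @ c' @ y" using assms(5) unfolding sublist_def by blast
  have "str_ok (b' @ b')" using rot_band(4)[OF b assms(3), of 2] by (simp add: numeral_2_eq_2)
  then have ok: "str_ok (x @ c' @ y @ b')" using b' by simp
  then have "on_cycle b (x @ c' @ y @ b')" using on_cycle_rot[OF b assms(3), of b'] b' by simp
  moreover have "on_cycle c (c' @ y @ b')" using on_cycle_rot[OF c assms(4)] str_ok_appendD(2)[OF ok] .
  moreover have "on_cycle b b'" using on_cycle_rot[OF b assms(3), of "[]"] rot_band(5)[OF b assms(3)] by simp
  ultimately have "reach b c" "reach c b"
    using reachI[OF b c, of b' "c' @ y"] reachI[OF c b, of "c' @ y @ b'" x] by auto
  then show ?thesis by (rule reach_antisym[OF b c])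
qed

text \<open>Between the two occurrences the string runs along the cycle of \<open>b\<close>, so the
  word \<open>u\<close> separating their starts satisfies \<open>u @ b1 = b2 @ u\<close>. Hence
  \<open>red\<close> does not depend on the occurrence chosen.\<close>

lemma deletion_unique:
  assumes b: "bandw b" and "rot b b1" and "rot b b2" and "str_ok w"
    and "w = y2 @ b1 @ y1" and "w = x2 @ b2 @ x1"
  shows "y2 @ y1 = x2 @ x1"
proof -
  have *: "y2 @ y1 = x2 @ x1"
    if r: "rot b b1" "rot b b2" and w: "w = y2 @ b1 @ y1" "w = x2 @ b2 @ x1"
      and u: "y2 = x2 @ u" "b2 @ x1 = u @ b1 @ y1" for b1 b2 y1 y2 x1 x2 u
  proof -
    have "str_ok (b2 @ x1)" using assms(4) w(2) str_ok_appendD(2) by blast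
    moreover from this have "str_ok (b1 @ y1)" using u(2) str_ok_appendD(2) by metis
    ultimately have "u @ b1 = b2 @ u"
      using reset[OF rot_band(1)[OF b r(1)], of y1] reset[OF rot_band(1)[OF b r(2)], of x1] u(2)
      by (intro follow_cycle_to[OF b r(1) _ r(2), of "b1 @ y1"]) simp_all
    with u have "x1 = u @ y1" by (metis append.assoc append_same_eq same_append_eq)
    with u(1) show ?thesis by simp
  qed
  have "y2 @ (b1 @ y1) = x2 @ (b2 @ x1)" using assms(5,6) by simp
  from iffD1[OF append_eq_append_conv2 this] obtain u where
    "y2 = x2 @ u \<and> u @ b1 @ y1 = b2 @ x1 \<or> y2 @ u = x2 \<and> b1 @ y1 = u @ b2 @ x1" by auto
  then show ?thesis
  proof
    assume "y2 = x2 @ u \<and> u @ b1 @ y1 = b2 @ x1"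
    then show ?thesis using *[OF assms(2,3,5,6), of u] by simp
  next
    assume "y2 @ u = x2 \<and> b1 @ y1 = u @ b2 @ x1"
    then show ?thesis using *[OF assms(3,2,6,5), of u] by simp
  qed
qed

lemma red_eq:
  assumes "bandw b" and "band_reduction \<Lambda> (Syl b) y z"
  shows "red \<Lambda> (Syl b) y = z"
proof -
  have "band_reduction \<Lambda> (Syl b) y (red \<Lambda> (Syl b) y)"
    unfolding red_def using assms(2) by (rule someI)
  from band_reductionD[OF this] band_reductionD[OF assms(2)] show ?thesis
    using deletion_unique[OF assms(1)] is_string_str_ok by (metis string_eqI)
qed

text \<open>
  \<open>linked A b b0 Y\<close>: after inserting enough copies of the band \<open>b\<close> where \<open>Y\<close> runs through its
  cycle, the word \<open>Y\<close> ends with \<open>A b\<close>.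
\<close>

definition linked ::
    "'a syllable list \<Rightarrow> 'a syllable list \<Rightarrow> 'a syllable list \<Rightarrow> 'a syllable list \<Rightarrow> bool" where
  "linked A b b0 Y \<longleftrightarrow> str_ok Y \<and> suffix b0 Y \<and>
     (\<exists>z2 z1 b' m. Y = z2 @ z1 \<and> rot b b' \<and> same_ext z1 b' \<and> prefix (A @ b) (z2 @ wpow m b'))"

text \<open>If \<open>\<beta>\<close> is a rotation of \<open>b\<close>, the insertion point moves
  along the cycle to the place of the deletion, with further copies inserted if necessary. Otherwise
  \<open>b\<close> does not reach \<open>\<beta>\<close>, so the deleted loop is read completely
  before the insertion point, and removing it changes no later state. The bound on \<open>y1\<close>
  protects the copy of \<open>b0\<close> that is read first.\<close>

lemma linked_deletion:
  assumes b: "bandw b" and \<beta>: "bandw \<beta>" and "rot \<beta> \<beta>'" and "reach \<beta> b"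
    and l: "linked A b b0 (y2 @ \<beta>' @ y1)" and se: "same_ext (\<beta>' @ y1) y1"
    and len: "length b0 \<le> length y1"
  shows "linked A b b0 (y2 @ y1)"
proof -
  have ok: "str_ok (y2 @ \<beta>' @ y1)" and suf: "suffix b0 (y2 @ \<beta>' @ y1)" using l by (auto simp: linked_def)
  have ok': "str_ok (y2 @ y1)" using ok same_ext_str_ok[OF se, of y2] by simp
  have "suffix y1 (y2 @ \<beta>' @ y1)" by (simp add: suffix_def)
  from suffix_length_suffix[OF suf this len] have suf': "suffix b0 (y2 @ y1)"
    by (simp add: suffix_appendI)
  have ok1: "str_ok (\<beta>' @ y1)" "str_ok y1" using ok str_ok_appendD(2) by blast+
  have sy: "same_ext y1 \<beta>'"
    using reset[OF rot_band(1)[OF \<beta> assms(3)] ok1(1)] se same_ext_sym same_ext_trans by blast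
  have cy: "on_cycle \<beta> y1" unfolding on_cycle_def using sy assms(3) ok1 by blast
  obtain z2 z1 b' m where z: "y2 @ \<beta>' @ y1 = z2 @ z1" "rot b b'" "same_ext z1 b'"
    "prefix (A @ b) (z2 @ wpow m b')" using l unfolding linked_def by blast
  have okz: "str_ok z1" using ok z(1) str_ok_appendD(2) by metis
  have cz: "on_cycle b z1" unfolding on_cycle_def using z okz by blast
  have "z2 @ z1 = (y2 @ \<beta>') @ y1" using z(1) by simp
  from iffD1[OF append_eq_append_conv2 this] obtain x where
    x: "z2 = y2 @ \<beta>' @ x \<and> x @ z1 = y1 \<or> z2 @ x = y2 @ \<beta>' \<and> z1 = x @ y1" by auto
  have "\<exists>z2 z1 b' m. y2 @ y1 = z2 @ z1 \<and> rot b b' \<and> same_ext z1 b' \<and> prefix (A @ b) (z2 @ wpow m b')"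
  proof (cases "rot b \<beta>")
    case True
    then have rb: "rot b \<beta>'" using assms(3) rot_trans by blast
    have "\<exists>k. prefix (A @ b) (y2 @ wpow k \<beta>')"
      using x
    proof
      assume x: "z2 = y2 @ \<beta>' @ x \<and> x @ z1 = y1"
      have fc: "x @ b' = \<beta>' @ x"
        using x ok1 sy z by (intro follow_cycle_to[OF b z(2) z(3) rb]) simp_all
      obtain k where k: "prefix x (wpow k \<beta>')"
        using prefix_wpow[OF fc] rot_band(3)[OF b rb] by blast
      have "z2 @ wpow m b' = y2 @ wpow (Suc m) \<beta>' @ x"
        using x wpow_conj[OF fc, of m] by simp
      moreover have "prefix (y2 @ wpow (Suc m) \<beta>' @ x) (y2 @ wpow (Suc m) \<beta>' @ wpow k \<beta>')"
        using k by simp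
      moreover have "wpow (Suc m) \<beta>' @ wpow k \<beta>' = wpow (Suc m + k) \<beta>'" by (rule wpow_add[symmetric])
      ultimately show ?thesis using z(4) prefix_order.order_trans by metis
    next
      assume x: "z2 @ x = y2 @ \<beta>' \<and> z1 = x @ y1"
      have fc: "x @ \<beta>' = b' @ x"
        using x okz sy z by (intro follow_cycle_to[OF b rb sy z(2)]) simp_all
      have "(z2 @ wpow m b') @ x = (z2 @ x) @ wpow m \<beta>'" using wpow_conj[OF fc, of m] by simp
      also have "\<dots> = y2 @ wpow (Suc m) \<beta>'" using x by simp
      finally have "prefix (z2 @ wpow m b') (y2 @ wpow (Suc m) \<beta>')" by (metis prefixI)
      then show ?thesis using z(4) prefix_order.order_trans by blast
    qed
    then show ?thesis using rb sy by blast
  next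
    case False
    from x show ?thesis
    proof
      assume "z2 = y2 @ \<beta>' @ x \<and> x @ z1 = y1"
      then have "reach b \<beta>" using reachI[OF b \<beta> cz, of x] cy by simp
      then show ?thesis using reach_antisym[OF b \<beta> _ assms(4)] False by blast
    next
      assume x: "z2 @ x = y2 @ \<beta>' \<and> z1 = x @ y1"
      then have "z2 @ x = y2 @ \<beta>'" by blast
      from iffD1[OF append_eq_append_conv2 this] obtain u where
        "z2 = y2 @ u \<and> u @ x = \<beta>' \<or> z2 @ u = y2 \<and> x = u @ \<beta>'" by auto
      then show ?thesis
      proof
        assume u: "z2 = y2 @ u \<and> u @ x = \<beta>'"
        have "\<beta>' @ y1 = u @ z1" using u x by (metis append.assoc)
        then have "on_cycle \<beta> (u @ z1)" using on_cycle_rot[OF \<beta> assms(3) ok1(1)] by metis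
        then have "reach b \<beta>" using reachI[OF b \<beta> cz] by blast
        then show ?thesis using reach_antisym[OF b \<beta> _ assms(4)] False by blast
      next
        assume u: "z2 @ u = y2 \<and> x = u @ \<beta>'"
        have "same_ext (u @ \<beta>' @ y1) (u @ y1)" using se by (rule same_ext_append)
        moreover have "z1 = u @ \<beta>' @ y1" using x u by simp
        ultimately have "same_ext (u @ y1) b'" using z(3) same_ext_sym same_ext_trans by blast
        moreover have "y2 @ y1 = z2 @ u @ y1" using u by auto
        ultimately show ?thesis using z by blast
      qed
    qed
  qed
  with ok' suf' show ?thesis unfolding linked_def by blast
qed

end

section \<open>Skeletons\<close>

context domestic_alg
begin

lemma band_start_end:
  assumes "bandw b" and "rot b c"
  shows "start_pt \<Lambda> (Syl c) = end_pt \<Lambda> (Syl c)"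
  using end_start_pt[of c c] rot_band(3)[OF assms] rot_band(4)[OF assms, of 2]
  by (simp add: numeral_2_eq_2)

text \<open>A copy of \<open>\<beta>'\<close> is deleted next to another one that has just been
  read, so a loop is removed. The statement about the other bands \<open>\<gamma>\<close> is needed
  because the skeleton applies the multiplicities of the original string after other bands have been
  deleted.\<close>

lemma skeleton_step:
  assumes b: "bandw b" and b0: "bandw b0" and \<beta>: "bandw \<beta>" and "reach \<beta> b"
    and l: "linked A b b0 Y" and c: "contains_pow (Suc (Suc k)) \<beta> Y"
  shows "\<exists>Y'. red \<Lambda> (Syl \<beta>) (Syl Y) = Syl Y' \<and> linked A b b0 Y' \<and> contains_pow (Suc k) \<beta> Y' \<and>
    (\<forall>\<gamma> j. bandw \<gamma> \<and> \<not> rot \<beta> \<gamma> \<and> contains_pow (Suc (Suc j)) \<gamma> Y \<longrightarrow> contains_pow (Suc (Suc j)) \<gamma> Y')"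
proof -
  obtain \<beta>' y2 y1 where r: "rot \<beta> \<beta>'" and Y0: "Y = y2 @ wpow (Suc (Suc k)) \<beta>' @ y1"
    using c unfolding contains_pow_def sublist_def by blast
  note rb = rot_band[OF \<beta> r]
  define R where "R = wpow (Suc k) \<beta>' @ y1"
  have Y: "Y = y2 @ \<beta>' @ R" unfolding R_def Y0 by simp
  have okY: "str_ok Y" using l by (simp add: linked_def)
  have ok1: "str_ok (\<beta>' @ R)" "str_ok R" using okY Y str_ok_appendD(2) by blast+
  have se: "same_ext (\<beta>' @ R) R"
  proof -
    have "same_ext R \<beta>'" using reset[OF rb(1), of "wpow k \<beta>' @ y1"] ok1(2) by (simp add: R_def)
    with reset[OF rb(1) ok1(1)] show ?thesis using same_ext_sym same_ext_trans by blast
  qed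
  \<comment> \<open>A \<open>b0\<close> longer than \<open>R\<close> would contain
    \<open>\<beta>'\<close> and hence be a rotation of \<open>\<beta>\<close>; but then it is no
    longer than the copy of \<open>\<beta>'\<close> at the head of \<open>R\<close>.\<close>
  have "length b0 \<le> length R"
  proof (rule ccontr)
    assume "\<not> length b0 \<le> length R"
    moreover have "suffix R Y" unfolding Y by (simp add: suffix_def)
    moreover have "suffix b0 Y" using l by (simp add: linked_def)
    ultimately have "suffix R b0" using suffix_length_suffix by (metis nat_le_linear)
    then obtain x where "b0 = x @ \<beta>' @ (wpow k \<beta>' @ y1)" unfolding suffix_def R_def by auto
    then have "sublist \<beta>' b0" unfolding sublist_def by blast
    then have "rot b0 \<beta>" using band_factor_rot[OF b0 \<beta> rot_refl r] by blast
    then have "length \<beta>' = length b0" using r rot_length by metis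
    with \<open>\<not> length b0 \<le> length R\<close> show False by (simp add: R_def)
  qed
  from linked_deletion[OF b \<beta> r assms(4) l[unfolded Y] se this] have l': "linked A b b0 (y2 @ R)" .
  have neR: "R \<noteq> []" using rb(3) by (simp add: R_def)
  have "band_reduction \<Lambda> (Syl \<beta>) (Syl Y) (Syl (y2 @ R))"
  proof (rule band_reductionI[OF r rb(3)])
    show "is_string \<Lambda> (Syl Y)" "is_string \<Lambda> (Syl (y2 @ R))"
      using okY l' Y neR by (simp_all add: linked_def)
    show "start_pt \<Lambda> (Syl (y2 @ R)) = start_pt \<Lambda> (Syl Y)" using neR Y by simp
    show "end_pt \<Lambda> (Syl (y2 @ R)) = end_pt \<Lambda> (Syl Y)"
      using neR Y rb(3) by (cases "y2 = []") (simp_all add: R_def)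
    show "start_pt \<Lambda> (Syl \<beta>') = end_pt \<Lambda> (Syl \<beta>')" using band_start_end[OF \<beta> r] .
  qed (simp_all add: Y)
  from red_eq[OF \<beta> this] have red: "red \<Lambda> (Syl \<beta>) (Syl Y) = Syl (y2 @ R)" .
  have con: "contains_pow (Suc k) \<beta> (y2 @ R)"
    using r unfolding contains_pow_def sublist_def R_def by blast
  have "contains_pow (Suc (Suc j)) \<gamma> (y2 @ R)"
    if \<gamma>: "bandw \<gamma>" "\<not> rot \<beta> \<gamma>" and cg: "contains_pow (Suc (Suc j)) \<gamma> Y" for \<gamma> j
  proof -
    obtain \<gamma>' g2 g1 where rg: "rot \<gamma> \<gamma>'" and Yg: "Y = g2 @ wpow (Suc (Suc j)) \<gamma>' @ g1"
      using cg unfolding contains_pow_def sublist_def by blast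
    define G where "G = wpow (Suc (Suc j)) \<gamma>'"
    have containsI: "contains_pow (Suc (Suc j)) \<gamma> w" if "w = u @ G @ v" for u v w
      using that rg unfolding contains_pow_def sublist_def G_def by blast
    \<comment> \<open>The times spent on the two cycles are disjoint, so one of the powers is read first.\<close>
    have okg: "str_ok (\<gamma>' @ g1)" "str_ok (G @ g1)"
      using okY Yg str_ok_appendD(2)[of "g2 @ wpow (Suc j) \<gamma>'" "\<gamma>' @ g1"] str_ok_appendD(2)[of g2 "G @ g1"]
      by (simp_all add: wpow_commute_append G_def)
    have okb: "str_ok (\<beta>' @ y1)"
      using ok1 str_ok_appendD(2)[of "wpow k \<beta>'" "\<beta>' @ y1"] by (simp add: wpow_commute_append R_def)
    have cyc\<gamma>: "on_cycle \<gamma> (\<gamma>' @ g1)" "on_cycle \<gamma> (G @ g1)"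
      using on_cycle_rot[OF \<gamma>(1) rg okg(1)] on_cycle_rot[OF \<gamma>(1) rg, of "wpow (Suc j) \<gamma>' @ g1"] okg(2)
      by (simp_all add: G_def)
    have cyc\<beta>: "on_cycle \<beta> (\<beta>' @ y1)" "on_cycle \<beta> (\<beta>' @ R)"
      using on_cycle_rot[OF \<beta> r] okb ok1(1) by blast+
    have Yb: "Y = (y2 @ wpow (Suc k) \<beta>') @ (\<beta>' @ y1)" unfolding Y0 by (simp add: wpow_commute_append)
    have Ybb: "Y = y2 @ (\<beta>' @ R)" using Y by simp
    have Ygg: "Y = g2 @ (G @ g1)" using Yg by (simp add: G_def)
    have Yg1: "Y = (g2 @ wpow (Suc j) \<gamma>') @ (\<gamma>' @ g1)" unfolding Yg by (simp add: wpow_commute_append)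
    have suf: "suffix s t \<or> suffix t s" if "Y = p @ s" "Y = q @ t" for p q s t
      using that by (metis suffixI suffix_same_cases)
    have nr: "\<not> (reach \<beta> \<gamma> \<and> reach \<gamma> \<beta>)" using reach_antisym[OF \<beta> \<gamma>(1)] \<gamma>(2) by blast
    \<comment> \<open>\<open>\<beta>' @ y1\<close> and \<open>\<gamma>' @ g1\<close> are read up to
      the end of the first copy, \<open>\<beta>' @ R\<close> and \<open>G @ g1\<close> up to the end
      of the last one. If both alternatives failed, each cycle would be visited after the
      other.\<close>
    have "suffix (G @ g1) (\<beta>' @ y1) \<or> suffix (\<beta>' @ R) (\<gamma>' @ g1)"
    proof (rule ccontr)
      assume n: "\<not> ?thesis"
      then obtain u where u: "\<beta>' @ y1 = u" "suffix u (G @ g1)" using suf[OF Ygg Yb] by blast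
      obtain v where v: "\<gamma>' @ g1 = v" "suffix v (\<beta>' @ R)" using n suf[OF Yg1 Ybb] by blast
      have r1: "reach \<beta> \<gamma>" using u cyc\<beta>(1) cyc\<gamma>(2) reachI[OF \<beta> \<gamma>(1)] unfolding suffix_def by metis
      have r2: "reach \<gamma> \<beta>" using v cyc\<beta>(2) cyc\<gamma>(1) reachI[OF \<gamma>(1) \<beta>] unfolding suffix_def by metis
      show False using nr r1 r2 by blast
    qed
    then show ?thesis
    proof
      assume "suffix (G @ g1) (\<beta>' @ y1)"
      then obtain x where "\<beta>' @ y1 = x @ G @ g1" unfolding suffix_def by blast
      then have "y2 @ R = (y2 @ wpow k \<beta>' @ x) @ G @ g1"
        using wpow_commute_append[of k \<beta>' y1] unfolding R_def by simp
      then show ?thesis by (rule containsI)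
    next
      assume s: "suffix (\<beta>' @ R) (\<gamma>' @ g1)"
      then obtain x where x: "\<gamma>' @ g1 = x @ \<beta>' @ R" unfolding suffix_def by blast
      have R: "R = wpow k \<beta>' @ (\<beta>' @ y1)" unfolding R_def by (simp add: wpow_commute_append)
      have "\<gamma>' @ g1 = (x @ \<beta>' @ wpow k \<beta>') @ (\<beta>' @ y1)" using x R by simp
      from iffD1[OF append_eq_append_conv2 this] obtain z where
        z: "\<gamma>' = (x @ \<beta>' @ wpow k \<beta>') @ z \<and> z @ g1 = \<beta>' @ y1 \<or>
            \<gamma>' @ z = x @ \<beta>' @ wpow k \<beta>' \<and> g1 = z @ \<beta>' @ y1" by auto
      then show ?thesis
      proof
        assume "\<gamma>' = (x @ \<beta>' @ wpow k \<beta>') @ z \<and> z @ g1 = \<beta>' @ y1"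
        then have "sublist \<beta>' \<gamma>'" by (auto simp: sublist_def)
        then show ?thesis using band_factor_rot[OF \<gamma>(1) \<beta> rg r] \<gamma>(2) rot_sym by blast
      next
        assume z: "\<gamma>' @ z = x @ \<beta>' @ wpow k \<beta>' \<and> g1 = z @ \<beta>' @ y1"
        have "y2 @ wpow (Suc k) \<beta>' @ (\<beta>' @ y1) = (g2 @ G @ z) @ (\<beta>' @ y1)"
          using Ygg Yb z by simp
        then have "y2 @ wpow (Suc k) \<beta>' = g2 @ G @ z" by (simp del: concat.simps replicate.simps)
        then have "y2 @ R = g2 @ G @ (z @ y1)" unfolding R_def by (metis append.assoc)
        then show ?thesis by (rule containsI)
      qed
    qed
  qed
  with red l' con show ?thesis by blast
qed

lemma skeleton_steps:
  assumes b: "bandw b" and b0: "bandw b0" and \<beta>: "bandw \<beta>" and "reach \<beta> b"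
    and l: "linked A b b0 Y" and c: "contains_pow (Suc k) \<beta> Y"
  shows "\<exists>Y'. (red \<Lambda> (Syl \<beta>) ^^ k) (Syl Y) = Syl Y' \<and> linked A b b0 Y' \<and>
    (\<forall>\<gamma> j. bandw \<gamma> \<and> \<not> rot \<beta> \<gamma> \<and> contains_pow (Suc (Suc j)) \<gamma> Y \<longrightarrow> contains_pow (Suc (Suc j)) \<gamma> Y')"
  using l c
proof (induction k arbitrary: Y)
  case (Suc k)
  from skeleton_step[OF assms(1-4) Suc.prems] obtain Y1 where
    Y1: "red \<Lambda> (Syl \<beta>) (Syl Y) = Syl Y1" "linked A b b0 Y1" "contains_pow (Suc k) \<beta> Y1"
    "\<And>\<gamma> j. bandw \<gamma> \<and> \<not> rot \<beta> \<gamma> \<and> contains_pow (Suc (Suc j)) \<gamma> Y \<Longrightarrow> contains_pow (Suc (Suc j)) \<gamma> Y1"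
    by blast
  from Suc.IH[OF Y1(2,3)] obtain Y' where
    Y': "(red \<Lambda> (Syl \<beta>) ^^ k) (Syl Y1) = Syl Y'" "linked A b b0 Y'"
    "\<And>\<gamma> j. bandw \<gamma> \<and> \<not> rot \<beta> \<gamma> \<and> contains_pow (Suc (Suc j)) \<gamma> Y1 \<Longrightarrow> contains_pow (Suc (Suc j)) \<gamma> Y'"
    by blast
  have "(red \<Lambda> (Syl \<beta>) ^^ Suc k) (Syl Y) = Syl Y'"
    using Y1(1) Y'(1) by (simp add: funpow_swap1)
  then show ?case using Y'(2,3) Y1(4) by blast
qed auto

text \<open>\<open>N\<close> stands for the multiplicities in the original string. Bands with
  \<open>N \<beta> \<le> 1\<close> call for no deletion, so only powers with exponent at least 2
  have to survive the deletions of other bands.\<close>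

lemma skeleton_fold:
  assumes b: "bandw b" and b0: "bandw b0" and "distinct bs"
    and "\<And>\<beta>. \<beta> \<in> set bs \<Longrightarrow> \<exists>w. \<beta> = Syl w \<and> bandw w \<and>
           (N \<beta> \<ge> 2 \<longrightarrow> contains_pow (N \<beta>) w Y \<and> reach w b)"
    and "\<And>\<beta> \<gamma> v w. \<beta> \<in> set bs \<Longrightarrow> \<gamma> \<in> set bs \<Longrightarrow> \<beta> = Syl v \<Longrightarrow> \<gamma> = Syl w \<Longrightarrow> rot v w \<Longrightarrow> \<beta> = \<gamma>"
    and "linked A b b0 Y"
  shows "\<exists>Y'. fold (\<lambda>\<beta>. red \<Lambda> \<beta> ^^ (N \<beta> - 1)) bs (Syl Y) = Syl Y' \<and> linked A b b0 Y'"
  using assms(3-)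
proof (induction bs arbitrary: Y)
  case (Cons \<beta> bs)
  obtain w where w: "\<beta> = Syl w" "bandw w" "N \<beta> \<ge> 2 \<Longrightarrow> contains_pow (N \<beta>) w Y \<and> reach w b"
    using Cons.prems(2)[of \<beta>] by auto
  have "\<exists>Y1. (red \<Lambda> \<beta> ^^ (N \<beta> - 1)) (Syl Y) = Syl Y1 \<and> linked A b b0 Y1 \<and>
    (\<forall>\<gamma> j. bandw \<gamma> \<and> \<not> rot w \<gamma> \<and> contains_pow (Suc (Suc j)) \<gamma> Y \<longrightarrow> contains_pow (Suc (Suc j)) \<gamma> Y1)"
  proof (cases "N \<beta> \<ge> 2")
    case True
    then have "Suc (N \<beta> - 1) = N \<beta>" by simp
    then show ?thesis
      using skeleton_steps[OF b b0 w(2), of A Y "N \<beta> - 1"] w(3)[OF True] Cons.prems(4) w(1) by simp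
  next
    case False
    then have "N \<beta> - 1 = 0" by simp
    then show ?thesis using Cons.prems(4) by auto
  qed
  then obtain Y1 where Y1: "(red \<Lambda> \<beta> ^^ (N \<beta> - 1)) (Syl Y) = Syl Y1" "linked A b b0 Y1"
    "\<And>\<gamma> j. bandw \<gamma> \<Longrightarrow> \<not> rot w \<gamma> \<Longrightarrow> contains_pow (Suc (Suc j)) \<gamma> Y \<Longrightarrow> contains_pow (Suc (Suc j)) \<gamma> Y1"
    by blast
  have "\<exists>Y'. fold (\<lambda>\<beta>. red \<Lambda> \<beta> ^^ (N \<beta> - 1)) bs (Syl Y1) = Syl Y' \<and> linked A b b0 Y'"
  proof (rule Cons.IH)
    show "distinct bs" using Cons.prems(1) by simp
    show "linked A b b0 Y1" by (rule Y1(2))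
    show "\<gamma> = \<delta>" if "\<gamma> \<in> set bs" "\<delta> \<in> set bs" "\<gamma> = Syl v" "\<delta> = Syl v'" "rot v v'" for \<gamma> \<delta> v v'
      using Cons.prems(3)[of \<gamma> \<delta> v v'] that by simp
    fix \<gamma> assume \<gamma>: "\<gamma> \<in> set bs"
    then obtain v where v: "\<gamma> = Syl v" "bandw v" "N \<gamma> \<ge> 2 \<longrightarrow> contains_pow (N \<gamma>) v Y \<and> reach v b"
      using Cons.prems(2)[of \<gamma>] by auto
    have "\<not> rot w v" using Cons.prems(1) Cons.prems(3)[of \<beta> \<gamma> w v] \<gamma> w(1) v(1) by auto
    have "contains_pow (N \<gamma>) v Y1" if "N \<gamma> \<ge> 2"
    proof -
      have "N \<gamma> = Suc (Suc (N \<gamma> - 2))" using that by simp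
      then show ?thesis using Y1(3)[OF v(2) \<open>\<not> rot w v\<close>, of "N \<gamma> - 2"] v(3) that by simp
    qed
    then show "\<exists>w. \<gamma> = Syl w \<and> bandw w \<and> (N \<gamma> \<ge> 2 \<longrightarrow> contains_pow (N \<gamma>) w Y1 \<and> reach w b)"
      using v by blast
  qed
  then show ?case using Y1(1) by simp
qed simp

section \<open>Squares of bands in the string of a path\<close>

definition band_free_word :: "'a syllable list \<Rightarrow> bool" where
  "band_free_word w \<longleftrightarrow> (\<forall>\<gamma> \<gamma>'. bandw \<gamma> \<longrightarrow> rot \<gamma> \<gamma>' \<longrightarrow> \<not> sublist \<gamma>' w)"

lemma band_free_wordD: "band_free_word w \<Longrightarrow> bandw \<gamma> \<Longrightarrow> rot \<gamma> \<gamma>' \<Longrightarrow> w \<noteq> x @ \<gamma>' @ y"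
  unfolding band_free_word_def by (metis sublist_appendI)

text \<open>
  \<open>bn\<close> is either a band or, for reverse half bridges, empty.  A square \<open>\<beta>\<^sup>2\<close> read after \<open>b\<close> would
  have to overlap \<open>b\<close> in direct syllables only and \<open>bn\<close> in inverse syllables only; the part
  in between then contains a rotation of \<open>\<beta>\<close>.
\<close>

lemma square_before_last_arrow:
  assumes b: "bandw b" and \<beta>: "bandw \<beta>" and bn: "bn = [] \<or> bandw bn"
    and ok: "str_ok ((bn @ un) @ b @ w)" and free: "band_free_word un"
    and sq: "contains_pow 2 \<beta> ((bn @ un) @ b @ w)"
  shows "reach \<beta> b"
proof -
  obtain \<beta>' y2 y1 where r: "rot \<beta> \<beta>'" and Y: "(bn @ un) @ b @ w = (y2 @ \<beta>') @ (\<beta>' @ y1)"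
    using sq unfolding contains_pow_def sublist_def by (auto simp: numeral_2_eq_2)
  note rb = rot_band[OF \<beta> r] and no = band_free_wordD[OF free \<beta> r]
  have okb: "str_ok (b @ w)" using ok str_ok_appendD(2) by blast
  have okY: "str_ok ((y2 @ \<beta>') @ (\<beta>' @ y1))" using ok unfolding Y .
  then have ok1: "str_ok (\<beta>' @ y1)" "str_ok (\<beta>' @ \<beta>' @ y1)"
    using str_ok_appendD(2)[of "y2 @ \<beta>'" "\<beta>' @ y1"] str_ok_appendD(2)[of y2 "\<beta>' @ \<beta>' @ y1"] by simp_all
  have cb: "on_cycle b (b @ w)" using on_cycle_rot[OF b rot_refl okb] .
  have c\<beta>: "on_cycle \<beta> (\<beta>' @ y1)" "on_cycle \<beta> (\<beta>' @ \<beta>' @ y1)" "on_cycle \<beta> \<beta>'"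
    using on_cycle_rot[OF \<beta> r] ok1 on_cycle_rot[OF \<beta> r, of "[]"] rb(5) by auto
  from iffD1[OF append_eq_append_conv2 Y] obtain x where
    "bn @ un = (y2 @ \<beta>') @ x \<and> x @ b @ w = \<beta>' @ y1 \<or>
     (bn @ un) @ x = y2 @ \<beta>' \<and> b @ w = x @ \<beta>' @ y1" by auto
  then show ?thesis
  proof
    assume "(bn @ un) @ x = y2 @ \<beta>' \<and> b @ w = x @ \<beta>' @ y1"
    then show ?thesis using reachI[OF \<beta> b c\<beta>(1), of x] cb by simp
  next
    assume "bn @ un = (y2 @ \<beta>') @ x \<and> x @ b @ w = \<beta>' @ y1"
    then have x: "bn @ un = y2 @ \<beta>' @ x" "\<beta>' @ y1 = x @ b @ w" by simp_all
    \<comment> \<open>In written order, the copy of \<open>\<beta>'\<close> that is read last begins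
      in \<open>bn\<close> and ends in \<open>un\<close>: it does not fit into the band-free
      \<open>un\<close>, and if it fits into \<open>bn\<close> it exhausts it.\<close>
    have xun: "\<exists>e v. bn = y2 @ e \<and> e @ v = \<beta>' \<and> un = v @ x"
    proof -
      from iffD1[OF append_eq_append_conv2 x(1)] obtain e where
        "bn = y2 @ e \<and> e @ un = \<beta>' @ x \<or> bn @ e = y2 \<and> un = e @ \<beta>' @ x" by auto
      then have e: "bn = y2 @ e" "e @ un = \<beta>' @ x" using no by blast+
      from iffD1[OF append_eq_append_conv2 e(2)] obtain v where
        "e = \<beta>' @ v \<and> v @ un = x \<or> e @ v = \<beta>' \<and> un = v @ x" by auto
      then show ?thesis
      proof
        assume v: "e = \<beta>' @ v \<and> v @ un = x"
        then have "bn \<noteq> []" "sublist \<beta>' bn" using e(1) rb(3) unfolding sublist_def by auto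
        then have "rot bn \<beta>" using bn band_factor_rot[OF _ \<beta> rot_refl r] by blast
        then have "length bn = length \<beta>'" using rot_length r by metis
        then have "v = []" using e(1) v by simp
        then show ?thesis using e(1) v by auto
      qed (use e in blast)
    qed
    then obtain e v where e: "bn = y2 @ e" "e @ v = \<beta>'" "un = v @ x" by blast
    have "e \<noteq> []" using no[of "[]" x] e by auto
    then have bn': "bandw bn" using bn e(1) by auto
    have "last bn = last e" using e(1) \<open>e \<noteq> []\<close> by simp
    \<comment> \<open>The copy read first is \<open>x @ d\<close>, where \<open>d\<close> is its
      part inside \<open>b @ w\<close>. A mixed \<open>d\<close> fixes a state on the cycle of
      \<open>b\<close> that is also met when going around \<open>\<beta>\<close>.\<close>
    from iffD1[OF append_eq_append_conv2 x(2)] obtain d where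
      "\<beta>' = x @ d \<and> d @ y1 = b @ w \<or> \<beta>' @ d = x \<and> y1 = d @ b @ w" by auto
    then have d: "\<beta>' = x @ d" "d @ y1 = b @ w" using no[of v d] e(3) by auto
    have "d \<noteq> []" using no[of v "[]"] e(3) d(1) by auto
    show ?thesis
    proof (cases "mixed d")
      case True
      have okd: "str_ok (d @ \<beta>')" using rot_band(4)[OF \<beta> r, of 2] d(1)
        str_ok_appendD(2)[of x "d @ \<beta>'"] by (simp add: numeral_2_eq_2)
      have "same_ext (d @ \<beta>') d" using reset[OF True okd] .
      moreover have "same_ext (b @ w) d" using reset[OF True, of y1] d(2) okb by simp
      ultimately have "on_cycle b (d @ \<beta>')"
        using cb on_cycle_same_ext same_ext_sym same_ext_trans by blast
      then show ?thesis using reachI[OF \<beta> b c\<beta>(3)] by blast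
    next
      case False
      have "hd d = hd b" using d(2) \<open>d \<noteq> []\<close> band_nonempty[OF b] by (metis hd_append2)
      then have dir: "\<forall>\<alpha> \<in> set d. is_direct \<alpha>"
        using False band_hd[OF b] \<open>d \<noteq> []\<close> unfolding mixed_def by (metis hd_in_set)
      show ?thesis
      proof (cases "rot bn \<beta>")
        case True
        then have rn: "rot bn \<beta>'" using r rot_trans by blast
        have okn: "str_ok (bn @ un @ b @ w)" using ok by simp
        have eqn: "(y2 @ \<beta>') @ \<beta>' @ y1 = bn @ un @ b @ w" using Y by simp
        \<comment> \<open>Here the walk from \<open>\<beta>'\<close> to \<open>bn\<close> follows a
          single cycle, which turns \<open>un @ d\<close> into \<open>bn @ y2\<close>. As
          \<open>un\<close> is band-free, the last entry of \<open>bn\<close>, an inverse syllable,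
          falls into the direct word \<open>d\<close>.\<close>
        have "(y2 @ \<beta>') @ \<beta>' = bn @ (y2 @ \<beta>')"
          using eqn okn reset[OF band_mixed[OF bn'] okn] reset[OF rb(1) ok1(1)]
          by (intro follow_cycle_to[OF bn' rn _ rot_refl, of "\<beta>' @ y1"]) simp_all
        then have y2: "y2 @ \<beta>' = bn @ y2" by (metis append.assoc append_same_eq)
        have "bn @ un @ d = y2 @ \<beta>' @ \<beta>'" using x(1) d(1) by (metis append.assoc)
        also have "\<dots> = bn @ y2 @ \<beta>'" using y2 by (metis append.assoc)
        finally have ud: "un @ d = bn @ y2" using y2 by simp
        from iffD1[OF append_eq_append_conv2 ud] obtain d1 where
          "un = bn @ d1 \<and> d1 @ d = y2 \<or> un @ d1 = bn \<and> d = d1 @ y2" by auto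
        then have d1: "un @ d1 = bn" "d = d1 @ y2"
          using band_free_wordD[OF free bn' rot_refl, of "[]" d1] by auto
        have "d1 \<noteq> []" using d1(1) band_free_wordD[OF free bn' rot_refl, of "[]" "[]"] by auto
        then have "last bn \<in> set d" using d1 by (metis Un_iff last_appendR last_in_set set_append)
        then show ?thesis using dir band_last[OF bn'] by blast
      next
        case nrot: False
        \<comment> \<open>A mixed \<open>e\<close> would fix a state on the cycle of
          \<open>\<beta>\<close> that is reached from \<open>bn\<close>, while \<open>bn\<close> is
          reached from \<open>\<beta>\<close>.\<close>
        have "\<not> mixed e"
        proof
          assume m: "mixed e"
          have "str_ok (bn @ bn)" using band_wpow[OF bn', of 2] by (simp add: numeral_2_eq_2)
          then have "str_ok (e @ bn)" using e(1) str_ok_appendD(2) by (metis append.assoc)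
          then have s: "same_ext (e @ bn) e" by (rule reset[OF m])
          have "same_ext (\<beta>' @ \<beta>' @ y1) e"
            using reset[OF m, of "v @ \<beta>' @ y1"] ok1(2) e(2) by (metis append.assoc)
          with s have "on_cycle \<beta> (e @ bn)"
            using c\<beta>(2) on_cycle_same_ext same_ext_sym same_ext_trans by blast
          moreover have cn: "on_cycle bn bn" "on_cycle bn (y2 @ \<beta>' @ \<beta>' @ y1)"
            using on_cycle_rot[OF bn' rot_refl, of "[]"] rot_band(5)[OF bn' rot_refl]
              on_cycle_rot[OF bn' rot_refl, of "un @ b @ w"] ok Y by simp_all
          ultimately have "reach bn \<beta>" "reach \<beta> bn"
            using reachI[OF bn' \<beta> cn(1)] reachI[OF \<beta> bn' c\<beta>(2)] by blast+
          then show False using reach_antisym[OF bn' \<beta>] nrot by blast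
        qed
        then have inv: "\<forall>\<alpha> \<in> set e. \<not> is_direct \<alpha>"
          using band_last[OF bn'] \<open>last bn = last e\<close> \<open>e \<noteq> []\<close> unfolding mixed_def by (metis last_in_set)
        have "e @ v = x @ d" using e(2) d(1) by simp
        from iffD1[OF append_eq_append_conv2 this] obtain u where
          "e = x @ u \<and> u @ v = d \<or> e @ u = x \<and> v = u @ d" by auto
        then have "\<exists>u. e @ u = x \<and> v = u @ d"
        proof
          assume u: "e = x @ u \<and> u @ v = d"
          then have "u = []" using dir inv by (cases u) auto
          with u show ?thesis by auto
        qed auto
        then obtain u where u: "e @ u = x" "v = u @ d" by blast
        \<comment> \<open>The word \<open>d @ e @ u\<close> is a rotation of
          \<open>\<beta>' = e @ u @ d\<close>.\<close>
        have un: "un = u @ (d @ e @ u) @ []" using e(3) u by simp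
        have "\<beta>' = (e @ u) @ d" using d(1) u by simp
        then have "rot \<beta>' (d @ e @ u)" unfolding rot_def by blast
        then have "rot \<beta> (d @ e @ u)" using r rot_trans by blast
        then show ?thesis using band_free_wordD[OF free \<beta>, of _ u "[]"] un by blast
      qed
    qed
  qed
qed

text \<open>The witness of the H-reduction may differ from the deletion performed by
  \<open>red\<close> in band and place. Both yield the same word, so
  \<open>rot_if_same_deletion\<close> identifies the bands, and the witness shows a place where the
  deleted word is a loop. This place lies beyond \<open>b0\<close>, since \<open>b0\<close> reaches
  \<open>\<beta>\<close> without being on the same cycle.\<close>

lemma H_red_step:
  assumes b: "bandw b" and b0: "bandw b0" and \<beta>: "bandw \<beta>" and "reach \<beta> b" and "reach b0 \<beta>"
    and nr: "\<not> rot b0 \<beta>" and l: "linked A b b0 Y"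
  shows "\<exists>Y'. H_red \<Lambda> B (Syl \<beta>) (Syl Y) = Syl Y' \<and> linked A b b0 Y'"
proof (cases "Syl \<beta> \<in> bands_in \<Lambda> B (Syl Y) \<and> (\<exists>z. band_reduction \<Lambda> (Syl \<beta>) (Syl Y) z) \<and>
    H_reduction \<Lambda> (Syl Y) (red \<Lambda> (Syl \<beta>) (Syl Y))")
  case False
  then have "H_red \<Lambda> B (Syl \<beta>) (Syl Y) = Syl Y"
    unfolding H_red_def by (rule if_not_P)
  then show ?thesis using l by blast
next
  case True
  define z where "z = red \<Lambda> (Syl \<beta>) (Syl Y)"
  have H: "H_red \<Lambda> B (Syl \<beta>) (Syl Y) = z"
    using True unfolding H_red_def z_def by (rule if_P)
  have "band_reduction \<Lambda> (Syl \<beta>) (Syl Y) z" unfolding z_def red_def using True by (metis someI_ex)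
  from band_reductionD[OF this] obtain x2 \<beta>' x1 where
    x: "rot \<beta> \<beta>'" "Y = x2 @ \<beta>' @ x1" "syls z = x2 @ x1" by auto
  have "H_reduction \<Lambda> (Syl Y) z" using True z_def by simp
  then obtain c q2 c' q1 w where h: "band \<Lambda> c" "cyclic_perm c c'" "prd \<Lambda> [q2, c', q1] = Some (Syl Y)"
    "prd \<Lambda> [c', q1] = Some w" "H_equiv \<Lambda> w q1" "prd \<Lambda> [q2, q1] = Some z"
    unfolding H_reduction_def by blast
  obtain \<delta> where c': "c' = Syl \<delta>" using h(2) unfolding cyclic_perm_def by blast
  define y2 y1 where "y2 = syls q2" and "y1 = syls q1"
  have Y: "Y = y2 @ \<delta> @ y1" and z: "syls z = y2 @ y1"
    using prd3_syls[OF h(3)] prd2_syls[OF h(6)] unfolding c' y2_def y1_def by simp_all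
  have "length \<delta> = length \<beta>'"
  proof -
    have "length Y = length (syls z) + length \<delta>" unfolding Y z by simp
    moreover have "length Y = length (syls z) + length \<beta>'" unfolding x by simp
    ultimately show ?thesis by simp
  qed
  from rot_if_same_deletion[OF x(2)[symmetric, unfolded Y] x(3)[symmetric, unfolded z] this[symmetric]]
  have "rot \<beta>' \<delta>" .
  then have r: "rot \<beta> \<delta>" using x(1) rot_trans by blast
  have nf: "\<not> sublist \<delta> b0" "\<not> sublist b0 \<delta>"
    using band_factor_rot[OF b0 \<beta> rot_refl r] band_factor_rot[OF \<beta> b0 r rot_refl] nr rot_sym by blast+
  have suf: "suffix b0 (y2 @ \<delta> @ y1)" and okY: "str_ok (y2 @ \<delta> @ y1)"
    using l Y by (simp_all add: linked_def)
  \<comment> \<open>Were \<open>y1\<close> empty, \<open>b0\<close> and \<open>\<delta>\<close>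
    would both be suffixes of the string, hence one a factor of the other.\<close>
  have "y1 \<noteq> []"
  proof
    assume "y1 = []"
    then have "suffix b0 (y2 @ \<delta>)" "suffix \<delta> (y2 @ \<delta>)" using suf by (auto simp: suffix_def)
    then have "suffix b0 \<delta> \<or> suffix \<delta> b0" by (rule suffix_same_cases)
    then show False using nf suffix_imp_sublist by blast
  qed
  then have q1: "q1 = Syl y1" unfolding y1_def by (intro Syl_eqI) auto
  then have w: "w = Syl (\<delta> @ y1)" using prd2_iff[of c' q1 w] h(4) c' by auto
  have se: "same_ext (\<delta> @ y1) y1" using H_equiv_same_ext h(5) unfolding w q1 by blast
  have ok1: "str_ok (\<delta> @ y1)" "str_ok y1" using okY str_ok_appendD(2) by blast+
  have c\<beta>: "on_cycle \<beta> y1"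
    using on_cycle_rot[OF \<beta> r ok1(1)] on_cycle_same_ext same_ext_sym[OF se] by blast
  have len: "length b0 \<le> length y1"
  proof (rule ccontr)
    assume "\<not> length b0 \<le> length y1"
    moreover have "suffix y1 (y2 @ \<delta> @ y1)" by (simp add: suffix_def)
    ultimately have "suffix y1 b0" using suf suffix_length_suffix by (metis nat_le_linear)
    then obtain v where "b0 = v @ y1" unfolding suffix_def by blast
    moreover have "on_cycle b0 b0"
      using on_cycle_rot[OF b0 rot_refl, of "[]"] rot_band(5)[OF b0 rot_refl] by simp
    ultimately have "reach \<beta> b0" using reachI[OF \<beta> b0 c\<beta>, of v] by simp
    then show False using reach_antisym[OF b0 \<beta> assms(5)] nr by blast
  qed
  have "linked A b b0 (y2 @ y1)"
    using linked_deletion[OF b \<beta> r assms(4) _ se len] l unfolding Y by blast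
  moreover have "z = Syl (y2 @ y1)" using z \<open>y1 \<noteq> []\<close> by (intro Syl_eqI) auto
  ultimately show ?thesis using H by blast
qed

end

section \<open>Extracting a factorization\<close>

lemma last_change:
  assumes "P []" and "\<not> P x"
  shows "\<exists>x2 g x1. x = x2 @ g # x1 \<and> P x1 \<and> \<not> P (g # x1)"
  using assms
proof (induction x)
  case (Cons a x)
  show ?case
  proof (cases "P x")
    case True
    then show ?thesis using Cons.prems by blast
  next
    case False
    with Cons.IH Cons.prems(1) obtain x2 g x1 where "x = x2 @ g # x1" "P x1" "\<not> P (g # x1)" by blast
    then show ?thesis by (intro exI[of _ "a # x2"]) auto
  qed
qed simp

context domestic_alg
begin

lemma on_cycle_wpow: "bandw b \<Longrightarrow> rot b b' \<Longrightarrow> same_ext a b' \<Longrightarrow> same_ext (wpow n b' @ a) a"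
proof (induction n)
  case (Suc n)
  have "same_ext (b' @ wpow n b' @ a) (b' @ a)" using Suc by (intro same_ext_append) blast
  then show ?case using cycle_loop[OF Suc.prems] same_ext_trans by simp
qed simp

lemma on_cycle_self: "bandw b \<Longrightarrow> rot b b' \<Longrightarrow> on_cycle b b'"
  using on_cycle_rot[of b b' "[]"] rot_band(5)[of b b'] by simp

lemma on_cycle_next:
  assumes b: "bandw b" and "on_cycle b a"
  shows "\<exists>d. on_cycle b (d # a)"
proof -
  obtain b' where b': "rot b b'" "same_ext a b'" using assms(2) unfolding on_cycle_def by blast
  obtain c d where c: "b' = c @ [d]" using rot_band(3)[OF b b'(1)] by (metis rev_exhaust)
  have "rot b' (d # c)" unfolding rot_def c by (metis append_Cons append_Nil)
  then have r: "rot b (d # c)" using b'(1) rot_trans by blast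
  have "str_ok ((d # c) @ [d])"
    using rot_band(4)[OF b b'(1), of 2] str_ok_appendD(2)[of c "d # c @ [d]"]
    by (simp add: c numeral_2_eq_2)
  then have "on_cycle b (d # b')" using on_cycle_rot[OF b r, of "[d]"] by (simp add: c)
  moreover have "same_ext (d # a) (d # b')" using same_ext_append[OF b'(2), of "[d]"] by simp
  ultimately show ?thesis using on_cycle_same_ext by blast
qed

text \<open>
  A string that reads an initial part \<open>x e\<close> of the band \<open>bn\<close> after \<open>w\<close> only reads inverse syllables
  there. Leaving the cycle of \<open>\<gamma>\<close> within \<open>x\<close>, it could instead continue with a direct syllable
  on that cycle, and so could \<open>bn\<close>.
\<close>

lemma overlap_meets_one_cycle:
  assumes \<gamma>: "bandw \<gamma>" and b: "bandw b" and bn: "bandw bn"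
    and "\<not> rot \<gamma> b" and "\<not> rot b bn" and "reach b bn"
    and eq: "bn = f @ x @ e" and "e \<noteq> []"
    and c\<gamma>: "on_cycle \<gamma> (e @ w)" and cb: "on_cycle b (x @ e @ w)"
  shows False
proof -
  have nbn: "\<not> reach bn b" using reach_antisym[OF b bn assms(6)] assms(5) by blast
  have r\<gamma>b: "reach \<gamma> b" using reachI[OF \<gamma> b c\<gamma> cb] .
  have okxe: "str_ok (x @ e @ bn)"
    using band_wpow[OF bn, of 2] str_ok_appendD(2)[of f "x @ e @ bn"] eq by (simp add: numeral_2_eq_2)
  \<comment> \<open>A mixed \<open>x @ e\<close> would lead to the cycle of \<open>b\<close> also
    when it is read after a full \<open>bn\<close>.\<close>
  have "\<not> mixed (x @ e)"
  proof
    assume m: "mixed (x @ e)"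
    have "same_ext ((x @ e) @ w) (x @ e)" "same_ext ((x @ e) @ bn) (x @ e)"
      using reset[OF m, of w] reset[OF m, of bn] on_cycle_str_ok[OF cb] okxe by simp_all
    then have "on_cycle b (x @ e @ bn)"
      using cb on_cycle_same_ext same_ext_sym same_ext_trans by (metis append.assoc)
    then have "reach bn b" using reachI[OF bn b on_cycle_self[OF bn rot_refl], of "x @ e"] by simp
    then show False using nbn by blast
  qed
  moreover have "last (x @ e) = last bn" using eq \<open>e \<noteq> []\<close> by simp
  then have "last e \<in> set (x @ e)" "\<not> is_direct (last e)"
    using band_last[OF bn] last_in_set[OF \<open>e \<noteq> []\<close>] \<open>e \<noteq> []\<close> by (auto simp del: last_in_set)
  ultimately have inv: "\<forall>\<alpha> \<in> set (x @ e). \<not> is_direct \<alpha>" unfolding mixed_def by blast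
  have "\<not> on_cycle \<gamma> (x @ e @ w)" using on_cycle_disjoint[OF \<gamma> b _ cb] assms(4) by blast
  \<comment> \<open>\<open>g\<close> is a syllable with which the walk leaves the cycle of
    \<open>\<gamma>\<close>; \<open>d\<close> below is one with which it would have stayed
    there.\<close>
  with last_change[of "\<lambda>x. on_cycle \<gamma> (x @ e @ w)" x] c\<gamma> obtain x2 g x1 where
    x: "x = x2 @ g # x1" and in\<gamma>: "on_cycle \<gamma> (x1 @ e @ w)" and out: "\<not> on_cycle \<gamma> (g # x1 @ e @ w)"
    by auto
  obtain d where d: "on_cycle \<gamma> (d # x1 @ e @ w)" using on_cycle_next[OF \<gamma> in\<gamma>] by blast
  obtain h y where h: "x1 @ e = h # y" using \<open>e \<noteq> []\<close> by (cases "x1 @ e") auto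
  have hg: "\<not> is_direct h" "\<not> is_direct g"
    using inv h x by (auto simp: Cons_eq_append_conv)
  have okd: "str_ok (d # h # y @ w)" using on_cycle_str_ok[OF d] h by (metis append_Cons append.assoc)
  have "str_ok ((x2 @ [g]) @ h # y @ w)"
    using on_cycle_str_ok[OF cb] h x by (metis append.assoc append_Cons append_Nil)
  then have okg: "str_ok (g # h # y @ w)" using str_ok_appendD(2)[of x2] by simp
  have "d \<noteq> g" using d out by blast
  \<comment> \<open>\<open>g\<close> and \<open>h\<close> are inverse, and \<open>h\<close> has at
    most one inverse continuation.\<close>
  have "is_direct d"
  proof (rule ccontr)
    assume "\<not> is_direct d"
    then obtain p q r where "d = Inv p" "g = Inv q" "h = Inv r"
      using hg by (metis syllable.disc(1) syllable.exhaust)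
    then show False using inverse_unique[of p r "y @ w" q "y @ w"] okd okg \<open>d \<noteq> g\<close> by simp
  qed
  then have m: "mixed [d, h]" using hg unfolding mixed_def by auto
  have "str_ok [d, h]" using okd str_ok_appendD(1)[of "[d, h]"] by simp
  moreover have "str_ok (h # y @ bn)"
  proof -
    have "x @ e @ bn = (x2 @ [g]) @ (h # y @ bn)" using h x by (metis append.assoc append_Cons append_Nil)
    then show ?thesis using okxe str_ok_appendD(2) by metis
  qed
  \<comment> \<open>The turn \<open>[d, h]\<close> can be taken after \<open>bn\<close> as well and
    fixes the state, so \<open>bn\<close> reaches the cycle of \<open>\<gamma>\<close> and thereby
    that of \<open>b\<close>.\<close>
  ultimately have okdb: "str_ok (d # h # y @ bn)"
    using glue_turn[of d h "y @ bn"] \<open>is_direct d\<close> hg by simp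
  have "same_ext ([d, h] @ y @ bn) [d, h]" using okdb by (intro reset[OF m]) simp
  moreover have "same_ext ([d, h] @ y @ w) [d, h]" using okd by (intro reset[OF m]) simp
  moreover have "on_cycle \<gamma> ([d, h] @ y @ w)" using d h by (metis append.assoc append_Cons append_Nil)
  ultimately have "on_cycle \<gamma> (([d, h] @ y) @ bn)"
    using on_cycle_same_ext same_ext_sym same_ext_trans by (metis append.assoc)
  then have "reach bn \<gamma>" using reachI[OF bn \<gamma> on_cycle_self[OF bn rot_refl]] by blast
  then show False using reach_trans[OF \<gamma> _ r\<gamma>b] nbn by blast
qed

text \<open>All words \<open>z2 @ wpow m b' @ z1\<close> are strings, and \<open>m = 0\<close> gives
  \<open>bn @ u @ b0\<close>. For the least \<open>m\<close> such that the word has the form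
  \<open>bn @ un @ b @ v @ b0\<close>, the factor \<open>v\<close> is the desired one. Deleting
  \<open>b\<close> gives the word for \<open>m - 1\<close>, so \<open>un @ v\<close> is
  \<open>u\<close> with \<open>m - 1\<close> copies of the band inserted; as \<open>un\<close> and
  \<open>v\<close> are band-free, \<open>m - 1\<close> is at most 1.\<close>

lemma word_factorization:
  assumes b: "bandw b" and b0: "bandw b0" and bn: "bn = [] \<or> bandw bn \<and> \<not> rot b bn"
    and r0: "reach b0 b" and nr0: "\<not> rot b0 b"
    and fn: "band_free_word un" and fu: "band_free_word u"
    and okn: "str_ok (bn @ un @ b)"
    and l: "linked (bn @ un) b b0 (bn @ u @ b0)"
  shows "\<exists>v. band_free_word v \<and> str_ok (b @ v @ b0) \<and> str_ok (un @ v @ b0) \<and>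
    (\<exists>c. on_cycle b c \<and> suffix c (b @ v @ b0) \<and> suffix c (bn @ u @ b0) \<and> suffix b0 c) \<and>
    (un @ v = u \<or> (\<exists>\<delta> p q. rot b \<delta> \<and> un @ v = p @ \<delta> @ q \<and> u = p @ q))"
proof -
  obtain z2 z1 b' m0 where z: "bn @ u @ b0 = z2 @ z1" "rot b b'" "same_ext z1 b'"
    and pre: "prefix ((bn @ un) @ b) (z2 @ wpow m0 b')" using l unfolding linked_def by blast
  note rb' = rot_band[OF b z(2)]
  have okL: "str_ok (z2 @ z1)" using l z(1) by (metis linked_def)
  have okz1: "str_ok z1" using okL str_ok_appendD(2) by blast
  have cz: "on_cycle b z1" unfolding on_cycle_def using okz1 z by blast
  have nrb: "\<not> reach b b0" using reach_antisym[OF b0 b r0] nr0 by blast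
  have sufz: "suffix z1 (bn @ u @ b0)" using z(1) by (simp add: suffix_def)
  have "suffix b0 z1"
  proof (rule ccontr)
    assume "\<not> suffix b0 z1"
    moreover have "suffix b0 (bn @ u @ b0)" by (simp add: suffix_def)
    ultimately have "suffix z1 b0" using sufz suffix_same_cases by blast
    then obtain x where "b0 = x @ z1" unfolding suffix_def by blast
    then have "reach b b0" using reachI[OF b b0 cz, of x] on_cycle_self[OF b0 rot_refl] by simp
    then show False using nrb by blast
  qed
  then obtain z1' where z1': "z1 = z1' @ b0" unfolding suffix_def by blast
  have okW: "str_ok (z2 @ wpow m b' @ z1)" for m
    using same_ext_str_ok[OF on_cycle_wpow[OF b z(2,3), of m], of z2] okL by simp
  let ?P = "\<lambda>m. \<exists>v. bn @ un @ b @ v @ b0 = z2 @ wpow m b' @ z1"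
  obtain r where r: "z2 @ wpow m0 b' = ((bn @ un) @ b) @ r" using pre unfolding prefix_def by blast
  have "z2 @ wpow m0 b' @ z1 = (z2 @ wpow m0 b') @ z1" by simp
  also have "\<dots> = bn @ un @ b @ (r @ z1') @ b0" unfolding r z1' by simp
  finally have "?P m0" by metis
  define m where "m = (LEAST m. ?P m)"
  have "?P m" unfolding m_def using \<open>?P m0\<close> by (rule LeastI)
  then obtain v where v: "bn @ un @ b @ v @ b0 = z2 @ wpow m b' @ z1" by blast
  have least: "m \<le> k" if "?P k" for k unfolding m_def using that by (rule Least_le)
  \<comment> \<open>\<open>m = 0\<close> would put a copy of \<open>b\<close> into the band-free
    word \<open>u\<close>.\<close>
  obtain j where j: "m = Suc j"
  proof (cases m)
    case 0
    then have "bn @ un @ b @ v @ b0 = bn @ u @ b0" using v z(1) by simp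
    then have "u = un @ b @ v" by (metis append.assoc append_same_eq same_append_eq)
    then show ?thesis using band_free_wordD[OF fu b rot_refl] by blast
  qed (use that in blast)
  define W where "W = bn @ un @ b @ v @ b0"
  have W': "W = z2 @ b' @ (wpow j b' @ z1)" using v by (simp add: W_def j)
  have okWW: "str_ok W" using okW[of m] v by (simp add: W_def)
  \<comment> \<open>The copy of \<open>b\<close> is deleted on the left and a copy of
    \<open>b'\<close> on the right; by \<open>deletion_unique\<close> the results agree.\<close>
  have del: "bn @ un @ v @ b0 = z2 @ wpow j b' @ z1"
    using deletion_unique[OF b rot_refl z(2) okWW, of "bn @ un" "v @ b0" z2 "wpow j b' @ z1"] W'
    by (simp add: W_def)
  have okunv: "str_ok (un @ v @ b0)" using okW[of j] del str_ok_appendD(2) by metis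
  have okbv: "str_ok (b @ v @ b0)" using okWW str_ok_appendD(2)[of "bn @ un" "b @ v @ b0"] by (simp add: W_def)
  have cbv: "on_cycle b (b @ v @ b0)" using on_cycle_rot[OF b rot_refl okbv] .
  have fv: "band_free_word v"
    unfolding band_free_word_def
  proof (intro allI impI notI)
    fix \<gamma> \<gamma>' assume \<gamma>: "bandw \<gamma>" and rg: "rot \<gamma> \<gamma>'" and "sublist \<gamma>' v"
    then obtain p q where pq: "v = p @ \<gamma>' @ q" unfolding sublist_def by blast
    have okg: "str_ok (\<gamma>' @ q @ b0)"
      using okbv str_ok_appendD(2)[of "b @ p" "\<gamma>' @ q @ b0"] pq by simp
    have cg: "on_cycle \<gamma> (\<gamma>' @ q @ b0)" using on_cycle_rot[OF \<gamma> rg okg] .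
    show False
    proof (cases "rot \<gamma> b")
      case True
      then have rbg: "rot b \<gamma>'" using rg rot_sym rot_trans by blast
      \<comment> \<open>The copy of the band can be moved to the front of \<open>v\<close>, so that
        one turn less would already have sufficed for the form required by
        \<open>?P\<close>.\<close>
      have "(b @ p) @ \<gamma>' = b @ (b @ p)"
        using reset[OF rot_band(1)[OF \<gamma> rg] okg] reset[OF band_mixed[OF b] okbv] okbv pq
        by (intro follow_cycle_to[OF b rbg _ rot_refl, of "\<gamma>' @ q @ b0"]) simp_all
      then have "p @ \<gamma>' = b @ p" by simp
      then have "v = b @ p @ q" using pq by (metis append.assoc)
      then have "?P j" using del by (metis append.assoc)
      then show False using least j by fastforce
    next
      case False
      \<comment> \<open>Either \<open>\<gamma>'\<close> is completed no earlier than
        \<open>z1\<close> and lies between two visits to the cycle of \<open>b\<close>, or it is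
        part of \<open>z1\<close> and hence of \<open>bn @ u @ b0\<close>. In the latter case it
        overlaps \<open>bn\<close>, because \<open>u\<close> is band-free.\<close>
      have "(bn @ un @ b @ p) @ (\<gamma>' @ q @ b0) = (z2 @ wpow m b') @ z1" using v pq by simp
      from iffD1[OF append_eq_append_conv2 this] obtain x where
        "bn @ un @ b @ p = (z2 @ wpow m b') @ x \<and> x @ \<gamma>' @ q @ b0 = z1 \<or>
         (bn @ un @ b @ p) @ x = z2 @ wpow m b' \<and> \<gamma>' @ q @ b0 = x @ z1" by auto
      then show False
      proof
        assume "(bn @ un @ b @ p) @ x = z2 @ wpow m b' \<and> \<gamma>' @ q @ b0 = x @ z1"
        then have "reach b \<gamma>" using reachI[OF b \<gamma> cz, of x] cg by simp
        moreover have "reach \<gamma> b" using reachI[OF \<gamma> b cg, of "b @ p"] cbv pq by simp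
        ultimately show False using reach_antisym[OF \<gamma> b] False by blast
      next
        assume x: "bn @ un @ b @ p = (z2 @ wpow m b') @ x \<and> x @ \<gamma>' @ q @ b0 = z1"
        then have "(bn @ u) @ b0 = ((z2 @ x) @ \<gamma>' @ q) @ b0" using z(1) by auto
        then have bu: "bn @ u = (z2 @ x) @ \<gamma>' @ q" by (rule iffD1[OF append_same_eq])
        from iffD1[OF append_eq_append_conv2 bu] obtain e where
          "bn = (z2 @ x) @ e \<and> e @ u = \<gamma>' @ q \<or> bn @ e = z2 @ x \<and> u = e @ \<gamma>' @ q" by auto
        then have e: "bn = z2 @ x @ e" "e @ u = \<gamma>' @ q"
          using band_free_wordD[OF fu \<gamma> rg] by auto
        have "e \<noteq> []" using e(2) band_free_wordD[OF fu \<gamma> rg, of "[]" q] by auto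
        then have bn': "bandw bn" "\<not> rot b bn" using bn e(1) by auto
        have "e @ (u @ b0) = \<gamma>' @ q @ b0" using e(2) by (metis append.assoc)
        moreover from this x have "x @ e @ u @ b0 = z1" by metis
        moreover have "reach b bn" using okn unfolding reach_def by blast
        ultimately show False
          using overlap_meets_one_cycle[OF \<gamma> b bn'(1) False bn'(2) _ e(1) \<open>e \<noteq> []\<close>, of "u @ b0"] cg cz
          by metis
      qed
    qed
  qed
  \<comment> \<open>The shorter of \<open>z1\<close> and \<open>b @ v @ b0\<close> is an initial
    part of both strings and ends on the cycle of \<open>b\<close>; it will determine both
    exits.\<close>
  have "\<exists>c. on_cycle b c \<and> suffix c (b @ v @ b0) \<and> suffix c (bn @ u @ b0) \<and> suffix b0 c"
  proof -
    have "suffix z1 W" unfolding W' by (simp add: suffix_def)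
    moreover have "suffix (b @ v @ b0) W" unfolding W_def by (simp add: suffix_def)
    ultimately have "suffix z1 (b @ v @ b0) \<or> suffix (b @ v @ b0) z1" by (rule suffix_same_cases)
    then show ?thesis
    proof
      assume "suffix z1 (b @ v @ b0)"
      then show ?thesis using cz sufz \<open>suffix b0 z1\<close> by blast
    next
      assume s: "suffix (b @ v @ b0) z1"
      then have "suffix (b @ v @ b0) (bn @ u @ b0)" using sufz suffix_order.order_trans by blast
      moreover have "suffix b0 (b @ v @ b0)" by (simp add: suffix_def)
      ultimately show ?thesis using cbv by blast
    qed
  qed
  moreover have "un @ v = u \<or> (\<exists>\<delta> p q. rot b \<delta> \<and> un @ v = p @ \<delta> @ q \<and> u = p @ q)"
  proof (cases "j = 0")
    case True
    then have "(bn @ un @ v) @ b0 = (bn @ u) @ b0" using del z(1) by simp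
    then show ?thesis by simp
  next
    case False
    have "\<exists>\<delta> p q. rot b \<delta> \<and> un @ v = p @ wpow j \<delta> @ q \<and> u = p @ q"
    proof -
      from iffD1[OF append_eq_append_conv2 z(1)] obtain e where
        "bn = z2 @ e \<and> e @ u @ b0 = z1 \<or> bn @ e = z2 \<and> u @ b0 = e @ z1" by auto
      then show ?thesis
      proof
        assume e: "bn @ e = z2 \<and> u @ b0 = e @ z1"
        have "(bn @ un @ v) @ b0 = (bn @ e @ wpow j b' @ z1') @ b0" using del e z1' by auto
        then have "un @ v = e @ wpow j b' @ z1'" by simp
        moreover have "u @ b0 = (e @ z1') @ b0" using e z1' by simp
        then have "u = e @ z1'" by (rule iffD1[OF append_same_eq])
        ultimately show ?thesis using z(2) by blast
      next
        assume e: "bn = z2 @ e \<and> e @ u @ b0 = z1"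
        then have "(z2 @ e @ un @ v) @ b0 = (z2 @ wpow j b' @ e @ u) @ b0" using del by auto
        then have eq: "e @ un @ v = wpow j b' @ e @ u" by simp
        \<comment> \<open>An insertion point inside \<open>bn\<close> is moved back to the point
          where \<open>u\<close> has just been read: the part \<open>e\<close> of \<open>bn\<close>
          is not mixed and therefore begins \<open>b'\<close>, so inserting
          \<open>b' = e @ s\<close> after \<open>e\<close> amounts to inserting the rotation
          \<open>s @ e\<close> before it.\<close>
        have "\<exists>s. b' = e @ s"
        proof (cases "e = []")
          case ne: False
          then have bn': "bandw bn" "\<not> rot b bn" using bn e by auto
          have "\<not> mixed e"
          proof
            assume m: "mixed e"
            have "str_ok (e @ bn)" using band_wpow[OF bn'(1), of 2] str_ok_appendD(2)[of z2 "e @ bn"] e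
              by (simp add: numeral_2_eq_2)
            then have s: "same_ext (e @ bn) e" by (rule reset[OF m])
            have "same_ext z1 e" using reset[OF m, of "u @ b0"] e okz1 by simp
            with s have "on_cycle b (e @ bn)"
              using cz on_cycle_same_ext same_ext_sym same_ext_trans by blast
            then have "reach bn b" using reachI[OF bn'(1) b on_cycle_self[OF bn'(1) rot_refl]] by blast
            moreover have "reach b bn" using okn unfolding reach_def by blast
            ultimately show False using reach_antisym[OF b bn'(1)] bn'(2) by blast
          qed
          obtain i where "j = Suc i" using False by (cases j) auto
          then have "e @ un @ v = b' @ wpow i b' @ e @ u" using eq by simp
          from iffD1[OF append_eq_append_conv2 this] obtain t where
            "e = b' @ t \<or> e @ t = b'" by auto
          moreover have "e \<noteq> b' @ t" using \<open>\<not> mixed e\<close> rb'(1) mixed_append[of b' "[]" t] by auto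
          ultimately show ?thesis by auto
        qed simp
        then obtain s where s: "b' = e @ s" by blast
        have "e @ (s @ e) = b' @ e" using s by simp
        then have "e @ wpow j (s @ e) = wpow j b' @ e" by (rule wpow_conj)
        then have "e @ (un @ v) = e @ (wpow j (s @ e) @ u)" using eq by (metis append.assoc)
        then have "un @ v = [] @ wpow j (s @ e) @ u" by simp
        moreover have "rot b' (s @ e)" unfolding rot_def using s by blast
        then have "rot b (s @ e)" using z(2) rot_trans by blast
        ultimately show ?thesis by (metis append_Nil)
      qed
    qed
    then obtain \<delta> p q where d: "rot b \<delta>" "un @ v = p @ wpow j \<delta> @ q" "u = p @ q" by blast
    \<comment> \<open>Two consecutive copies inside \<open>un @ v\<close> would leave a complete one
      in \<open>un\<close> or in \<open>v\<close>.\<close>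
    have "j = 1"
    proof (rule ccontr)
      assume "j \<noteq> 1"
      then obtain i where "j = Suc (Suc i)" using False by (cases j rule: nat.exhaust; metis nat.exhaust One_nat_def)
      then have "un @ v = (p @ \<delta>) @ (\<delta> @ wpow i \<delta> @ q)" using d(2) by simp
      from iffD1[OF append_eq_append_conv2 this] obtain t where
        "un = (p @ \<delta>) @ t \<or> v = t @ \<delta> @ wpow i \<delta> @ q" by auto
      then show False using band_free_wordD[OF fn b d(1)] band_free_wordD[OF fv b d(1)] by auto
    qed
    then show ?thesis using d by auto
  qed
  ultimately show ?thesis using fv okbv okunv by blast
qed

text \<open>The word \<open>c\<close> ends on the cycle of \<open>b\<close>, from which
  \<open>b0\<close> cannot be reached, so \<open>c\<close> is not a factor of a power of
  \<open>b0\<close> and the exit lies within \<open>c\<close>. The value depends on \<open>c\<close>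
  and \<open>b0\<close> only and hence is shared by all arrows whose strings begin by reading
  \<open>c\<close>.\<close>

lemma exit_syl_eq:
  assumes b: "bandw b" and b0: "bandw b0" and r0: "reach b0 b" and nr: "\<not> rot b0 b"
    and c: "on_cycle b c" "suffix b0 c" "suffix c w"
    and src: "source u = Syl b0" and w: "prd \<Lambda> [target u, str u, source u] = Some (Syl w)"
  defines "Q \<equiv> \<lambda>w. \<not> (\<exists>m z. prd \<Lambda> (replicate m (Syl b0)) = Some z \<and> substring \<Lambda> (Syl w) z)"
  shows "exit_syl \<Lambda> u = c ! (length c - length b0 -
    (LEAST k. 1 \<le> k \<and> k \<le> length c - length b0 \<and> Q (drop (length c - length b0 - k) c)))"
proof -
  obtain x where x: "w = x @ c" using c(3) unfolding suffix_def by blast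
  obtain y where y: "c = y @ b0" using c(2) unfolding suffix_def by blast
  define nc where "nc = length c - length b0"
  define n where "n = length w - length b0"
  have n: "n = length x + nc" unfolding n_def nc_def x y by simp
  have "Q c"
    unfolding Q_def
  proof
    assume "\<exists>m z. prd \<Lambda> (replicate m (Syl b0)) = Some z \<and> substring \<Lambda> (Syl c) z"
    then obtain m z y2 y1 where z: "prd \<Lambda> (replicate m (Syl b0)) = Some z" "prd \<Lambda> [y2, Syl c, y1] = Some z"
      unfolding substring_def by blast
    have "syls z = wpow m b0" using prd_props[OF z(1)] by (simp add: map_replicate del: start_pt.simps end_pt.simps)
    moreover obtain p q where "syls z = p @ c @ q" using prd3_syls[OF z(2)] by auto
    ultimately have pq: "wpow m b0 = p @ c @ q" by simp
    have ok: "str_ok (b0 @ wpow m b0)" using band_wpow[OF b0, of "Suc m"] by simp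
    have eq: "b0 @ wpow m b0 = p @ c @ q @ b0" using wpow_commute[of m b0] pq by simp
    have "mixed c" using band_mixed[OF b0] mixed_append[of b0 y "[]"] y by simp
    then have "same_ext (c @ q @ b0) c" using ok eq str_ok_appendD(2)[of p] by (intro reset) auto
    then have "on_cycle b (c @ q @ b0)" using c(1) on_cycle_same_ext by blast
    moreover have "on_cycle b0 (p @ c @ q @ b0)" using on_cycle_rot[OF b0 rot_refl ok] eq by simp
    ultimately have "reach b b0" using reachI[OF b b0] by blast
    then show False using reach_antisym[OF b0 b r0] nr by blast
  qed
  have "y \<noteq> []"
  proof
    assume "y = []"
    then show False using on_cycle_disjoint[OF b0 b on_cycle_self[OF b0 rot_refl]] c(1) y nr by simp
  qed
  then have nc1: "1 \<le> nc" unfolding nc_def y by (cases y) auto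
  define R where "R k \<longleftrightarrow> 1 \<le> k \<and> k \<le> nc \<and> Q (drop (nc - k) c)" for k
  define k where "k = (LEAST k. R k)"
  have "R nc" unfolding R_def using nc1 \<open>Q c\<close> by simp
  then have "R k" unfolding k_def by (rule LeastI)
  have d: "drop (n - i) w = drop (nc - i) c" if "i \<le> nc" for i
    using that unfolding n x by simp
  have "(LEAST k. 1 \<le> k \<and> k \<le> n \<and> Q (drop (n - k) w)) = k"
  proof (rule Least_equality)
    show "1 \<le> k \<and> k \<le> n \<and> Q (drop (n - k) w)" using \<open>R k\<close> d[of k] n unfolding R_def by simp
    fix i assume i: "1 \<le> i \<and> i \<le> n \<and> Q (drop (n - i) w)"
    show "k \<le> i"
    proof (cases "i \<le> nc")
      case True
      then have "R i" using i d unfolding R_def by simp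
      then show ?thesis unfolding k_def by (rule Least_le)
    qed (use \<open>R k\<close> in \<open>simp add: R_def\<close>)
  qed
  then have "exit_syl \<Lambda> u = w ! (n - k)"
    unfolding exit_syl_def w by (simp add: src n_def Q_def Let_def)
  also have "n - k = length x + (nc - k)" using \<open>R k\<close> unfolding R_def n by simp
  also have "w ! (length x + (nc - k)) = c ! (nc - k)" unfolding x by (rule nth_append_length_plus)
  finally show ?thesis unfolding k_def R_def nc_def .
qed

section \<open>Translation between words and arrows\<close>

lemma qword_after:
  assumes "str_ok (w @ a)" and "a \<noteq> []"
  shows "is_string \<Lambda> (qword_of (end_pt \<Lambda> (Syl a)) w)"
    and "start_pt \<Lambda> (qword_of (end_pt \<Lambda> (Syl a)) w) = end_pt \<Lambda> (Syl a)"
proof -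
  have "is_string \<Lambda> (Syl a)" using assms str_ok_appendD(2) by simp
  from point_strings(1)[OF this] have p: "is_string \<Lambda> (Triv (fst (end_pt \<Lambda> (Syl a))) (snd (end_pt \<Lambda> (Syl a))))"
    by simp
  have w: "str_ok w" using assms(1) str_ok_appendD(1) by blast
  show "is_string \<Lambda> (qword_of (end_pt \<Lambda> (Syl a)) w)" using qword_of_points(1)[OF p w] .
  show "start_pt \<Lambda> (qword_of (end_pt \<Lambda> (Syl a)) w) = end_pt \<Lambda> (Syl a)"
    using qword_of_points[OF p w] end_start_pt[OF assms(1,2)] by metis
qed

lemma arrow_prdD:
  assumes "prd \<Lambda> [t, x, s] = Some z"
  shows "is_string \<Lambda> t \<and> is_string \<Lambda> x \<and> is_string \<Lambda> s \<and> end_pt \<Lambda> s = start_pt \<Lambda> x \<and>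
    end_pt \<Lambda> x = start_pt \<Lambda> t \<and> str_ok (syls t @ syls x @ syls s) \<and> syls z = syls t @ syls x @ syls s"
proof -
  obtain y where y: "prd \<Lambda> [x, s] = Some y" "prd \<Lambda> [t, y] = Some z" using prd_ConsD[OF assms] by blast
  from prd2_iff[of x s y] prd2_iff[of t y z] y prd2_syls[OF y(1)] prd2_syls[OF y(2)] is_string_str_ok
  show ?thesis by (metis append.assoc)
qed

lemma arrow_prdI:
  assumes "is_string \<Lambda> t" and "is_string \<Lambda> x" and "is_string \<Lambda> (Syl s)"
    and "end_pt \<Lambda> (Syl s) = start_pt \<Lambda> x" and "end_pt \<Lambda> x = start_pt \<Lambda> t"
    and "str_ok (syls t @ syls x @ s)"
  shows "prd \<Lambda> [t, x, Syl s] = Some (Syl (syls t @ syls x @ s))"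
proof (rule prd_ConsI)
  have s: "s \<noteq> []" using assms(3) by simp
  have ok: "str_ok (syls x @ s)" using assms(6) str_ok_appendD(2) by blast
  show 1: "prd \<Lambda> [x, Syl s] = Some (Syl (syls x @ s))"
    using assms s ok by (intro prd2I) simp_all
  show "prd \<Lambda> [t, Syl (syls x @ s)] = Some (Syl (syls t @ syls x @ s))"
    using assms s ok prd2_syls[OF 1] by (intro prd2I) simp_all
qed

text \<open>Bands are mixed, so consecutive arrows of a path can be glued along the band between
  them.\<close>

lemma arrow_extend:
  assumes b: "bandw b" and a: "prd \<Lambda> [t, x, Syl b] \<noteq> None"
    and zs: "prd \<Lambda> (z # zs) = Some (Syl (b @ w))"
  shows "prd \<Lambda> (t # x # z # zs) = Some (Syl (syls t @ syls x @ b @ w))"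
proof -
  obtain y where y: "prd \<Lambda> [t, x, Syl b] = Some y" using a by blast
  note f = arrow_prdD[OF y]
  have ok: "str_ok (b @ w)" using prd_props[OF zs] is_string_Syl by blast
  have "str_ok ((syls t @ syls x) @ b @ w)"
    using f ok glue[OF band_mixed[OF b], of "syls t @ syls x" w] by simp
  then have "prd \<Lambda> [t, x, Syl (b @ w)] = Some (Syl (syls t @ syls x @ b @ w))"
    using f ok band_nonempty[OF b] by (intro arrow_prdI) simp_all
  then obtain v where "prd \<Lambda> [x, Syl (b @ w)] = Some v" "prd \<Lambda> [t, v] = Some (Syl (syls t @ syls x @ b @ w))"
    using prd_ConsD by blast
  then show ?thesis using prd_ConsI[OF zs] prd_ConsI by blast
qed

lemma band_free_iff: "is_string \<Lambda> x \<Longrightarrow> band_free \<Lambda> x \<longleftrightarrow> band_free_word (syls x)"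
proof
  assume x: "is_string \<Lambda> x" and "band_free \<Lambda> x"
  show "band_free_word (syls x)"
    unfolding band_free_word_def
  proof (intro allI impI notI)
    fix \<gamma> \<gamma>' assume \<gamma>: "bandw \<gamma>" "rot \<gamma> \<gamma>'" "sublist \<gamma>' (syls x)"
    then obtain p q where "syls x = p @ \<gamma>' @ q" unfolding sublist_def by blast
    from factor_prd(1)[OF x this rot_band(3)[OF \<gamma>(1,2)]] have "substring \<Lambda> (Syl \<gamma>') x"
      unfolding substring_def by blast
    then show False using \<open>band_free \<Lambda> x\<close> \<gamma>(1,2) cyclic_perm_Syl unfolding band_free_def by blast
  qed
next
  assume "is_string \<Lambda> x" and f: "band_free_word (syls x)"
  show "band_free \<Lambda> x"
    unfolding band_free_def
  proof
    assume "\<exists>b b'. band \<Lambda> b \<and> cyclic_perm b b' \<and> substring \<Lambda> b' x"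
    then obtain b b' y2 y1 where b: "band \<Lambda> b" "cyclic_perm b b'" "prd \<Lambda> [y2, b', y1] = Some x"
      unfolding substring_def by blast
    obtain \<gamma> where \<gamma>: "b = Syl \<gamma>" using b(2) unfolding cyclic_perm_def by blast
    then obtain \<gamma>' where "b' = Syl \<gamma>'" "rot \<gamma> \<gamma>'" using b(2) unfolding \<gamma> cyclic_perm_Syl by blast
    moreover have "syls x = syls y2 @ syls b' @ syls y1" using prd3_syls[OF b(3)] by blast
    ultimately show False using band_free_wordD[OF f, of \<gamma> \<gamma>' "syls y2" "syls y1"] b(1) \<gamma> by simp
  qed
qed

lemma band_mult_one:
  assumes "is_string \<Lambda> y" and "syls y = p @ \<delta> @ q" and "rot b \<delta>" and "\<delta> \<noteq> []"
    and sq: "\<And>\<delta>' s t. rot b \<delta>' \<Longrightarrow> syls y \<noteq> s @ \<delta>' @ \<delta>' @ t"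
  shows "band_mult \<Lambda> (Syl b) y = 1"
  unfolding band_mult_def
proof (rule Greatest_equality)
  have "cyclic_perm (Syl b) (Syl \<delta>)" using assms(3) cyclic_perm_Syl by blast
  with factor_prd(1)[OF assms(1,2,4)]
  show "\<exists>y2 b' y1. cyclic_perm (Syl b) b' \<and> prd \<Lambda> (y2 # replicate 1 b' @ [y1]) = Some y"
    by (metis One_nat_def append_Cons append_Nil replicate_0 replicate_Suc)
  fix n assume "\<exists>y2 b' y1. cyclic_perm (Syl b) b' \<and> prd \<Lambda> (y2 # replicate n b' @ [y1]) = Some y"
  then obtain y2 b' y1 where "rot b b'" and n: "prd \<Lambda> (y2 # replicate n (Syl b') @ [y1]) = Some y"
    unfolding cyclic_perm_Syl by blast
  from prd_props[OF n] have w: "syls y = syls y2 @ wpow n b' @ syls y1"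
    by (simp add: map_replicate del: prd.simps start_pt.simps end_pt.simps)
  show "n \<le> 1"
  proof (rule ccontr)
    assume "\<not> n \<le> 1"
    then obtain i where "n = Suc (Suc i)" by (metis One_nat_def le_SucI le_refl not0_implies_Suc zero_le)
    then show False using w sq[OF \<open>rot b b'\<close>, of "syls y2" "wpow i b' @ syls y1"] by simp
  qed
qed

end

section \<open>Weak bridges and paths\<close>

locale bridge_alg = domestic_alg K \<Lambda>
  for K :: "'k ring" and \<Lambda> :: "('v, 'a) bound_quiver" +
  fixes B :: "('v, 'a) qword set"
  assumes reps: "band_representatives \<Lambda> B"
begin

lemma reps_band: "c \<in> B \<Longrightarrow> \<exists>b. c = Syl b \<and> bandw b"
  using reps unfolding band_representatives_def band_def by (cases c) auto

lemma reps_unique: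
  assumes "Syl b \<in> B" and "Syl c \<in> B" and "rot b c"
  shows "b = c"
proof -
  have "band \<Lambda> (Syl b)" using reps assms(1) unfolding band_representatives_def by auto
  then have "\<exists>!b0. b0 \<in> B \<and> cyclic_perm (Syl b) b0"
    using reps unfolding band_representatives_def by blast
  then show ?thesis using assms rot_refl unfolding cyclic_perm_Syl by blast
qed

text \<open>The two ends lie on different cycles: a string \<open>b @ w @ b\<close> makes
  \<open>b @ w\<close> a loop at \<open>b\<close>, hence a power of \<open>b\<close>; being
  band-free, \<open>w\<close> is then empty, which is the excluded trivial case.\<close>

lemma weak_bridgeD:
  assumes "weak_bridge \<Lambda> B u"
  obtains b c z where "source u = Syl b" and "target u = Syl c" and "bandw b" and "bandw c"
    and "\<not> rot b c" and "reach b c" and "is_string \<Lambda> (str u)" and "band_free_word (syls (str u))"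
    and "prd \<Lambda> [Syl c, str u, Syl b] = Some z"
proof -
  obtain b c where bc: "source u = Syl b" "target u = Syl c" "bandw b" "bandw c" "Syl b \<in> B" "Syl c \<in> B"
    using assms reps_band unfolding weak_bridge_def by metis
  obtain z where z: "prd \<Lambda> [Syl c, str u, Syl b] = Some z"
    using assms bc unfolding weak_bridge_def by auto
  have s: "is_string \<Lambda> (str u)" "band_free_word (syls (str u))"
    using assms band_free_iff unfolding weak_bridge_def by blast+
  note f = arrow_prdD[OF z]
  have r: "reach b c" unfolding reach_def using f by auto
  have "\<not> rot b c"
  proof
    assume "rot b c"
    then have c: "c = b" using reps_unique bc(5,6) by blast
    define w where "w = syls (str u)"
    have "str_ok (b @ w @ b)" using f c by (simp add: w_def)
    from reset[OF band_mixed[OF bc(3)] this] have "same_ext ((b @ w) @ b) b" by simp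
    moreover have "same_ext (b @ b) b" using cycle_loop[OF bc(3) rot_refl] by simp
    ultimately have "(b @ w) @ b = b @ (b @ w)"
      using loops_commute rot_band(5)[OF bc(3) rot_refl] by blast
    then obtain n where n: "b @ w = wpow n b" using commute_primitive[OF band_primitive[OF bc(3)]] by blast
    have "w = []"
    proof (cases n)
      case 0
      with n show ?thesis by simp
    next
      case (Suc m)
      then have w: "w = wpow m b" using n by simp
      show ?thesis
      proof (cases m)
        case (Suc k)
        then have "w = [] @ b @ wpow k b" using w by simp
        then show ?thesis using band_free_wordD[OF s(2) bc(3) rot_refl] unfolding w_def by blast
      qed (use w in simp)
    qed
    then obtain v i where "str u = Triv v i" using s(1) by (cases "str u") (auto simp: w_def)
    then have "str u = triv_at \<Lambda> (source u)" using f bc(1) unfolding triv_at_def by simp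
    then show False using assms bc(1,2) c unfolding weak_bridge_def by simp
  qed
  with that bc s z r show ?thesis by blast
qed

text \<open>Base points are restored to the words of \<open>word_factorization\<close>. Its two
  alternatives for \<open>un @ v\<close> match the two clauses of \<open>compose_arrow\<close>, the
  plain product and the reduced one.\<close>

lemma factorization:
  assumes un: "weak_bridge \<Lambda> B un \<or> weak_rhb \<Lambda> B un \<and> str un \<noteq> triv_at \<Lambda> (source un)"
    and u: "if weak_bridge \<Lambda> B un then weak_bridge \<Lambda> B u else weak_rhb \<Lambda> B u"
    and ends: "source u = Syl b0" "source un = Syl b" "target un = target u"
    and nr: "\<not> rot b0 b" and r: "reach b0 b"
    and l: "linked (syls (target u) @ syls (str un)) b b0 (syls (target u) @ syls (str u) @ b0)"
  shows "\<exists>u1. nontrivial_factorization \<Lambda> B u un u1 \<and> exit_syl \<Lambda> u = exit_syl \<Lambda> u1"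
proof -
  define t where "t = target u"
  define bn where "bn = syls t"
  have "Syl b \<in> B" "Syl b0 \<in> B" using un u ends unfolding weak_bridge_def weak_rhb_def
    by (metis (full_types))+
  then have b: "bandw b" and b0: "bandw b0" using reps unfolding band_representatives_def by auto
  obtain zn where zn: "prd \<Lambda> [t, str un, Syl b] = Some zn"
    using un ends unfolding weak_bridge_def weak_rhb_def t_def by auto
  obtain zu where zu: "prd \<Lambda> [t, str u, Syl b0] = Some zu"
    using u ends unfolding weak_bridge_def weak_rhb_def t_def by (metis (full_types) not_None_eq)
  note fn = arrow_prdD[OF zn] and fu = arrow_prdD[OF zu]
  have free: "band_free_word (syls (str un))" "band_free_word (syls (str u))"
    using un u fn fu band_free_iff unfolding weak_bridge_def weak_rhb_def by (metis (full_types))+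
  have bn: "bn = [] \<or> bandw bn \<and> \<not> rot b bn"
  proof (cases "weak_bridge \<Lambda> B un")
    case True
    then obtain b1 c where "source un = Syl b1" "target un = Syl c" "bandw c" "\<not> rot b1 c"
      by (rule weak_bridgeD)
    then show ?thesis using ends by (simp add: bn_def t_def)
  next
    case False
    then obtain v i where "target un = Triv v i" using un unfolding weak_rhb_def by blast
    then show ?thesis using ends by (simp add: bn_def t_def)
  qed
  have "str_ok (bn @ syls (str un) @ b)" using fn by (simp add: bn_def)
  from word_factorization[OF b b0 bn r nr free this l[folded t_def, folded bn_def]]
  obtain v c where v: "band_free_word v" "str_ok (b @ v @ b0)" "str_ok (syls (str un) @ v @ b0)"
    and c: "on_cycle b c" "suffix c (b @ v @ b0)" "suffix c (bn @ syls (str u) @ b0)" "suffix b0 c"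
    and split: "syls (str un) @ v = syls (str u) \<or>
      (\<exists>\<delta> p q. rot b \<delta> \<and> syls (str un) @ v = p @ \<delta> @ q \<and> syls (str u) = p @ q)"
    by blast
  have ne: "b \<noteq> []" "b0 \<noteq> []" using b b0 band_nonempty by blast+
  have okv: "str_ok (v @ b0)" using v(2) str_ok_appendD(2) by blast
  define V where "V = qword_of (end_pt \<Lambda> (Syl b0)) v"
  define y where "y = qword_of (end_pt \<Lambda> (Syl b0)) (syls (str un) @ v)"
  have V: "is_string \<Lambda> V" "start_pt \<Lambda> V = end_pt \<Lambda> (Syl b0)" "syls V = v"
    using qword_after[OF okv ne(2)] by (simp_all add: V_def del: start_pt.simps end_pt.simps)
  have y: "is_string \<Lambda> y" "start_pt \<Lambda> y = end_pt \<Lambda> (Syl b0)" "syls y = syls (str un) @ v"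
    using qword_after[of "syls (str un) @ v" b0] v(3) ne(2)
    by (simp_all add: y_def del: start_pt.simps end_pt.simps)
  have eV: "end_pt \<Lambda> V = start_pt \<Lambda> (Syl b)"
  proof (cases "v = []")
    case True
    then have "end_pt \<Lambda> V = end_pt \<Lambda> (Syl b0)" by (simp add: V_def qword_of_def)
    also have "\<dots> = start_pt \<Lambda> (Syl b)" using end_start_pt[of b b0] v(2) ne True by simp
    finally show ?thesis .
  next
    case False
    then have "end_pt \<Lambda> V = end_pt \<Lambda> (Syl (v @ b0))" by (simp add: V_def qword_of_def)
    also have "\<dots> = start_pt \<Lambda> (Syl b)" using end_start_pt[of b "v @ b0"] v(2) ne by blast
    finally show ?thesis .
  qed
  define u1 where "u1 = Arrow (Syl b0) V (Syl b)"
  have "is_string \<Lambda> (Syl b)" "is_string \<Lambda> (Syl b0)" using rot_band(5)[OF b rot_refl] rot_band(5)[OF b0 rot_refl] ne by simp_all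
  then have prd1: "prd \<Lambda> [Syl b, V, Syl b0] = Some (Syl (b @ v @ b0))"
    using arrow_prdI[of "Syl b" V b0] V eV v(2) by (simp del: prd.simps start_pt.simps end_pt.simps)
  have "b0 \<noteq> b" using nr by auto
  then have wb1: "weak_bridge \<Lambda> B u1"
    unfolding weak_bridge_def u1_def
    using \<open>Syl b \<in> B\<close> \<open>Syl b0 \<in> B\<close> V v(1) prd1 band_free_iff by (simp del: prd.simps)
  have py: "prd \<Lambda> [str un, V] = Some y"
    using V y fn eV band_start_end[OF b rot_refl]
    by (intro prd2I) (simp_all del: start_pt.simps end_pt.simps)
  have eu: "end_pt \<Lambda> y = end_pt \<Lambda> (str u)"
    using prd2_syls[OF py] fn fu by (simp del: start_pt.simps end_pt.simps)
  \<comment> \<open>A weak bridge ends in a band and a weak reverse half bridge in a trivial string,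
    so \<open>un\<close> cannot be both.\<close>
  have triv: "\<not> (weak_rhb \<Lambda> B un \<and> str un = triv_at \<Lambda> (source un))"
  proof
    assume "weak_rhb \<Lambda> B un \<and> str un = triv_at \<Lambda> (source un)"
    then have "weak_rhb \<Lambda> B un" "weak_bridge \<Lambda> B un" using un by blast+
    then show False using reps_band unfolding weak_rhb_def weak_bridge_def by fastforce
  qed
  have u': "u = Arrow (Syl b0) (str u) (target un)" using ends by (cases u) simp
  have comp: "compose_arrow \<Lambda> B un u1 = Some u"
  proof (cases "syls (str un) @ v = syls (str u)")
    case True
    have "y = str u" using y fu True by (intro string_eqI) simp_all
    then show ?thesis
      unfolding compose_arrow_def using wb1 un u py u' ends
      by (auto simp: u1_def Let_def simp del: prd.simps)
  next
    case False
    then obtain \<delta> p q where d: "rot b \<delta>" "syls (str un) @ v = p @ \<delta> @ q" "syls (str u) = p @ q"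
      using split by blast
    note rd = rot_band[OF b d(1)]
    \<comment> \<open>\<open>compose_arrow\<close> prefers the plain product; it is rejected here
      because it contains the band \<open>\<delta>\<close>.\<close>
    have nfree: "\<not> band_free \<Lambda> y"
      using band_free_iff[OF y(1)] band_free_wordD[OF _ b d(1), of "syls y" p q] y(3) d(2) by auto
    have br: "band_reduction \<Lambda> (Syl b) y (str u)"
      using y d fu eu band_start_end[OF b d(1)] rd(3)
      by (intro band_reductionI[of b \<delta> y p q]) (simp_all del: start_pt.simps end_pt.simps)
    have red: "red \<Lambda> (Syl b) y = str u" using red_eq[OF b br] .
    have mult: "band_mult \<Lambda> (Syl b) y = 1"
    proof (rule band_mult_one[OF y(1) _ d(1) rd(3)])
      show "syls y = p @ \<delta> @ q" using y(3) d(2) by simp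
      fix \<delta>' s t assume r': "rot b \<delta>'"
      show "syls y \<noteq> s @ \<delta>' @ \<delta>' @ t"
      proof
        assume "syls y = s @ \<delta>' @ \<delta>' @ t"
        then have "syls (str un) @ v = (s @ \<delta>') @ (\<delta>' @ t)" using y(3) by simp
        from iffD1[OF append_eq_append_conv2 this] obtain x where
          "syls (str un) = (s @ \<delta>') @ x \<or> v = x @ \<delta>' @ t" by auto
        then show False using band_free_wordD[OF free(1) b r'] band_free_wordD[OF v(1) b r'] by auto
      qed
    qed
    have "\<not> weak_bridge \<Lambda> B (Arrow s y t)" "\<not> weak_rhb \<Lambda> B (Arrow s y t)" for s t
      using nfree unfolding weak_bridge_def weak_rhb_def by simp_all
    moreover have "\<exists>z. band_reduction \<Lambda> (Syl b) y z" using br by blast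
    ultimately show ?thesis
      unfolding compose_arrow_def using wb1 un u py u' ends red mult
      by (auto simp: u1_def Let_def simp del: prd.simps)
  qed
  have "zu = Syl (bn @ syls (str u) @ b0)" using fu ne unfolding bn_def by (intro Syl_eqI) simp_all
  then have "exit_syl \<Lambda> u = exit_syl \<Lambda> u1"
    using exit_syl_eq[OF b b0 r nr c(1,4,3) ends(1)] exit_syl_eq[OF b b0 r nr c(1,4,2), of u1] zu prd1 ends
    by (simp add: u1_def t_def del: prd.simps)
  with comp wb1 triv show ?thesis unfolding nontrivial_factorization_def by blast
qed

section \<open>Strings of paths and their reductions\<close>

lemma path_prd:
  assumes "Q \<noteq> []" and "successively (\<lambda>u u'. target u = source u') Q"
    and "\<forall>u \<in> set Q. weak_bridge \<Lambda> B u"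
  shows "\<exists>w. prd \<Lambda> (concat (map (\<lambda>u. [target u, str u]) (rev Q)) @ [source (hd Q)]) =
      Some (Syl (syls (target (last Q)) @ w)) \<and> suffix (syls (source (hd Q))) w"
  using assms
proof (induction Q rule: rev_induct)
  case (snoc u Q)
  from snoc.prems(3) have "weak_bridge \<Lambda> B u" by simp
  then obtain b c z where u: "source u = Syl b" "target u = Syl c" "bandw b" "bandw c"
    "prd \<Lambda> [Syl c, str u, Syl b] = Some z"
    by (rule weak_bridgeD)
  show ?case
  proof (cases "Q = []")
    case True
    have "z = Syl (c @ syls (str u) @ b)"
      using arrow_prdD[OF u(5)] band_nonempty[OF u(3)] by (intro Syl_eqI) simp_all
    with True u show ?thesis by (auto simp: suffix_def simp del: prd.simps)
  next
    case False
    with snoc obtain w where w: "prd \<Lambda> (concat (map (\<lambda>u. [target u, str u]) (rev Q)) @ [source (hd Q)]) =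
      Some (Syl (syls (target (last Q)) @ w))" "suffix (syls (source (hd Q))) w"
      by (auto simp: successively_append_iff)
    have "target (last Q) = Syl b" using snoc.prems(2) False u(1) by (auto simp: successively_append_iff)
    moreover obtain x xs where x: "concat (map (\<lambda>u. [target u, str u]) (rev Q)) @ [source (hd Q)] = x # xs"
      using False by (cases "concat (map (\<lambda>u. [target u, str u]) (rev Q)) @ [source (hd Q)]") auto
    ultimately have "prd \<Lambda> (Syl c # str u # x # xs) = Some (Syl (c @ syls (str u) @ b @ w))"
      using arrow_extend[OF u(3), of "Syl c" "str u" x xs w] u(5) w(1) by simp
    then have "prd \<Lambda> (concat (map (\<lambda>u. [target u, str u]) (rev (Q @ [u]))) @ [source (hd (Q @ [u]))]) =
        Some (Syl (syls (target (last (Q @ [u]))) @ (syls (str u) @ b @ w)))"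
      using u(2) x False by (simp del: prd.simps)
    moreover have "suffix (syls (source (hd (Q @ [u])))) (syls (str u) @ b @ w)"
      using w(2) False by (simp add: suffix_appendI)
    ultimately show ?thesis by blast
  qed
qed simp

text \<open>Reachability is transitive along the path and, being antisymmetric up to rotation,
  excludes a return to the cycle of the source. So the H-reductions concern only cycles strictly
  after that of the source, all of which reach the end of the path.\<close>

lemma path_reach:
  assumes "Q \<noteq> []" and "successively (\<lambda>u u'. target u = source u') Q"
    and "\<forall>u \<in> set Q. weak_bridge \<Lambda> B u" and "v \<in> set Q"
  shows "\<exists>c. target v = Syl c \<and> bandw c \<and> reach (syls (source (hd Q))) c \<and>
    \<not> rot (syls (source (hd Q))) c \<and> reach c (syls (target (last Q)))"
  using assms
proof (induction Q arbitrary: v)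
  case (Cons u Q)
  from Cons.prems(3) have "weak_bridge \<Lambda> B u" by simp
  then obtain b c where u: "source u = Syl b" "target u = Syl c" "bandw b" "bandw c"
    "\<not> rot b c" "reach b c"
    by (rule weak_bridgeD)
  show ?case
  proof (cases "Q = []")
    case True
    with Cons.prems(4) u reach_refl[OF u(4)] show ?thesis by simp
  next
    case False
    have src: "source (hd Q) = Syl c" using Cons.prems(2) False u(2) by (auto simp: successively_Cons)
    have suc: "successively (\<lambda>u u'. target u = source u') Q"
      using Cons.prems(2) False by (auto simp: successively_Cons)
    have IH: "\<exists>d. target v = Syl d \<and> bandw d \<and> reach c d \<and> \<not> rot c d \<and> reach d (syls (target (last Q)))"
      if "v \<in> set Q" for v
      using Cons.IH[OF False suc _ that] Cons.prems(3) src by simp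
    show ?thesis
    proof (cases "v \<in> set Q")
      case True
      then obtain d where d: "target v = Syl d" "bandw d" "reach c d" "reach d (syls (target (last Q)))"
        using IH by blast
      have "\<not> rot b d"
      proof
        assume "rot b d"
        have "on_cycle b d" using on_cycle_self[OF u(3) \<open>rot b d\<close>] .
        moreover obtain x where "str_ok (d @ x @ c)" using d(3) unfolding reach_def by blast
        then have "on_cycle b ((d @ x) @ c)" using on_cycle_rot[OF u(3) \<open>rot b d\<close>] by simp
        then have "reach c b" using reachI[OF u(4,3) on_cycle_self[OF u(4) rot_refl]] by blast
        then show False using reach_antisym[OF u(3,4,6)] u(5) by blast
      qed
      moreover have "reach b d" using reach_trans[OF u(4) u(6) d(3)] .
      ultimately show ?thesis using d False u(1) by simp
    next
      case v: False
      then have "v = u" using Cons.prems(4) by simp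
      obtain d where d: "target (last Q) = Syl d" "reach c d" using IH[of "last Q"] False by auto
      then show ?thesis using u \<open>v = u\<close> False by simp
    qed
  qed
qed simp

lemma H_red_path:
  assumes b: "bandw b" and b0: "bandw b0" and "linked A b b0 Y"
    and "\<And>v. v \<in> set Q \<Longrightarrow> \<exists>c. target v = Syl c \<and> bandw c \<and> reach b0 c \<and> \<not> rot b0 c \<and> reach c b"
  shows "\<exists>Y'. foldr (\<lambda>u. H_red \<Lambda> B (target u)) Q (Syl Y) = Syl Y' \<and> linked A b b0 Y'"
  using assms(4)
proof (induction Q)
  case (Cons v Q)
  then obtain Y1 where Y1: "foldr (\<lambda>u. H_red \<Lambda> B (target u)) Q (Syl Y) = Syl Y1" "linked A b b0 Y1"
    by fastforce
  obtain c where c: "target v = Syl c" "bandw c" "reach b0 c" "\<not> rot b0 c" "reach c b"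
    using Cons.prems[of v] by auto
  from H_red_step[OF b b0 c(2,5,3,4) Y1(2)] show ?case using Y1(1) c(1) by simp
qed (use assms(3) in auto)

text \<open>The skeleton is formed in some unspecified order of the bands; the invariant is
  preserved for every order, since distinct representatives are not rotations of each other.\<close>

lemma skeleton_linked:
  assumes b: "bandw b" and b0: "bandw b0" and l: "linked A b b0 Y"
    and sq: "\<And>\<beta>. bandw \<beta> \<Longrightarrow> contains_pow 2 \<beta> Y \<Longrightarrow> reach \<beta> b"
  shows "\<exists>Y'. skeleton \<Lambda> B (Syl Y) = Syl Y' \<and> linked A b b0 Y'"
proof -
  let ?N = "\<lambda>\<beta>. band_mult \<Lambda> \<beta> (Syl Y)"
  let ?F = "\<lambda>bs. fold (\<lambda>\<beta>. red \<Lambda> \<beta> ^^ (?N \<beta> - 1)) bs (Syl Y)"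
  have "finite (bands_in \<Lambda> B (Syl Y))"
    using domestic reps unfolding domestic_def bands_in_def band_representatives_def
    by (metis (no_types, lifting) finite_subset mem_Collect_eq subsetD subsetI)
  then obtain bs0 where "set bs0 = bands_in \<Lambda> B (Syl Y)" "distinct bs0"
    using finite_distinct_list by blast
  then have "\<exists>z bs. distinct bs \<and> set bs = bands_in \<Lambda> B (Syl Y) \<and> z = ?F bs" by blast
  then have "\<exists>bs. distinct bs \<and> set bs = bands_in \<Lambda> B (Syl Y) \<and> skeleton \<Lambda> B (Syl Y) = ?F bs"
    unfolding skeleton_def by (rule someI_ex)
  then obtain bs where bs: "distinct bs" "set bs = bands_in \<Lambda> B (Syl Y)" "skeleton \<Lambda> B (Syl Y) = ?F bs"
    by blast
  have "Y \<noteq> []" using l band_nonempty[OF b0] unfolding linked_def by auto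
  then have strY: "is_string \<Lambda> (Syl Y)" using l unfolding linked_def by simp
  have inB: "\<beta> \<in> B" if "\<beta> \<in> set bs" for \<beta> using that bs(2) unfolding bands_in_def by blast
  have "\<exists>Y'. ?F bs = Syl Y' \<and> linked A b b0 Y'"
  proof (rule skeleton_fold[OF b b0 bs(1) _ _ l])
    fix \<beta> assume "\<beta> \<in> set bs"
    then obtain w where w: "\<beta> = Syl w" "bandw w" using inB reps_band by blast
    have con: "contains_pow (?N \<beta>) w Y" using band_mult_contains[OF strY band_nonempty[OF w(2)]] w(1) by simp
    have "reach w b" if "2 \<le> ?N \<beta>"
    proof (rule sq[OF w(2)])
      obtain w' where w': "rot w w'" "sublist (wpow (?N \<beta>) w') Y" using con unfolding contains_pow_def by blast
      have "wpow (?N \<beta>) w' = wpow 2 w' @ wpow (?N \<beta> - 2) w'" 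
        using that by (metis wpow_add le_add_diff_inverse)
      then have "sublist (wpow 2 w') Y" using w'(2) by (metis prefixI prefix_imp_sublist sublist_order.order_trans)
      then show "contains_pow 2 w Y" using w'(1) unfolding contains_pow_def by blast
    qed
    with con w show "\<exists>w. \<beta> = Syl w \<and> bandw w \<and> (2 \<le> ?N \<beta> \<longrightarrow> contains_pow (?N \<beta>) w Y \<and> reach w b)"
      by blast
  next
    fix \<beta> \<gamma> v w assume "\<beta> \<in> set bs" "\<gamma> \<in> set bs" "\<beta> = Syl v" "\<gamma> = Syl w" "rot v w"
    then show "\<beta> = \<gamma>" using inB reps_unique by metis
  qed
  with bs(3) show ?thesis by simp
qed

text \<open>For the trivial string, \<open>ub\<close> is \<open>b\<close> itself, a left substring
  of \<open>b @ b\<close>, and these two do not fork.\<close>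

lemma torsion_nontrivial:
  assumes "torsion \<Lambda> B u"
  shows "str u \<noteq> triv_at \<Lambda> (source u)"
proof
  assume t: "str u = triv_at \<Lambda> (source u)"
  obtain b where b: "source u = Syl b" "bandw b"
    using assms reps_band unfolding torsion_def weak_rhb_def by (metis (full_types))
  have ok: "str_ok (b @ b)" "b \<noteq> []" using band_wpow[OF b(2), of 2] band_nonempty[OF b(2)]
    by (simp_all add: numeral_2_eq_2)
  then have S: "is_string \<Lambda> (Syl b)" "is_string \<Lambda> (Syl (b @ b))" using str_ok_appendD(2) by auto
  have p1: "prd \<Lambda> [triv_at \<Lambda> (Syl b), Syl b] = Some (Syl b)"
    using S point_strings[OF S(1)] unfolding triv_at_def by (intro prd2I) simp_all
  have p2: "prd \<Lambda> [Syl b, Syl b] = Some (Syl (b @ b))"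
    using S end_start_pt[OF ok(1) ok(2) ok(2)] by (intro prd2I) simp_all
  have "fork \<Lambda> (Syl b) (Syl (b @ b))"
    using assms unfolding torsion_def Let_def b(1) t p1 p2 by simp
  then obtain w where w: "left_substring \<Lambda> w (Syl b)" "w \<noteq> Syl b"
    and max: "\<And>w'. left_substring \<Lambda> w' (Syl b) \<Longrightarrow> left_substring \<Lambda> w' (Syl (b @ b)) \<Longrightarrow> left_substring \<Lambda> w' w"
    unfolding fork_def proper_left_substring_def by blast
  have "left_substring \<Lambda> (Syl b) w" using max p1 p2 unfolding left_substring_def by blast
  then obtain x where "prd \<Lambda> [x, Syl b] = Some w" unfolding left_substring_def by blast
  from prd2_syls[OF this] have 1: "syls w = syls x @ b" by simp
  obtain x' where "prd \<Lambda> [x', w] = Some (Syl b)" using w(1) unfolding left_substring_def by blast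
  from prd2_syls[OF this] 1 have "syls w = b" by simp
  then have "w = Syl b" using ok(2) by (rule Syl_eqI)
  then show False using w(2) by blast
qed

lemma H_reduced_path_factorization:
  assumes u: "weak_bridge \<Lambda> B u \<or> torsion \<Lambda> B u" and "is_H_reduced_path \<Lambda> B u"
  shows "\<exists>u2 u1. nontrivial_factorization \<Lambda> B u u2 u1 \<and> exit_syl \<Lambda> u = exit_syl \<Lambda> u1"
proof -
  obtain P where P: "arrow_path \<Lambda> B P" "length P \<ge> 2" "source (hd P) = source u"
    "target (last P) = target u" "H_string \<Lambda> B P (str u)"
    using assms(2) unfolding is_H_reduced_path_def by blast
  define Q un where "Q = butlast P" and "un = last P"
  have PQ: "P = Q @ [un]" "Q \<noteq> []" using P(2) by (cases P rule: rev_cases; auto simp: Q_def un_def)+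
  have suc: "successively (\<lambda>u u'. target u = source u') Q" "target (last Q) = source un"
    using P(1) PQ unfolding arrow_path_def by (auto simp: successively_append_iff)
  have wbQ: "\<forall>v \<in> set Q. weak_bridge \<Lambda> B v" using P(1) unfolding arrow_path_def Q_def by blast
  have Triv_not_B: "Triv v i \<notin> B" for v i using reps_band by blast
  have un: "weak_bridge \<Lambda> B un \<or> torsion \<Lambda> B un" using P(1) unfolding arrow_path_def un_def by blast
  \<comment> \<open>Representatives of bands are never trivial strings, so the target decides which
    of the two kinds an arrow belongs to.\<close>
  have excl: "\<not> (weak_bridge \<Lambda> B a \<and> torsion \<Lambda> B a')" if "target a = target a'" for a a'
    using that Triv_not_B unfolding weak_bridge_def torsion_def weak_rhb_def by metis
  have tun: "target un = target u" using P(4) un_def by simp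
  have un': "weak_bridge \<Lambda> B un \<or> weak_rhb \<Lambda> B un \<and> str un \<noteq> triv_at \<Lambda> (source un)"
    using un torsion_nontrivial unfolding torsion_def by blast
  have u': "if weak_bridge \<Lambda> B un then weak_bridge \<Lambda> B u else weak_rhb \<Lambda> B u"
  proof (cases "weak_bridge \<Lambda> B un")
    case True
    then show ?thesis using u excl[OF tun] by auto
  next
    case False
    then have "torsion \<Lambda> B un" using un by blast
    then have "torsion \<Lambda> B u" using u excl[OF tun[symmetric]] by blast
    then show ?thesis using False unfolding torsion_def by simp
  qed
  have "source u \<in> B" "source un \<in> B"
    using u un unfolding weak_bridge_def torsion_def weak_rhb_def by metis+
  then obtain b0 b where b0: "source u = Syl b0" "bandw b0" and b: "source un = Syl b" "bandw b"
    using reps_band by metis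
  have hdQ: "source (hd Q) = Syl b0" using P(3) PQ b0(1) by simp
  have lastQ: "target (last Q) = Syl b" using suc(2) b(1) by simp
  have reachQ: "\<exists>c. target v = Syl c \<and> bandw c \<and> reach b0 c \<and> \<not> rot b0 c \<and> reach c b" if "v \<in> set Q" for v
    using path_reach[OF PQ(2) suc(1) wbQ that] hdQ lastQ by simp
  from reachQ[of "last Q"] PQ(2) lastQ have r: "reach b0 b" "\<not> rot b0 b" by auto
  obtain w where w: "prd \<Lambda> (concat (map (\<lambda>u. [target u, str u]) (rev Q)) @ [source (hd Q)]) = Some (Syl (b @ w))"
    and sw: "suffix b0 w" using path_prd[OF PQ(2) suc(1) wbQ] hdQ lastQ by auto
  have "prd \<Lambda> [target un, str un, source un] \<noteq> None"
    using un' unfolding weak_bridge_def weak_rhb_def by blast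
  then have zn: "prd \<Lambda> [target u, str un, Syl b] \<noteq> None" unfolding tun b(1) .
  define A where "A = syls (target u) @ syls (str un)"
  obtain x xs where x: "concat (map (\<lambda>u. [target u, str u]) (rev Q)) @ [source (hd Q)] = x # xs"
    using PQ(2) by (cases "concat (map (\<lambda>u. [target u, str u]) (rev Q)) @ [source (hd Q)]") auto
  have "prd \<Lambda> (target u # str un # x # xs) = Some (Syl (A @ b @ w))"
    using arrow_extend[OF b(2) zn, of x xs w] w unfolding x A_def by simp
  moreover have "concat (map (\<lambda>u. [target u, str u]) (rev P)) @ [source (hd P)] = target u # str un # x # xs"
    using x PQ tun by simp
  ultimately have ps: "path_string \<Lambda> P = Syl (A @ b @ w)" and okY: "str_ok (A @ b @ w)"
    unfolding path_string_def using prd_props[of "target u # str un # x # xs"] is_string_Syl by auto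
  have okb: "str_ok (b @ w)" using okY str_ok_appendD(2) by blast
  \<comment> \<open>Before any deletion the insertion point is right after the copy of
    \<open>b\<close> preceding the last arrow. That copy is counted in \<open>z1\<close>, so one
    inserted turn is needed to see \<open>A @ b\<close>.\<close>
  have l: "linked A b b0 (A @ b @ w)"
    unfolding linked_def
  proof (intro conjI exI)
    show "same_ext (b @ w) b" using reset[OF band_mixed[OF b(2)] okb] .
    show "prefix (A @ b) (A @ wpow 1 b)" by simp
    show "suffix b0 (A @ b @ w)" using sw by (simp add: suffix_appendI)
  qed (use okY in simp_all)
  have bn: "syls (target u) = [] \<or> bandw (syls (target u))"
    using un tun reps_band unfolding weak_bridge_def torsion_def weak_rhb_def by (metis syls.simps)
  have free: "band_free_word (syls (str un))"
    using un' band_free_iff unfolding weak_bridge_def weak_rhb_def by blast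
  \<comment> \<open>The skeleton deletes only bands that occur at least twice in a row, and these
    reach \<open>b\<close> by \<open>square_before_last_arrow\<close>.\<close>
  have "\<exists>Y'. skeleton \<Lambda> B (Syl (A @ b @ w)) = Syl Y' \<and> linked A b b0 Y'"
    using square_before_last_arrow[OF b(2) _ bn _ free, of _ w] okY
    by (intro skeleton_linked[OF b(2) b0(2) l]) (simp add: A_def)
  then obtain Y where Y: "skeleton \<Lambda> B (path_string \<Lambda> P) = Syl Y" "linked A b b0 Y" using ps by auto
  from H_red_path[OF b(2) b0(2) Y(2) reachQ] obtain L where
    L: "foldr (\<lambda>u. H_red \<Lambda> B (target u)) Q (Syl Y) = Syl L" "linked A b b0 L" by blast
  have "prd \<Lambda> [target u, str u, Syl b0] = Some (Syl L)"
    using P(3,4,5) L(1) Y(1) b0(1) unfolding H_string_def Q_def by simp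
  from arrow_prdD[OF this] have "L = syls (target u) @ syls (str u) @ b0" by simp
  with L(2) have "linked (syls (target u) @ syls (str un)) b b0 (syls (target u) @ syls (str u) @ b0)"
    unfolding A_def by simp
  from factorization[OF un' u' b0(1) b(1) tun r(2,1) this] show ?thesis by blast
qed

end

theorem proposition9p7:
  fixes K :: "'k ring"
    and \<Lambda> :: "('v, 'a) bound_quiver"
    and B :: "('v, 'a) qword set"
    and u :: "('v, 'a) arrow"
  assumes "string_algebra K \<Lambda>"
    and "domestic \<Lambda>"
    and "band_representatives \<Lambda> B"
  shows "(semi_bridge \<Lambda> B u \<longrightarrow> arch_bridge \<Lambda> B u) \<and>
         (torsion_reverse_semi_bridge \<Lambda> B u \<longrightarrow> torsion_reverse_arch_bridge \<Lambda> B u)"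
proof -
  interpret bridge_alg K \<Lambda> B
    using assms by unfold_locales
  show ?thesis
    using H_reduced_path_factorization
    unfolding semi_bridge_def arch_bridge_def torsion_reverse_semi_bridge_def
      torsion_reverse_arch_bridge_def by blast
qed

end
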